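(* The random transposition walk on the symmetric group $S_n$ (started at the identity) has cutoff in separation distance at $\frac12 n\log n$. That is, writing $\mathrm{sep}_n(t)$ for the separation distance from uniform after $t$ steps of the walk on $S_n$, for every $\epsilon\in(0,1)$, $$\lim_{n\to\infty}\mathrm{sep}_n\!\left(\left\lfloor(1-\epsilon)\tfrac12 n\log n\right\rfloor\right)=1\quad\text{and}\quad\lim_{n\to\infty}\mathrm{sep}_n\!\left(\left\lceil(1+\epsilon)\tfrac12 n\log n\right\rceil\right)=0.$$
   Context: The random transposition walk on $S_n$ is the random walk starting at the identity where each step multiplies the current permutation by an independent random element which is each transposition $(i\;j)$ with probability $\frac{2}{n^2}$, and the identity with probability $\frac1n$. The separation distance of a probability distribution $p$ on $S_n$ from the uniform distribution is $\max_{\pi\in S_n}\left(1-n!\,p(\pi)\right)$; $\mathrm{sep}_n(t)$ is this quantity for $p$ the law of the walk after $t$ steps. Here $\log$ is the natural logarithm. *)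

theory Defs
  imports "HOL-Probability.Probability" "HOL-Combinatorics.Combinatorics"
begin

text \<open>
  The symmetric group \<open>S\<^sub>n\<close> is the set of all \<open>\<pi> :: nat \<Rightarrow> nat\<close> with \<open>\<pi> permutes {1..n}\<close>;
  its product is composition.
\<close>

definition transpositions :: "nat \<Rightarrow> (nat \<Rightarrow> nat) set" where
  "transpositions n = {Transposition.transpose i j | i j. i \<in> {1..n} \<and> j \<in> {1..n} \<and> i \<noteq> j}"

definition rt_step_mass :: "nat \<Rightarrow> (nat \<Rightarrow> nat) \<Rightarrow> real" where
  "rt_step_mass n \<sigma> =
     (if \<sigma> = id then 1 / real n else if \<sigma> \<in> transpositions n then 2 / (real n)\<^sup>2 else 0)"

text \<open>
  For \<open>n \<ge> 1\<close> the masses add up to one, so that \<^const>\<open>embed_pmf\<close> yields the distribution with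
  exactly these masses (lemma \<open>pmf_rt_step\<close> below). For \<open>n = 0\<close> the value is irrelevant.
\<close>

definition rt_step :: "nat \<Rightarrow> (nat \<Rightarrow> nat) pmf" where
  "rt_step n = embed_pmf (rt_step_mass n)"

primrec rt_walk :: "nat \<Rightarrow> nat \<Rightarrow> (nat \<Rightarrow> nat) pmf" where
  "rt_walk n 0 = return_pmf id"
| "rt_walk n (Suc t) = bind_pmf (rt_walk n t) (\<lambda>\<pi>. map_pmf (\<lambda>\<tau>. \<tau> \<circ> \<pi>) (rt_step n))"

definition separation :: "nat \<Rightarrow> (nat \<Rightarrow> nat) pmf \<Rightarrow> real" where
  "separation n p = Max ((\<lambda>\<pi>. 1 - fact n * pmf p \<pi>) ` {\<pi>. \<pi> permutes {1..n}})"

definition sep :: "nat \<Rightarrow> nat \<Rightarrow> real" where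
  "sep n t = separation n (rt_walk n t)"

lemma transpose_eq_iff_pair:
  fixes a b i j :: nat
  assumes "a \<noteq> b"
  shows "Transposition.transpose i j = Transposition.transpose a b \<longleftrightarrow> (i = a \<and> j = b) \<or> (i = b \<and> j = a)"
proof
  assume eq: "Transposition.transpose i j = Transposition.transpose a b"
  have "Transposition.transpose i j a = b" "Transposition.transpose i j b = a"
    using eq by simp_all
  then show "(i = a \<and> j = b) \<or> (i = b \<and> j = a)"
    using assms by (auto simp: Transposition.transpose_def split: if_splits)
qed (auto simp: transpose_commute)

lemma pmf_uniform_pair_transpose:
  assumes "n \<ge> 1"
  shows "pmf (map_pmf (\<lambda>(i, j). Transposition.transpose i j) (pmf_of_set ({1..n} \<times> {1..n}))) \<sigma> = rt_step_mass n \<sigma>"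
proof -
  let ?A = "{1..n} \<times> {1..n}"
  let ?F = "(\<lambda>(i, j). Transposition.transpose i j) -` {\<sigma>} :: (nat \<times> nat) set"
  have ne: "?A \<noteq> {}" using assms by auto
  have L: "pmf (map_pmf (\<lambda>(i, j). Transposition.transpose i j) (pmf_of_set ?A)) \<sigma>
             = real (card (?A \<inter> ?F)) / (real n)\<^sup>2"
    using ne by (simp add: pmf_map measure_pmf_of_set power2_eq_square)
  consider "\<sigma> = id" | "\<sigma> \<noteq> id" "\<sigma> \<in> transpositions n" | "\<sigma> \<noteq> id" "\<sigma> \<notin> transpositions n"
    by blast
  then show ?thesis
  proof cases
    case 1
    have "i = j" if "Transposition.transpose i j = id" for i j :: nat
      using that by (metis id_apply transpose_apply_first)
    then have "?A \<inter> ?F = (\<lambda>i. (i, i)) ` {1..n}"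
      using 1 by auto
    then have "card (?A \<inter> ?F) = n"
      by (simp add: card_image inj_on_def)
    then show ?thesis
      unfolding L using 1 assms by (simp add: rt_step_mass_def power2_eq_square)
  next
    case 2
    then obtain a b where ab: "a \<in> {1..n}" "b \<in> {1..n}" "a \<noteq> b" "\<sigma> = Transposition.transpose a b"
      by (auto simp: transpositions_def)
    have "?A \<inter> ?F = {(a, b), (b, a)}"
      using ab transpose_eq_iff_pair[OF ab(3)] by auto
    then have "card (?A \<inter> ?F) = 2"
      using ab by simp
    then show ?thesis
      unfolding L using 2 by (simp add: rt_step_mass_def)
  next
    case 3
    have "(i, j) \<notin> ?F" if "i \<in> {1..n}" "j \<in> {1..n}" for i j
      using 3 that by (cases "i = j") (auto simp: transpositions_def)
    then have "?A \<inter> ?F = {}"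
      by blast
    then have "card (?A \<inter> ?F) = 0"
      by simp
    then show ?thesis
      unfolding L using 3 by (simp add: rt_step_mass_def)
  qed
qed

lemma rt_step_eq_uniform_pair:
  assumes "n \<ge> 1"
  shows "rt_step n = map_pmf (\<lambda>(i, j). Transposition.transpose i j) (pmf_of_set ({1..n} \<times> {1..n}))"
proof -
  have "rt_step_mass n = pmf (map_pmf (\<lambda>(i, j). Transposition.transpose i j) (pmf_of_set ({1..n} \<times> {1..n})))"
    using pmf_uniform_pair_transpose[OF assms] by auto
  then show ?thesis
    unfolding rt_step_def
    using type_definition.Rep_inverse[OF td_pmf_embed_pmf] by metis
qed

lemma pmf_rt_step:
  assumes "n \<ge> 1"
  shows "pmf (rt_step n) \<sigma> = rt_step_mass n \<sigma>"
  using assms by (simp only: rt_step_eq_uniform_pair pmf_uniform_pair_transpose)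

end

theory Submission
  imports Defs "HOL-Real_Asymp.Real_Asymp"
begin

text \<open>
  Lower bound: at time \<open>(1 - \<epsilon>) n ln n / 2\<close> the second moment method leaves at least two cards
  untouched with probability tending to one, whereas at least half of all permutations have at most
  one fixed point. Some permutation with at most one fixed point is therefore far too unlikely.

  Upper bound: run the walk until a cycle of length at least \<open>n / 4\<close> appears; while all
  cycles are shorter, the expected number of cycles drops by at least \<open>1/2\<close> per step, so this takes
  order \<open>n\<close> steps. By symmetry such a cycle is uniform among the cycles on its support. Two independent
  runs give random supports whose intersection \<open>K\<close> has at least \<open>n / 32\<close> elements
  (Chebyshev), and since a uniform cycle factors through a uniform cycle on any subset of its support,
  the product of two uniform cycles on \<open>K\<close> can be extracted. The number of factorisations of
  an even permutation into two long cycles is given by an integral over \<open>{0..1}\<close>, which shows that this product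
  has density at least \<open>k / (k + 3)\<close> with respect to the uniform distribution on the alternating
  group of \<open>K\<close>, where \<open>k\<close> is the size of \<open>K\<close>. Parity is repaired by one step that is either the
  identity or a transposition inside \<open>K\<close>. All this costs only \<open>o(n ln n)\<close> steps. Finally, the uniformly
  permuted set \<open>K\<close> grows to \<open>{1..n}\<close> by the coset decomposition of the symmetric group of
  \<open>insert x K\<close>: the identity and the transpositions \<open>(x y)\<close> with \<open>y \<in> K\<close>. As soon as \<open>2 * k \<ge> n\<close>, a set of size \<open>k\<close> grows with
  probability \<open>2 (n - k) (k + 1) / n\<^sup>2\<close> per step, and \<open>(n - k) / k\<close> is an eigenfunction of this pure birth
  chain with eigenvalue \<open>1 - 2 / n\<close>, which gives the time \<open>n ln n / 2\<close>.
\<close>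

section \<open>Orbits of a permutation multiplied by a transposition\<close>

text \<open>Growth from a single point would be too slow: a set of size k far below n gains a point
  with probability at most about 2 k / n, so reaching a fixed fraction of n would cost about n ln n
  / 2 further steps. The long cycles are there to supply a set of linear size cheaply. One uniform
  cycle does not do, since it lives on a single conjugacy class; a product of two cycles on the same
  set does, and because the supports of two runs differ, their intersection is the set on which both
  can be used. Separation at most 1 - c says exactly that every permutation has probability at least
  c / n!. All estimates therefore have the form "density f, followed by t more steps, is at least c
  times uniform". They are proved backwards in time, the last phase of the walk first. Origin of the
  constants: with all cycles below n / 4 a random pair joins two cycles with probability at least
  3/4, which gives the drift 1/2. Two supports of size n / 4 meet in n / 16 points on average, and
  half of this is n / 32.\<close>

abbreviation tr :: "'a \<Rightarrow> 'a \<Rightarrow> 'a \<Rightarrow> 'a" where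
  "tr \<equiv> Transposition.transpose"

lemma funpow_transpose_comp:
  assumes "\<And>j. 0 < j \<Longrightarrow> j < p \<Longrightarrow> (f ^^ j) a \<noteq> a \<and> (f ^^ j) a \<noteq> z"
  shows "j < p \<Longrightarrow> ((tr a z \<circ> f) ^^ j) a = (f ^^ j) a"
proof (induction j)
  case (Suc j)
  have "((tr a z \<circ> f) ^^ Suc j) a = tr a z ((f ^^ Suc j) a)"
    using Suc by (simp add: o_def)
  also have "\<dots> = (f ^^ Suc j) a"
    using assms[of "Suc j"] Suc.prems by (auto simp: Transposition.transpose_def)
  finally show ?case .
qed simp

lemma orbit_period:
  assumes "permutation f"
  obtains p where "0 < p" "(f ^^ p) a = a" "orbit f a = (\<lambda>j. (f ^^ j) a) ` {..<p}"
    "inj_on (\<lambda>j. (f ^^ j) a) {..<p}" "card (orbit f a) = p"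
proof -
  have self: "a \<in> orbit f a" using permutation_self_in_orbit[OF assms] .
  let ?p = "funpow_dist1 f a a"
  have 1: "0 < ?p" "(f ^^ ?p) a = a" using funpow_dist1_prop[OF self] by auto
  have 2: "orbit f a = (\<lambda>j. (f ^^ j) a) ` {..<?p}"
    using orbit_conv_funpow_dist1[OF self] by (simp add: atLeast0LessThan)
  have 3: "inj_on (\<lambda>j. (f ^^ j) a) {..<?p}"
    using inj_on_funpow_dist1[OF self] by (simp add: atLeast0LessThan)
  have 4: "card (orbit f a) = ?p" using 2 3 by (simp add: card_image)
  show thesis using that[OF 1 2 3 4] .
qed

lemma permutation_transpose_comp: "permutation f \<Longrightarrow> permutation (tr a z \<circ> f)"
  by (intro permutation_compose permutation_swap_id)

lemma transpose_comp_transpose_comp [simp]: "tr a z \<circ> (tr a z \<circ> f) = f"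
  by (metis comp_assoc id_comp transpose_comp_involutory)

lemma orbit_eq_orbit_iff:
  assumes "permutation f"
  shows "orbit f x = orbit f y \<longleftrightarrow> x \<in> orbit f y"
  by (metis assms cyclic_on_orbit' orbit_cyclic_eq3 permutation_self_in_orbit)

text \<open>The transposition acts after \<open>f\<close>, so along the \<open>f\<close>-cycle of
  \<open>a\<close> nothing changes until the step that would close it, which is diverted to
  \<open>z\<close>. The same holds with \<open>a\<close> and \<open>z\<close> exchanged, so the two
  cycles are joined.\<close>

lemma orbit_transpose_comp_merge:
  assumes f: "permutation f" and z: "z \<notin> orbit f a"
  shows "orbit (tr a z \<circ> f) a = orbit f a \<union> orbit f z"
proof -
  have half: "z \<in> orbit (tr a z \<circ> f) a \<and> orbit f a \<subseteq> orbit (tr a z \<circ> f) a" if z: "z \<notin> orbit f a" for a z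
  proof -
    let ?g = "tr a z \<circ> f"
    have g: "permutation ?g" using f by (rule permutation_transpose_comp)
    obtain p where p: "0 < p" "(f ^^ p) a = a" "orbit f a = (\<lambda>j. (f ^^ j) a) ` {..<p}"
      "inj_on (\<lambda>j. (f ^^ j) a) {..<p}"
      using orbit_period[OF f] by metis
    have ne: "(f ^^ j) a \<noteq> a \<and> (f ^^ j) a \<noteq> z" if "0 < j" "j < p" for j
    proof
      show "(f ^^ j) a \<noteq> a" using inj_onD[OF p(4), of j 0] that by auto
      show "(f ^^ j) a \<noteq> z" using that z p(3) by auto
    qed
    have eq: "(?g ^^ j) a = (f ^^ j) a" if "j < p" for j
      using funpow_transpose_comp[OF ne] that by blast
    have "(?g ^^ p) a = ?g ((?g ^^ (p - 1)) a)"
      using p(1) by (metis Suc_pred' comp_apply funpow.simps(2))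
    also have "\<dots> = tr a z ((f ^^ p) a)"
      using eq[of "p - 1"] p(1) by (metis Suc_pred' comp_apply diff_less funpow.simps(2) zero_less_one)
    finally have "(?g ^^ p) a = z" using p(2) by simp
    then have "z \<in> orbit ?g a" using p(1) unfolding orbit_altdef by (intro CollectI exI[of _ p]) simp
    moreover have "orbit f a \<subseteq> orbit ?g a"
    proof
      fix y assume "y \<in> orbit f a"
      then obtain j where j: "j < p" "y = (f ^^ j) a" unfolding p(3) by blast
      then have "y = (?g ^^ j) a" using eq by simp
      then show "y \<in> orbit ?g a" unfolding orbit_altdef_permutation[OF g] by blast
    qed
    ultimately show ?thesis by simp
  qed
  let ?g = "tr a z \<circ> f"
  have g: "permutation ?g" using f by (rule permutation_transpose_comp)
  have a: "a \<notin> orbit f z" using z f orbit_eq_orbit_iff permutation_self_in_orbit by metis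
  have "orbit f z \<subseteq> orbit ?g z"
    using half[OF a] by (simp add: transpose_commute)
  then have "orbit f a \<union> orbit f z \<subseteq> orbit ?g a"
    using half[OF z] orbit_eq_orbit_iff[OF g, of z a] by auto
  moreover have "orbit ?g a \<subseteq> orbit f a \<union> orbit f z"
  proof
    fix y assume "y \<in> orbit ?g a"
    then show "y \<in> orbit f a \<union> orbit f z"
    proof induction
      case base
      then show ?case using permutation_self_in_orbit[OF f]
        by (auto simp: Transposition.transpose_def intro: orbit.base)
    next
      case (step y)
      then show ?case using permutation_self_in_orbit[OF f]
        by (auto simp: Transposition.transpose_def intro: orbit.step)
    qed
  qed
  ultimately show ?thesis by blast
qed

lemma orbit_transpose_comp_other:
  assumes f: "permutation f" and "y \<notin> orbit f a" "y \<notin> orbit f z"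
  shows "orbit (tr a z \<circ> f) y = orbit f y"
proof (rule orbit_cong)
  show "y \<in> orbit f y" using permutation_self_in_orbit[OF f] .
  fix s assume "s \<in> orbit f y"
  then have "f s \<in> orbit f y" by (rule orbit.step)
  then have "f s \<noteq> a" "f s \<noteq> z"
    using assms orbit_eq_orbit_iff[OF f] permutation_self_in_orbit[OF f] by metis+
  then show "(tr a z \<circ> f) s = f s" by simp
qed

text \<open>The same walk along the cycle of \<open>a\<close> now meets \<open>z\<close> after
  \<open>i\<close> steps and is sent back to \<open>a\<close>, which cuts off a cycle of length
  \<open>i\<close>. The other half comes from the merging lemma applied to the product, as the
  transposition is an involution.\<close>

lemma orbit_transpose_comp_split:
  assumes f: "permutation f" and i: "0 < i" "i < card (orbit f a)"
  defines "z \<equiv> (f ^^ i) a"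
  shows "card (orbit (tr a z \<circ> f) a) = i" "z \<notin> orbit (tr a z \<circ> f) a"
    "orbit f a = orbit (tr a z \<circ> f) a \<union> orbit (tr a z \<circ> f) z"
    "card (orbit (tr a z \<circ> f) z) = card (orbit f a) - i"
proof -
  let ?g = "tr a z \<circ> f"
  have g: "permutation ?g" using f by (rule permutation_transpose_comp)
  obtain p where p: "0 < p" "(f ^^ p) a = a" "orbit f a = (\<lambda>j. (f ^^ j) a) ` {..<p}"
    "inj_on (\<lambda>j. (f ^^ j) a) {..<p}" "card (orbit f a) = p"
    using orbit_period[OF f] by metis
  have ip: "i < p" using i p by simp
  have ne: "(f ^^ j) a \<noteq> a \<and> (f ^^ j) a \<noteq> z" if "0 < j" "j < i" for j
    using inj_onD[OF p(4), of j 0] inj_onD[OF p(4), of j i] that ip unfolding z_def by auto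
  have eq: "(?g ^^ j) a = (f ^^ j) a" if "j < i" for j
    using funpow_transpose_comp[OF ne] that by blast
  have "(?g ^^ i) a = ?g ((?g ^^ (i - 1)) a)"
    using i(1) by (metis Suc_pred' comp_apply funpow.simps(2))
  also have "\<dots> = tr a z ((f ^^ i) a)"
    using eq[of "i - 1"] i(1) by (metis Suc_pred' comp_apply diff_less funpow.simps(2) zero_less_one)
  finally have "(?g ^^ i) a = a" unfolding z_def by simp
  then have orb: "orbit ?g a = (\<lambda>j. (f ^^ j) a) ` {..<i}"
    using orbit_altdef_bounded[of i ?g a] i(1) eq by force
  have inj: "inj_on (\<lambda>j. (f ^^ j) a) {..<i}"
    using p(4) ip by (auto intro: inj_on_subset)
  show c: "card (orbit ?g a) = i" using orb inj by (simp add: card_image)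
  show zn: "z \<notin> orbit ?g a"
  proof
    assume "z \<in> orbit ?g a"
    then obtain j where "j < i" "(f ^^ j) a = (f ^^ i) a" unfolding orb unfolding z_def by auto
    then show False using inj_onD[OF p(4), of j i] ip by auto
  qed
  have "orbit (tr a z \<circ> ?g) a = orbit ?g a \<union> orbit ?g z"
    by (rule orbit_transpose_comp_merge[OF g zn])
  then show u: "orbit f a = orbit ?g a \<union> orbit ?g z"
    by simp
  have "orbit ?g a \<inter> orbit ?g z = {}"
    using zn orbit_eq_orbit_iff[OF g] permutation_self_in_orbit[OF g] by blast
  moreover have "finite (orbit ?g a)" "finite (orbit ?g z)"
    by (auto intro: finite_orbit permutation_self_in_orbit[OF g])
  ultimately have "card (orbit f a) = card (orbit ?g a) + card (orbit ?g z)"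
    unfolding u by (rule_tac card_Un_disjoint) auto
  then show "card (orbit ?g z) = card (orbit f a) - i" using c by simp
qed

lemma orbit_transpose_comp_fixed:
  assumes "f permutes K" "finite K" "x \<notin> K" "a \<in> K"
  shows "orbit (tr x a \<circ> f) x = insert x (orbit f a)"
proof -
  have f: "permutation f" using assms permutation_permutes by blast
  have "f x = x" using assms by (simp add: permutes_not_in)
  then have o: "orbit f x = {x}" by (simp add: orbit_eq_singleton_iff)
  then have "a \<notin> orbit f x" using assms by auto
  from orbit_transpose_comp_merge[OF f this] show ?thesis using o by simp
qed

section \<open>The number of factorisations into two long cycles\<close>

definition cycles_on :: "'a set \<Rightarrow> ('a \<Rightarrow> 'a) set" where
  "cycles_on K = {c. c permutes K \<and> cyclic_on c K}"

lemma finite_cycles_on: "finite K \<Longrightarrow> finite (cycles_on K)"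
  using finite_permutations[of K] unfolding cycles_on_def by (rule rev_finite_subset) auto

lemma cycles_on_transpose_comp_iff:
  assumes f: "f permutes K" and K: "finite K" "x \<notin> K" "y \<in> K"
  shows "tr x y \<circ> f \<in> cycles_on (insert x K) \<longleftrightarrow> f \<in> cycles_on K"
proof -
  let ?g = "tr x y \<circ> f"
  have g: "?g permutes insert x K"
    using assms by (intro permutes_compose permutes_swap_id) (auto intro: permutes_subset)
  have o: "orbit ?g x = insert x (orbit f y)" using assms by (rule orbit_transpose_comp_fixed)
  have "orbit f y \<subseteq> K" using permutes_orbit_subset[OF f] K by auto
  then have "orbit ?g x = insert x K \<longleftrightarrow> orbit f y = K" using o K by auto
  moreover have "cyclic_on ?g (insert x K) \<longleftrightarrow> orbit ?g x = insert x K"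
    by (metis cyclic_on_singleI insertI1 orbit_cyclic_eq3)
  moreover have "cyclic_on f K \<longleftrightarrow> orbit f y = K"
    by (metis cyclic_on_singleI K(3) orbit_cyclic_eq3)
  ultimately show ?thesis using f g unfolding cycles_on_def by auto
qed

text \<open>Cutting \<open>x\<close> out of a cycle \<open>c\<close> leaves the cycle
  \<open>tr x (c x) \<circ> c\<close> on \<open>K\<close>, and this together with the image
  \<open>y = c x\<close> determines \<open>c\<close>. The recursion drives the counts of cycles and
  of factorisations.\<close>

lemma cycles_on_insert:
  assumes K: "finite K" "x \<notin> K" "K \<noteq> {}"
  shows "bij_betw (\<lambda>(y, f). tr x y \<circ> f) (K \<times> cycles_on K) (cycles_on (insert x K))"
proof (rule bij_betw_imageI)
  show "inj_on (\<lambda>(y, f). tr x y \<circ> f) (K \<times> cycles_on K)"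
  proof (rule inj_onI, clarify)
    fix y f y' f'
    assume A: "y \<in> K" "f \<in> cycles_on K" "y' \<in> K" "f' \<in> cycles_on K" "tr x y \<circ> f = tr x y' \<circ> f'"
    have "f x = x" "f' x = x" using A K unfolding cycles_on_def by (auto simp: permutes_not_in)
    then have "y = y'" using fun_cong[OF A(5), of x] by simp
    then show "y = y' \<and> f = f'" using A(5) by (metis transpose_comp_transpose_comp)
  qed
  show "(\<lambda>(y, f). tr x y \<circ> f) ` (K \<times> cycles_on K) = cycles_on (insert x K)"
  proof (intro set_eqI iffI)
    fix c assume "c \<in> (\<lambda>(y, f). tr x y \<circ> f) ` (K \<times> cycles_on K)"
    then show "c \<in> cycles_on (insert x K)"
      using cycles_on_transpose_comp_iff[OF _ K(1,2)] unfolding cycles_on_def[of K] by auto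
  next
    fix c assume c: "c \<in> cycles_on (insert x K)"
    then have p: "c permutes insert x K" and cyc: "cyclic_on c (insert x K)"
      unfolding cycles_on_def by auto
    have q: "tr x (c x) \<circ> c permutes K" using permutes_insert_lemma[OF p] .
    have "c x \<noteq> x"
    proof
      assume "c x = x"
      then have "orbit c x = {x}" by (simp add: orbit_eq_singleton_iff)
      then show False using orbit_cyclic_eq3[OF cyc, of x] K by auto
    qed
    then have y: "c x \<in> K" using p by (metis insertE insertI1 permutes_in_image)
    have "c = tr x (c x) \<circ> (tr x (c x) \<circ> c)" by simp
    moreover from this have "tr x (c x) \<circ> c \<in> cycles_on K"
      using cycles_on_transpose_comp_iff[OF q K(1,2) y] c by simp
    ultimately show "c \<in> (\<lambda>(y, f). tr x y \<circ> f) ` (K \<times> cycles_on K)" using y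
      by (intro image_eqI[where x="(c x, tr x (c x) \<circ> c)"]) auto
  qed
qed

lemma cycles_on_singleton: "cycles_on {x} = {id}"
proof -
  have "orbit id x = {x}" by (simp add: orbit_eq_singleton_iff)
  then have "cyclic_on id {x}" unfolding cyclic_on_def by simp
  then show ?thesis unfolding cycles_on_def by auto
qed

lemma card_cycles_on:
  assumes "finite K" "K \<noteq> {}"
  shows "card (cycles_on K) = fact (card K - 1)"
  using assms
proof (induction K rule: finite_ne_induct)
  case (singleton x)
  then show ?case by (simp add: cycles_on_singleton)
next
  case (insert x K)
  have "card (cycles_on (insert x K)) = card K * card (cycles_on K)"
    using bij_betw_same_card[OF cycles_on_insert[of K x]] insert.hyps by (simp add: card_cartesian_product)
  moreover have "card K > 0" using insert.hyps by (simp add: card_gt_0_iff)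
  ultimately show ?case using insert by (simp add: fact_reduce[of "card K"])
qed

text \<open>The inverse of a cycle on \<open>K\<close> is again one, so through
  \<open>\<pi> = (\<pi> \<circ> c) \<circ> inv c\<close> this is the number of factorisations of
  \<open>\<pi>\<close> into two cycles on \<open>K\<close>.\<close>

definition cycle_factor_count :: "'a set \<Rightarrow> ('a \<Rightarrow> 'a) \<Rightarrow> nat" where
  "cycle_factor_count K \<pi> = card {c \<in> cycles_on K. \<pi> \<circ> c \<in> cycles_on K}"

lemma card_cycles_on_insert_filter:
  assumes K: "finite K" "x \<notin> K" "K \<noteq> {}"
  shows "card {c \<in> cycles_on (insert x K). P c} = (\<Sum>y\<in>K. card {f \<in> cycles_on K. P (tr x y \<circ> f)})"
proof -
  note b = cycles_on_insert[OF K]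
  have "{c \<in> cycles_on (insert x K). P c} = (\<lambda>(y, f). tr x y \<circ> f) ` (SIGMA y:K. {f \<in> cycles_on K. P (tr x y \<circ> f)})"
    unfolding bij_betw_imp_surj_on[OF b, symmetric] by auto
  also have "card \<dots> = card (SIGMA y:K. {f \<in> cycles_on K. P (tr x y \<circ> f)})"
    by (intro card_image inj_on_subset[OF bij_betw_imp_inj_on[OF b]]) auto
  also have "\<dots> = (\<Sum>y\<in>K. card {f \<in> cycles_on K. P (tr x y \<circ> f)})"
    using K finite_cycles_on[of K] by (intro card_SigmaI) auto
  finally show ?thesis .
qed

lemma transpose_conj:
  assumes "bij f"
  shows "f \<circ> tr a b = tr (f a) (f b) \<circ> f"
  using assms by (auto simp: fun_eq_iff Transposition.transpose_def bij_def inj_eq)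

text \<open>As \<open>\<rho>\<close> fixes \<open>x\<close>, moving \<open>tr x y\<close> across it
  gives \<open>tr x (\<rho> y)\<close>, and \<open>x\<close> can be cut out of both cycles at once.
  Each of the \<open>card K\<close> choices of \<open>y\<close> contributes the same number.\<close>

lemma cycle_factor_count_fixed:
  assumes K: "finite K" "x \<notin> K" "K \<noteq> {}" and r: "\<rho> permutes K"
  shows "cycle_factor_count (insert x K) \<rho> = card K * cycle_factor_count K \<rho>"
proof -
  have "card {f \<in> cycles_on K. \<rho> \<circ> (tr x y \<circ> f) \<in> cycles_on (insert x K)} = cycle_factor_count K \<rho>" if "y \<in> K" for y
  proof -
    have "\<rho> \<circ> (tr x y \<circ> f) = tr x (\<rho> y) \<circ> (\<rho> \<circ> f)" for f :: "'a \<Rightarrow> 'a"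
      using transpose_conj[OF permutes_bij[OF r], of x y] permutes_not_in[OF r K(2)] by (simp flip: comp_assoc)
    moreover have "tr x (\<rho> y) \<circ> (\<rho> \<circ> f) \<in> cycles_on (insert x K) \<longleftrightarrow> \<rho> \<circ> f \<in> cycles_on K" if "f \<in> cycles_on K" for f
      using that r \<open>y \<in> K\<close> K
      by (intro cycles_on_transpose_comp_iff permutes_compose) (auto simp: cycles_on_def permutes_in_image)
    ultimately show ?thesis unfolding cycle_factor_count_def by (intro arg_cong[where f=card]) auto
  qed
  then show ?thesis unfolding cycle_factor_count_def[of "insert x K"]
    by (subst card_cycles_on_insert_filter[OF K]) simp
qed

text \<open>After moving \<open>tr x y\<close> across \<open>\<rho>\<close>, two transpositions
  containing \<open>x\<close> meet. Unless they cancel, one of them can be traded for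
  \<open>tr a (\<rho> y)\<close>, which lives on \<open>K\<close>, and then \<open>x\<close> is cut
  out as before; \<open>z = \<rho> y\<close> runs through \<open>K - {a}\<close>.\<close>

lemma cycle_factor_count_transpose:
  assumes K: "finite K" "x \<notin> K" and r: "\<rho> permutes K" and a: "a \<in> K"
  shows "cycle_factor_count (insert x K) (tr x a \<circ> \<rho>) = (\<Sum>z\<in>K - {a}. cycle_factor_count K (tr a z \<circ> \<rho>))"
proof -
  have ne: "K \<noteq> {}" using a by auto
  have ax: "a \<noteq> x" using a K by auto
  define T where "T = (\<lambda>z. if z = a then 0 else cycle_factor_count K (tr a z \<circ> \<rho>))"
  have "card {f \<in> cycles_on K. tr x a \<circ> \<rho> \<circ> (tr x y \<circ> f) \<in> cycles_on (insert x K)} = T (\<rho> y)" if y: "y \<in> K" for y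
  proof -
    have e: "tr x a \<circ> \<rho> \<circ> (tr x y \<circ> f) = tr x a \<circ> (tr x (\<rho> y) \<circ> (\<rho> \<circ> f))" for f :: "'a \<Rightarrow> 'a"
      using transpose_conj[OF permutes_bij[OF r], of x y] permutes_not_in[OF r K(2)]
      by (simp add: comp_assoc) (simp flip: comp_assoc)
    have ry: "\<rho> y \<in> K" using y r by (simp add: permutes_in_image)
    show ?thesis
    proof (cases "\<rho> y = a")
      \<comment> \<open>The two transpositions cancel, which leaves \<open>x\<close> as a fixed
        point of the product, so this \<open>y\<close> contributes nothing.\<close>
      case True
      have "\<not> \<rho> \<circ> f \<in> cycles_on (insert x K)" if "f \<in> cycles_on K" for f
      proof
        assume "\<rho> \<circ> f \<in> cycles_on (insert x K)"
        then have "orbit (\<rho> \<circ> f) x = insert x K" unfolding cycles_on_def by (auto dest: orbit_cyclic_eq3)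
        moreover have "(\<rho> \<circ> f) x = x"
          using that r K(2) by (auto simp: cycles_on_def permutes_not_in)
        ultimately show False using a K(2) orbit_eq_singleton_iff[of "\<rho> \<circ> f" x] by auto
      qed
      then have "{f \<in> cycles_on K. \<rho> \<circ> f \<in> cycles_on (insert x K)} = {}" by blast
      then have "card {f \<in> cycles_on K. \<rho> \<circ> f \<in> cycles_on (insert x K)} = 0" by (simp only: card.empty)
      then show ?thesis using True by (simp add: e T_def)
    next
      case False
      have e2: "tr x a \<circ> (tr x (\<rho> y) \<circ> g) = tr x (\<rho> y) \<circ> (tr a (\<rho> y) \<circ> g)" for g :: "'a \<Rightarrow> 'a"
        using False ax ry K(2) by (auto simp: fun_eq_iff Transposition.transpose_def)
      have "tr x (\<rho> y) \<circ> (tr a (\<rho> y) \<circ> (\<rho> \<circ> f)) \<in> cycles_on (insert x K) \<longleftrightarrow> tr a (\<rho> y) \<circ> \<rho> \<circ> f \<in> cycles_on K"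
        if "f \<in> cycles_on K" for f
        unfolding comp_assoc using that r a ry K
        by (intro cycles_on_transpose_comp_iff permutes_compose permutes_swap_id) (auto simp: cycles_on_def)
      then show ?thesis unfolding e e2 cycle_factor_count_def T_def using False
        by (auto intro!: arg_cong[where f=card])
    qed
  qed
  then have "cycle_factor_count (insert x K) (tr x a \<circ> \<rho>) = (\<Sum>y\<in>K. T (\<rho> y))"
    unfolding cycle_factor_count_def[of "insert x K"]
    by (subst card_cycles_on_insert_filter[OF K ne]) simp
  also have "\<dots> = (\<Sum>y\<in>K. T y)"
    by (rule sum.reindex_bij_betw[OF permutes_imp_bij[OF r]])
  also have "\<dots> = (\<Sum>z\<in>K - {a}. cycle_factor_count K (tr a z \<circ> \<rho>))"
    using a K(1) by (subst sum.remove[of K a]) (auto simp: T_def intro!: sum.cong)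
  finally show ?thesis .
qed

lemma orbit_image_transpose_comp_merge:
  assumes f: "permutation f" and z: "z \<notin> orbit f a" and a: "a \<in> S"
  shows "orbit (tr a z \<circ> f) ` S = insert (orbit f a \<union> orbit f z) (orbit f ` S - {orbit f a, orbit f z})"
    and "orbit f a \<union> orbit f z \<notin> orbit f ` S"
proof -
  let ?g = "tr a z \<circ> f"
  have g: "permutation ?g" using f by (rule permutation_transpose_comp)
  have o: "orbit ?g a = orbit f a \<union> orbit f z" using f z by (rule orbit_transpose_comp_merge)
  have 1: "orbit ?g y = (if y \<in> orbit f a \<union> orbit f z then orbit f a \<union> orbit f z else orbit f y)" for y
    using o orbit_eq_orbit_iff[OF g, of y a] orbit_transpose_comp_other[OF f, of y a z] by auto
  have 2: "y \<in> orbit f a \<union> orbit f z \<longleftrightarrow> orbit f y \<in> {orbit f a, orbit f z}" for y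
    using orbit_eq_orbit_iff[OF f] by auto
  have 3: "a \<in> orbit f a \<union> orbit f z" using permutation_self_in_orbit[OF f] by auto
  show "orbit ?g ` S = insert (orbit f a \<union> orbit f z) (orbit f ` S - {orbit f a, orbit f z})"
    using 1 2 3 a by (auto simp: image_iff)
  show "orbit f a \<union> orbit f z \<notin> orbit f ` S"
  proof
    assume "orbit f a \<union> orbit f z \<in> orbit f ` S"
    then obtain y where y: "orbit f a \<union> orbit f z = orbit f y" by auto
    then have "a \<in> orbit f y" "z \<in> orbit f y" using permutation_self_in_orbit[OF f] by auto
    then show False using z orbit_eq_orbit_iff[OF f] permutation_self_in_orbit[OF f] by metis
  qed
qed

section \<open>The polynomial of a cycle type and its recursion\<close>

definition orbit_factor :: "nat \<Rightarrow> real \<Rightarrow> real" where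
  "orbit_factor q x = (1 - x) ^ q - (- x) ^ q"

text \<open>For \<open>f\<close> permuting a nonempty \<open>K\<close> with k elements this is the
  sum over r < k of \<open>\<chi>_r(f) x^r (1 - x)^(k-1-r)\<close>, where \<open>\<chi>_r\<close> is
  the character of the hook shape with r boxes below the first row. Long cycles see only hook
  characters, and the weights 1 / binomial(k-1, r) in Frobenius' formula for the number of
  factorisations are Beta integrals. This is the origin of the integral over
  \<open>{0..1}\<close>.\<close>

definition orbit_poly :: "('a \<Rightarrow> 'a) \<Rightarrow> 'a set \<Rightarrow> real \<Rightarrow> real" where
  "orbit_poly f K x = (\<Prod>Q\<in>orbit f ` K. orbit_factor (card Q) x)"

lemma orbit_factor_0 [simp]: "orbit_factor 0 x = 0"
  and orbit_factor_1 [simp]: "orbit_factor (Suc 0) x = 1"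
  by (simp_all add: orbit_factor_def)

text \<open>With u = 1 - x and v = - x one has u - v = 1, so \<open>orbit_factor\<close> is the
  Lucas sequence (u^q - v^q) / (u - v). This is its addition formula, the analogue of the one for
  Fibonacci numbers.\<close>

lemma orbit_factor_add:
  assumes "0 < m"
  shows "orbit_factor (m + p) x =
    orbit_factor (p + 1) x * orbit_factor m x - (1 - x) * (- x) * orbit_factor p x * orbit_factor (m - 1) x"
proof -
  obtain l where l: "m = Suc l" using assms gr0_implies_Suc by blast
  define A B C D where "A = (1 - x) ^ l" "B = (- x) ^ l" "C = (1 - x) ^ p" "D = (- x) ^ p"
  have "orbit_factor (m + p) x = (1 - x) * A * C - (- x) * B * D"
    by (simp add: orbit_factor_def l power_add A_B_C_D_def)
  also have "\<dots> = ((1 - x) * C - (- x) * D) * ((1 - x) * A - (- x) * B)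
      - (1 - x) * (- x) * (C - D) * (A - B)"
    by algebra
  finally show ?thesis by (simp add: orbit_factor_def l A_B_C_D_def)
qed

lemma orbit_factor_Suc: 
  "orbit_factor (Suc p) x = (\<Sum>i\<le>p. (1 - x) ^ i * (- x) ^ (p - i))"
  unfolding orbit_factor_def using power_diff_sumr2[of "1 - x" "Suc p" "- x"]
  by (simp add: lessThan_Suc_atMost mult.commute del: power_Suc sum.lessThan_Suc)

text \<open>Expanding a product leaves u^p + v^p, with u = 1 - x and v = - x, minus two mixed terms;
  each kind of mixed term sums to \<open>orbit_factor (p + 1) x\<close>.\<close>

lemma sum_orbit_factor_split:
  assumes "0 < p"
  shows "(\<Sum>i\<in>{0<..<p}. orbit_factor i x * orbit_factor (p - i) x) =
    (real p + 1) * ((1 - x) ^ p + (- x) ^ p) - 2 * orbit_factor (p + 1) x"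
proof -
  have "(\<Sum>i\<in>{0<..<p}. orbit_factor i x * orbit_factor (p - i) x) =
      (\<Sum>i\<le>p. orbit_factor i x * orbit_factor (p - i) x)"
  proof (rule sum.mono_neutral_left)
    show "\<forall>i\<in>{..p} - {0<..<p}. orbit_factor i x * orbit_factor (p - i) x = 0"
    proof
      fix i assume "i \<in> {..p} - {0<..<p}"
      then have "i = 0 \<or> i = p" by auto
      then show "orbit_factor i x * orbit_factor (p - i) x = 0" by auto
    qed
  qed auto
  also have "\<dots> = (\<Sum>i\<le>p. ((1 - x) ^ p + (- x) ^ p) - (1 - x) ^ i * (- x) ^ (p - i)
      - (1 - x) ^ (p - i) * (- x) ^ (p - (p - i)))"
  proof (intro sum.cong refl)
    fix i assume "i \<in> {..p}"
    then have "(1 - x) ^ p = (1 - x) ^ i * (1 - x) ^ (p - i)" "(- x) ^ p = (- x) ^ i * (- x) ^ (p - i)"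
      and "p - (p - i) = i"
      by (simp_all flip: power_add)
    then show "orbit_factor i x * orbit_factor (p - i) x = ((1 - x) ^ p + (- x) ^ p)
      - (1 - x) ^ i * (- x) ^ (p - i) - (1 - x) ^ (p - i) * (- x) ^ (p - (p - i))"
      by (simp add: orbit_factor_def algebra_simps)
  qed
  also have "\<dots> = (real p + 1) * ((1 - x) ^ p + (- x) ^ p) - orbit_factor (Suc p) x
      - (\<Sum>i\<le>p. (1 - x) ^ (p - i) * (- x) ^ (p - (p - i)))"
    by (simp add: sum_subtractf sum.distrib orbit_factor_Suc algebra_simps)
  also have "(\<Sum>i\<le>p. (1 - x) ^ (p - i) * (- x) ^ (p - (p - i))) = orbit_factor (Suc p) x"
    unfolding orbit_factor_Suc
    by (rule sum.reindex_bij_witness[where i="\<lambda>i. p - i" and j="\<lambda>i. p - i"]) auto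
  finally show ?thesis by simp
qed

lemma orbit_factor_deriv:
  "(orbit_factor q has_field_derivative - (real q * orbit_factor (q - 1) x)) (at x)"
  unfolding orbit_factor_def[abs_def]
  by (rule derivative_eq_intros refl | simp add: algebra_simps)+

text \<open>The right-hand side is the derivative of
  \<open>(1 - x) * (- x) * orbit_factor p x\<close>. The left-hand side is what remains of the
  recursion after the contributions of the other cycles have been taken out.\<close>

lemma orbit_factor_bracket:
  assumes "0 < p"
  shows "(real p + 1) * ((1 - x) ^ p + (- x) ^ p) - 2 * orbit_factor (p + 1) x - real p * orbit_factor (p + 1) x
    = - ((1 - x) + (- x)) * orbit_factor p x - (1 - x) * (- x) * (real p * orbit_factor (p - 1) x)"
proof -
  obtain l where l: "p = Suc l" using assms gr0_implies_Suc by blast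
  define A B where "A = (1 - x) ^ l" "B = (- x) ^ l"
  show ?thesis
    unfolding orbit_factor_def l by (simp add: A_B_def[symmetric]) algebra
qed

text \<open>A point \<open>z\<close> outside the cycle of \<open>a\<close> merges two cycles, with
  the same effect for all points of one cycle \<open>Q\<close>. A point
  \<open>(\<rho> ^^ i) a\<close> splits the cycle of \<open>a\<close> into lengths \<open>i\<close>
  and \<open>p - i\<close>.\<close>

lemma orbit_poly_transpose_sum:
  fixes \<rho> :: "'a \<Rightarrow> 'a"
  assumes r: "\<rho> permutes K" and K: "finite K" and a: "a \<in> K"
  defines "p \<equiv> card (orbit \<rho> a)" and "R \<equiv> orbit \<rho> ` K - {orbit \<rho> a}"
  shows "(\<Sum>z\<in>K - {a}. orbit_poly (tr a z \<circ> \<rho>) K x) =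
    (\<Sum>Q\<in>R. real (card Q) * orbit_factor (p + card Q) x * (\<Prod>Q'\<in>R - {Q}. orbit_factor (card Q') x))
    + (\<Sum>i\<in>{0<..<p}. orbit_factor i x * orbit_factor (p - i) x) * (\<Prod>Q\<in>R. orbit_factor (card Q) x)"
proof -
  have f: "permutation \<rho>" using r K permutation_permutes by blast
  have finR: "finite R" using K by (simp add: R_def)
  have sub: "orbit \<rho> y \<subseteq> K" if "y \<in> K" for y using permutes_orbit_subset[OF r that] .
  have fin: "finite (orbit \<rho> y)" for y using finite_orbit[OF permutation_self_in_orbit[OF f]] .
  note self = permutation_self_in_orbit[OF f]
  note oeq = orbit_eq_orbit_iff[OF f]
  have K_eq: "K - {a} = (orbit \<rho> a - {a}) \<union> \<Union>R"
  proof (intro set_eqI iffI)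
    fix y assume y: "y \<in> K - {a}"
    show "y \<in> (orbit \<rho> a - {a}) \<union> \<Union>R"
    proof (cases "y \<in> orbit \<rho> a")
      case False
      then have "orbit \<rho> y \<in> R" using y oeq by (auto simp: R_def)
      then show ?thesis using self by blast
    qed (use y in auto)
  next
    fix y assume "y \<in> (orbit \<rho> a - {a}) \<union> \<Union>R"
    then show "y \<in> K - {a}"
    proof
      assume "y \<in> \<Union>R"
      then obtain w where w: "w \<in> K" "y \<in> orbit \<rho> w" "orbit \<rho> w \<noteq> orbit \<rho> a" by (auto simp: R_def)
      then show ?thesis using sub[OF w(1)] oeq[of y w] oeq[of a w] by (metis DiffI singletonD subsetD)
    qed (use sub a in auto)
  qed
  have dis: "(orbit \<rho> a - {a}) \<inter> \<Union>R = {}"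
    unfolding R_def using oeq by (auto; metis)
  have pd: "\<forall>A\<in>R. \<forall>B\<in>R. A \<noteq> B \<longrightarrow> A \<inter> B = {}"
    unfolding R_def using oeq by (auto; metis)
  have finU: "finite (\<Union>R)" using finR fin by (auto simp: R_def)
  have "(\<Sum>z\<in>K - {a}. orbit_poly (tr a z \<circ> \<rho>) K x) =
    (\<Sum>z\<in>orbit \<rho> a - {a}. orbit_poly (tr a z \<circ> \<rho>) K x) + (\<Sum>Q\<in>R. \<Sum>z\<in>Q. orbit_poly (tr a z \<circ> \<rho>) K x)"
  proof -
    have "(\<Sum>z\<in>\<Union>R. orbit_poly (tr a z \<circ> \<rho>) K x) = (\<Sum>Q\<in>R. \<Sum>z\<in>Q. orbit_poly (tr a z \<circ> \<rho>) K x)"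
      using pd fin by (subst sum.Union_disjoint) (auto simp: R_def)
    then show ?thesis unfolding K_eq using dis finU fin by (subst sum.union_disjoint) auto
  qed
  also have "(\<Sum>Q\<in>R. \<Sum>z\<in>Q. orbit_poly (tr a z \<circ> \<rho>) K x) =
    (\<Sum>Q\<in>R. real (card Q) * orbit_factor (p + card Q) x * (\<Prod>Q'\<in>R - {Q}. orbit_factor (card Q') x))"
  proof (intro sum.cong refl)
    fix Q assume Q: "Q \<in> R"
    have "orbit_poly (tr a z \<circ> \<rho>) K x = orbit_factor (p + card Q) x * (\<Prod>Q'\<in>R - {Q}. orbit_factor (card Q') x)"
      if "z \<in> Q" for z
    proof -
      obtain w where w: "Q = orbit \<rho> w" "orbit \<rho> w \<noteq> orbit \<rho> a" using Q by (auto simp: R_def)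
      have oz: "orbit \<rho> z = Q" using that w oeq[of z w] by simp
      then have oz: "orbit \<rho> z = Q" "z \<notin> orbit \<rho> a" using w oeq[of z a] by auto
      have d: "orbit \<rho> a \<inter> Q = {}" using oz oeq by (metis disjoint_iff)
      note m = orbit_image_transpose_comp_merge[OF f oz(2) a, unfolded oz(1)]
      have "orbit (tr a z \<circ> \<rho>) ` K = insert (orbit \<rho> a \<union> Q) (R - {Q})"
        unfolding m R_def by auto
      moreover have "orbit \<rho> a \<union> Q \<notin> R - {Q}" using m(2) by (auto simp: R_def)
      moreover have "card (orbit \<rho> a \<union> Q) = p + card Q"
        unfolding p_def using d fin[of a] fin[of z] oz by (auto intro: card_Un_disjoint)
      ultimately show ?thesis using finR by (simp add: orbit_poly_def)
    qed
    then show "(\<Sum>z\<in>Q. orbit_poly (tr a z \<circ> \<rho>) K x) =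
      real (card Q) * orbit_factor (p + card Q) x * (\<Prod>Q'\<in>R - {Q}. orbit_factor (card Q') x)"
      by simp
  qed
  also have "(\<Sum>z\<in>orbit \<rho> a - {a}. orbit_poly (tr a z \<circ> \<rho>) K x) =
    (\<Sum>i\<in>{0<..<p}. orbit_poly (tr a ((\<rho> ^^ i) a) \<circ> \<rho>) K x)"
  proof -
    obtain q where q: "0 < q" "(\<rho> ^^ q) a = a" "orbit \<rho> a = (\<lambda>j. (\<rho> ^^ j) a) ` {..<q}"
      "inj_on (\<lambda>j. (\<rho> ^^ j) a) {..<q}" "card (orbit \<rho> a) = q"
      using orbit_period[OF f] by metis
    have s: "{..<q} = insert 0 {0<..<q}" using q(1) by auto
    have pq: "p = q" using q by (simp add: p_def)
    have "orbit \<rho> a - {a} = (\<lambda>j. (\<rho> ^^ j) a) ` {0<..<p}"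
    proof -
      have "a \<notin> (\<lambda>j. (\<rho> ^^ j) a) ` {0<..<p}"
      proof
        assume "a \<in> (\<lambda>j. (\<rho> ^^ j) a) ` {0<..<p}"
        then obtain j where "0 < j" "j < q" "(\<rho> ^^ j) a = (\<rho> ^^ 0) a" unfolding pq by auto
        then show False using inj_onD[OF q(4), of j 0] q(1) by auto
      qed
      then show ?thesis unfolding q(3) s pq by auto
    qed
    moreover have "inj_on (\<lambda>j. (\<rho> ^^ j) a) {0<..<p}" using q(4) pq by (auto intro: inj_on_subset)
    ultimately show ?thesis by (simp add: sum.reindex)
  qed
  also have "\<dots> = (\<Sum>i\<in>{0<..<p}. orbit_factor i x * orbit_factor (p - i) x * (\<Prod>Q\<in>R. orbit_factor (card Q) x))"
  proof (intro sum.cong refl)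
    fix i assume "i \<in> {0<..<p}"
    then have i: "0 < i" "i < card (orbit \<rho> a)" by (auto simp: p_def)
    define z where "z = (\<rho> ^^ i) a"
    let ?g = "tr a z \<circ> \<rho>"
    note sp = orbit_transpose_comp_split[OF f i, folded z_def]
    have g: "permutation ?g" using f by (rule permutation_transpose_comp)
    have zK: "z \<in> K" using sub[OF a] self[of a] unfolding z_def by (meson funpow_in_orbit subsetD)
    have m: "orbit \<rho> ` K = insert (orbit \<rho> a) (orbit ?g ` K - {orbit ?g a, orbit ?g z})"
       "orbit \<rho> a \<notin> orbit ?g ` K"
      using orbit_image_transpose_comp_merge[OF g sp(2) a] sp(3) by auto
    have "R = orbit ?g ` K - {orbit ?g a, orbit ?g z}"
      unfolding R_def m(1) using m(2) by auto
    then have "orbit ?g ` K = insert (orbit ?g a) (insert (orbit ?g z) R)"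
      using a zK by auto
    moreover have "orbit ?g a \<notin> insert (orbit ?g z) R" "orbit ?g z \<notin> R"
      using \<open>R = _\<close> sp(2) permutation_self_in_orbit[OF g, of z] by auto
    ultimately show "orbit_poly (tr a ((\<rho> ^^ i) a) \<circ> \<rho>) K x =
      orbit_factor i x * orbit_factor (p - i) x * (\<Prod>Q\<in>R. orbit_factor (card Q) x)"
      using finR sp(1,4) by (simp add: orbit_poly_def p_def flip: z_def)
  qed
  finally show ?thesis unfolding sum_distrib_right by (rule trans[OF _ add.commute])
qed

lemma card_eq_sum_orbits:
  assumes "f permutes K" "finite K"
  shows "card K = (\<Sum>Q\<in>orbit f ` K. card Q)"
proof -
  have p: "permutation f" using assms permutation_permutes by blast
  have "\<Union>(orbit f ` K) = K"
    using permutes_orbit_subset[OF assms(1)] permutation_self_in_orbit[OF p] by blast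
  moreover have "card (\<Union>(orbit f ` K)) = (\<Sum>Q\<in>orbit f ` K. card Q)"
  proof (rule card_Union_disjoint)
    show "pairwise disjnt (orbit f ` K)"
      unfolding pairwise_def disjnt_def using orbit_eq_orbit_iff[OF p] by (auto; metis)
  qed (auto intro: finite_orbit permutation_self_in_orbit[OF p])
  ultimately show ?thesis by simp
qed

lemma orbit_poly_insert_fixed:
  assumes "\<rho> permutes K" "finite K" "x \<notin> K"
  shows "orbit_poly \<rho> (insert x K) = orbit_poly \<rho> K"
proof -
  have "orbit \<rho> x = {x}" using assms by (simp add: orbit_eq_singleton_iff permutes_not_in)
  moreover have "{x} \<notin> orbit \<rho> ` K" using permutes_orbit_subset[OF assms(1)] assms(3) by blast
  ultimately show ?thesis using assms(2) by (auto simp: orbit_poly_def)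
qed

lemma orbit_image_insert_transpose:
  assumes r: "\<rho> permutes K" and K: "finite K" "x \<notin> K" and a: "a \<in> K"
  shows "orbit (tr x a \<circ> \<rho>) ` insert x K = insert (insert x (orbit \<rho> a)) (orbit \<rho> ` K - {orbit \<rho> a})"
    and "insert x (orbit \<rho> a) \<notin> orbit \<rho> ` K" and "card (insert x (orbit \<rho> a)) = Suc (card (orbit \<rho> a))"
proof -
  have f: "permutation \<rho>" using r K permutation_permutes by blast
  have o: "orbit \<rho> x = {x}" using r K by (simp add: orbit_eq_singleton_iff permutes_not_in)
  have nx: "a \<notin> orbit \<rho> x" using o a K by auto
  note m = orbit_image_transpose_comp_merge[OF f nx insertI1, of K, unfolded o]
  have sub: "orbit \<rho> y \<subseteq> K" if "y \<in> K" for y using permutes_orbit_subset[OF r that] .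
  show "insert x (orbit \<rho> a) \<notin> orbit \<rho> ` K" using sub K by auto
  show "orbit (tr x a \<circ> \<rho>) ` insert x K = insert (insert x (orbit \<rho> a)) (orbit \<rho> ` K - {orbit \<rho> a})"
  proof -
    have "{x} \<notin> orbit \<rho> ` K" using sub K by auto
    then have "orbit \<rho> ` insert x K - {{x}, orbit \<rho> a} = orbit \<rho> ` K - {orbit \<rho> a}" using o by auto
    then show ?thesis using m(1) by (simp only: insert_is_Un[symmetric])
  qed
  show "card (insert x (orbit \<rho> a)) = Suc (card (orbit \<rho> a))"
    using sub[OF a] K finite_orbit[OF permutation_self_in_orbit[OF f], of a] by (intro card_insert_disjoint) auto
qed

lemma orbit_poly_insert_transpose:
  assumes "\<rho> permutes K" "finite K" "x \<notin> K" "a \<in> K"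
  shows "orbit_poly (tr x a \<circ> \<rho>) (insert x K) t =
    orbit_factor (card (orbit \<rho> a) + 1) t * (\<Prod>Q\<in>orbit \<rho> ` K - {orbit \<rho> a}. orbit_factor (card Q) t)"
  unfolding orbit_poly_def orbit_image_insert_transpose(1)[OF assms]
  using orbit_image_insert_transpose(2,3)[OF assms] assms(2) by (subst prod.insert) auto

lemma continuous_orbit_poly: "continuous_on S (orbit_poly f K)"
  unfolding orbit_poly_def[abs_def] orbit_factor_def by (intro continuous_intros)

definition orbit_integral :: "('a \<Rightarrow> 'a) \<Rightarrow> 'a set \<Rightarrow> real" where
  "orbit_integral f K = integral {0..1} (orbit_poly f K)"

lemma orbit_poly_integrable: "orbit_poly f K integrable_on {a..b}"
  using continuous_orbit_poly by (rule integrable_continuous_real)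

text \<open>
  Up to sign, the difference of the two integrands is the derivative of \<open>x (x - 1)\<close> times a polynomial,
  which vanishes at both end points.
\<close>

lemma orbit_integral_transpose:
  fixes \<rho> :: "'a \<Rightarrow> 'a"
  assumes r: "\<rho> permutes K" and K: "finite K" "x \<notin> K" and a: "a \<in> K"
  shows "real (card K) * orbit_integral (tr x a \<circ> \<rho>) (insert x K) = (\<Sum>z\<in>K - {a}. orbit_integral (tr a z \<circ> \<rho>) K)"
proof -
  define p where "p = card (orbit \<rho> a)"
  define R where "R = orbit \<rho> ` K - {orbit \<rho> a}"
  have f: "permutation \<rho>" using r K permutation_permutes by blast
  have p0: "0 < p"
    unfolding p_def using finite_orbit[OF permutation_self_in_orbit[OF f], of a] permutation_self_in_orbit[OF f, of a]
    by (auto simp: card_gt_0_iff)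
  have finR: "finite R" using K by (simp add: R_def)
  have Q0: "0 < card Q" if "Q \<in> R" for Q
    using that finite_orbit[OF permutation_self_in_orbit[OF f]] permutation_self_in_orbit[OF f]
    by (auto simp: R_def card_gt_0_iff)
  have cK: "real (card K) = real p + (\<Sum>Q\<in>R. real (card Q))"
    using card_eq_sum_orbits[OF r K(1)] sum.remove[of "orbit \<rho> ` K" "orbit \<rho> a" card] K a
    by (simp add: p_def R_def)
  define \<Psi> where "\<Psi> = (\<lambda>t. \<Prod>Q\<in>R. orbit_factor (card Q) t)"
  define \<Psi>' where "\<Psi>' = (\<lambda>t. \<Sum>Q\<in>R. - (real (card Q) * orbit_factor (card Q - 1) t) * (\<Prod>Q'\<in>R - {Q}. orbit_factor (card Q') t))"
  have d\<Psi>: "(\<Psi> has_field_derivative \<Psi>' t) (at t)" for t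
    unfolding \<Psi>_def \<Psi>'_def
    by (rule has_field_derivative_prod) (rule orbit_factor_deriv)
  define h where "h = (\<lambda>t. (\<Sum>z\<in>K - {a}. orbit_poly (tr a z \<circ> \<rho>) K t) - real (card K) * orbit_poly (tr x a \<circ> \<rho>) (insert x K) t)"
  define H where "H = (\<lambda>t. (1 - t) * (- t) * orbit_factor p t * \<Psi> t)"
  \<comment> \<open>The addition formula separates a part that will cancel against the same part of
    \<open>card K\<close>, by \<open>cK\<close>, from a part that contains the derivative of
    \<open>\<Psi>\<close>.\<close>
  have S: "(\<Sum>Q\<in>R. real (card Q) * orbit_factor (p + card Q) t * (\<Prod>Q'\<in>R - {Q}. orbit_factor (card Q') t)) =
    (\<Sum>Q\<in>R. real (card Q)) * orbit_factor (p + 1) t * \<Psi> t + (1 - t) * (- t) * orbit_factor p t * \<Psi>' t" for t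
    unfolding \<Psi>'_def sum_distrib_left sum_distrib_right sum.distrib[symmetric]
  proof (intro sum.cong refl)
    fix Q assume Q: "Q \<in> R"
    have "\<Psi> t = orbit_factor (card Q) t * (\<Prod>Q'\<in>R - {Q}. orbit_factor (card Q') t)"
      unfolding \<Psi>_def using finR Q by (rule prod.remove)
    then show "real (card Q) * orbit_factor (p + card Q) t * (\<Prod>Q'\<in>R - {Q}. orbit_factor (card Q') t) =
      real (card Q) * orbit_factor (p + 1) t * \<Psi> t + (1 - t) * (- t) * orbit_factor p t *
        (- (real (card Q) * orbit_factor (card Q - 1) t) * (\<Prod>Q'\<in>R - {Q}. orbit_factor (card Q') t))"
      using orbit_factor_add[OF Q0[OF Q], of p t] by (simp add: add.commute[of p] ring_distribs mult_ac)
  qed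
  have dH: "(H has_field_derivative h t) (at t)" for t
  proof -
    have "(H has_field_derivative
      (((- 1) * (- t) + (- 1) * (1 - t)) * orbit_factor p t + - (real p * orbit_factor (p - 1) t) * ((1 - t) * (- t))) * \<Psi> t
        + \<Psi>' t * ((1 - t) * (- t) * orbit_factor p t)) (at t)"
      unfolding H_def by (intro DERIV_mult d\<Psi> orbit_factor_deriv) (auto intro!: derivative_eq_intros)
    moreover have "h t = (((- 1) * (- t) + (- 1) * (1 - t)) * orbit_factor p t + - (real p * orbit_factor (p - 1) t) * ((1 - t) * (- t))) * \<Psi> t
        + \<Psi>' t * ((1 - t) * (- t) * orbit_factor p t)"
    proof -
      have "h t = (\<Sum>Q\<in>R. real (card Q)) * orbit_factor (p + 1) t * \<Psi> t + (1 - t) * (- t) * orbit_factor p t * \<Psi>' t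
        + (\<Sum>i\<in>{0<..<p}. orbit_factor i t * orbit_factor (p - i) t) * \<Psi> t
        - (real p + (\<Sum>Q\<in>R. real (card Q))) * (orbit_factor (p + 1) t * \<Psi> t)"
        unfolding h_def orbit_poly_transpose_sum[OF r K(1) a, folded p_def, folded R_def]
          orbit_poly_insert_transpose[OF r K a, folded p_def, folded R_def] S cK \<Psi>_def ..
      also have "\<dots> = ((\<Sum>i\<in>{0<..<p}. orbit_factor i t * orbit_factor (p - i) t) - real p * orbit_factor (p + 1) t) * \<Psi> t
        + (1 - t) * (- t) * orbit_factor p t * \<Psi>' t"
        by (simp add: algebra_simps)
      also have "(\<Sum>i\<in>{0<..<p}. orbit_factor i t * orbit_factor (p - i) t) - real p * orbit_factor (p + 1) t =
        - ((1 - t) + (- t)) * orbit_factor p t - (1 - t) * (- t) * (real p * orbit_factor (p - 1) t)"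
        unfolding sum_orbit_factor_split[OF p0] using orbit_factor_bracket[OF p0, of t] .
      finally show ?thesis by algebra
    qed
    ultimately show ?thesis by simp
  qed
  have "(h has_integral H 1 - H 0) {0..1}"
    by (rule fundamental_theorem_of_calculus)
      (auto intro: dH has_field_derivative_subset simp flip: has_real_derivative_iff_has_vector_derivative)
  then have "integral {0..1} h = 0" by (simp add: H_def integral_unique)
  moreover have "integral {0..1} h = (\<Sum>z\<in>K - {a}. orbit_integral (tr a z \<circ> \<rho>) K)
      - real (card K) * orbit_integral (tr x a \<circ> \<rho>) (insert x K)"
    unfolding h_def orbit_integral_def using K
    by (subst integral_diff)
      (auto intro!: integrable_sum orbit_poly_integrable integrable_on_mult_right simp: integral_sum orbit_poly_integrable)
  ultimately show ?thesis by simp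
qed

text \<open>Both sides obey the same recursion when a point \<open>x\<close> is removed from
  \<open>K\<close>. If \<open>\<pi>\<close> fixes \<open>x\<close>, both are multiplied by the
  number of remaining points, as a fixed point contributes the factor 1 to
  \<open>orbit_poly\<close>; otherwise both become the same sum over
  \<open>K - {\<pi> x}\<close>.\<close>

theorem cycle_factor_count_eq:
  assumes "finite K" "K \<noteq> {}" "\<pi> permutes K"
  shows "real (cycle_factor_count K \<pi>) = fact (card K - 1) * orbit_integral \<pi> K"
  using assms
proof (induction K arbitrary: \<pi> rule: finite_ne_induct)
  case (singleton x)
  then have "\<pi> = id" by simp
  have "orbit id x = {x}" by (simp add: orbit_eq_singleton_iff)
  then have "orbit_integral \<pi> {x} = 1"
    unfolding orbit_integral_def orbit_poly_def[abs_def] \<open>\<pi> = id\<close> by simp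
  moreover have "cycle_factor_count {x} \<pi> = 1"
    unfolding cycle_factor_count_def cycles_on_singleton \<open>\<pi> = id\<close> by simp
  ultimately show ?case by simp
next
  case (insert x K)
  define \<rho> where "\<rho> = tr x (\<pi> x) \<circ> \<pi>"
  have r: "\<rho> permutes K" unfolding \<rho>_def using insert.prems by (rule permutes_insert_lemma)
  have k: "0 < card K" using insert.hyps by (simp add: card_gt_0_iff)
  have fk: "fact (card (insert x K) - 1) = real (card K) * fact (card K - 1)"
    using insert.hyps k by (simp add: fact_reduce[of "card K"])
  show ?case
  proof (cases "\<pi> x = x")
    case True
    then have "\<pi> = \<rho>" by (simp add: \<rho>_def)
    then show ?thesis using insert.hyps r insert.IH[OF r] fk
      by (simp add: cycle_factor_count_fixed orbit_integral_def orbit_poly_insert_fixed)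
  next
    case False
    then have a: "\<pi> x \<in> K" using insert.prems by (metis insertE insertI1 permutes_in_image)
    have pi: "\<pi> = tr x (\<pi> x) \<circ> \<rho>" by (simp add: \<rho>_def)
    have "real (cycle_factor_count (insert x K) \<pi>) = (\<Sum>z\<in>K - {\<pi> x}. real (cycle_factor_count K (tr (\<pi> x) z \<circ> \<rho>)))"
      by (subst pi, subst cycle_factor_count_transpose[OF insert.hyps(1) insert.hyps(3) r a]) simp
    also have "\<dots> = (\<Sum>z\<in>K - {\<pi> x}. fact (card K - 1) * orbit_integral (tr (\<pi> x) z \<circ> \<rho>) K)"
      using r a by (intro sum.cong refl insert.IH permutes_compose permutes_swap_id) auto
    also have "\<dots> = fact (card K - 1) * (real (card K) * orbit_integral (tr x (\<pi> x) \<circ> \<rho>) (insert x K))"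
      by (subst orbit_integral_transpose[OF r insert.hyps(1) insert.hyps(3) a]) (simp add: sum_distrib_left)
    finally show ?thesis using fk pi by simp
  qed
qed

section \<open>Lower bound for the integral at even permutations\<close>

lemma prod_orbits_sign:
  assumes "finite K" "\<pi> permutes K"
  shows "(\<Prod>Q\<in>orbit \<pi> ` K. (- 1) ^ (card Q - 1)) = sign \<pi>"
  using assms
proof (induction K arbitrary: \<pi> rule: finite_induct)
  case (insert x K)
  define \<rho> where "\<rho> = tr x (\<pi> x) \<circ> \<pi>"
  have r: "\<rho> permutes K" unfolding \<rho>_def using insert.prems by (rule permutes_insert_lemma)
  have f: "permutation \<rho>" using r insert.hyps permutation_permutes by blast
  show ?case
  proof (cases "\<pi> x = x")
    case True
    then have pi: "\<pi> = \<rho>" by (simp add: \<rho>_def)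
    have "orbit \<rho> x = {x}" using r insert.hyps by (simp add: orbit_eq_singleton_iff permutes_not_in)
    moreover have "{x} \<notin> orbit \<rho> ` K" using permutes_orbit_subset[OF r] insert.hyps by blast
    ultimately show ?thesis using insert.IH[OF r] insert.hyps pi by simp
  next
    case False
    then have a: "\<pi> x \<in> K" using insert.prems by (metis insertE insertI1 permutes_in_image)
    let ?a = "\<pi> x"
    have pi: "\<pi> = tr x ?a \<circ> \<rho>" by (simp add: \<rho>_def)
    note o = orbit_image_insert_transpose[OF r insert.hyps(1,2) a]
    have "0 < card (orbit \<rho> ?a)"
      using finite_orbit[OF permutation_self_in_orbit[OF f], of ?a] permutation_self_in_orbit[OF f, of ?a]
      by (auto simp: card_gt_0_iff)
    then obtain q where q: "card (orbit \<rho> ?a) = Suc q" using gr0_implies_Suc by blast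
    have "(\<Prod>Q\<in>orbit \<pi> ` insert x K. (- 1) ^ (card Q - 1) :: int) =
      (- 1) ^ card (orbit \<rho> ?a) * (\<Prod>Q\<in>orbit \<rho> ` K - {orbit \<rho> ?a}. (- 1) ^ (card Q - 1))"
      using o insert.hyps by (subst pi, subst o(1), subst prod.insert) auto
    also have "\<dots> = - (\<Prod>Q\<in>orbit \<rho> ` K. (- 1) ^ (card Q - 1))"
      using insert.hyps a q by (subst prod.remove[of "orbit \<rho> ` K" "orbit \<rho> ?a"]) auto
    also have "\<dots> = - sign \<rho>" using insert.IH[OF r] by simp
    also have "\<dots> = sign \<pi>"
      by (subst pi, subst sign_compose) (use False f in \<open>auto simp: sign_swap_id permutation_swap_id\<close>)
    finally show ?thesis .
  qed
qed simp

text \<open>Reflection multiplies the factor of each cycle by the sign of that cycle, and the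
  product of these is the sign of \<open>\<pi>\<close>. Hence the integrand need only be bounded
  from below on the left half of \<open>{0..1}\<close>.\<close>

lemma orbit_poly_reflect:
  assumes "finite K" "\<pi> permutes K" "evenperm \<pi>"
  shows "orbit_poly \<pi> K (1 - x) = orbit_poly \<pi> K x"
proof -
  have f: "permutation \<pi>" using assms permutation_permutes by blast
  have "orbit_factor (card (orbit \<pi> y)) (1 - x) = (- 1) ^ (card (orbit \<pi> y) - 1) * orbit_factor (card (orbit \<pi> y)) x" for y
  proof -
    have "0 < card (orbit \<pi> y)"
      using finite_orbit[OF permutation_self_in_orbit[OF f], of y] permutation_self_in_orbit[OF f, of y]
      by (auto simp: card_gt_0_iff)
    then obtain q where q: "card (orbit \<pi> y) = Suc q" using gr0_implies_Suc by blast
    have e: "x ^ q = (- 1) ^ q * (- x) ^ q" "(x - 1) ^ q = (- 1) ^ q * (1 - x) ^ q"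
      by (simp_all flip: power_mult_distrib)
    have "orbit_factor (Suc q) (1 - x) = x * x ^ q - (x - 1) * (x - 1) ^ q"
      by (simp add: orbit_factor_def)
    also have "\<dots> = (- 1) ^ q * ((1 - x) * (1 - x) ^ q - (- x) * (- x) ^ q)"
      unfolding e by algebra
    finally show ?thesis by (simp add: orbit_factor_def q)
  qed
  then have "orbit_poly \<pi> K (1 - x) = (\<Prod>Q\<in>orbit \<pi> ` K. (- 1) ^ (card Q - 1) * orbit_factor (card Q) x)"
    unfolding orbit_poly_def by (intro prod.cong) auto
  also have "\<dots> = real_of_int (\<Prod>Q\<in>orbit \<pi> ` K. (- 1) ^ (card Q - 1)) * orbit_poly \<pi> K x"
    by (simp add: prod.distrib orbit_poly_def)
  also have "\<dots> = orbit_poly \<pi> K x"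
    using assms prod_orbits_sign[OF assms(1,2)] by (simp add: sign_def)
  finally show ?thesis .
qed

text \<open>For q = 2 m write the factor as ((1 - x)^2)^m - (x^2)^m and use that the m-th power is
  superadditive (\<open>pw\<close>), with (1 - x)^2 - x^2 = 1 - 2 x. For odd q the factor is at
  least (1 - x)^q, and (1 - x)^2 is at least 1 - 2 x. In squared form the exponents of all cycles
  add up to \<open>card K\<close>, whatever their parities.\<close>

lemma orbit_factor_bounds:
  assumes x: "0 \<le> x" "x \<le> 1 / 2" and q: "0 < q"
  shows "0 \<le> orbit_factor q x" "(1 - 2 * x) ^ q \<le> (orbit_factor q x)\<^sup>2"
proof -
  have sq: "1 - 2 * x = (1 - x)\<^sup>2 - x\<^sup>2" by (simp add: power2_eq_square algebra_simps)
  have "0 \<le> orbit_factor q x \<and> (1 - 2 * x) ^ q \<le> (orbit_factor q x)\<^sup>2"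
  proof (cases "even q")
    case True
    then obtain m where m: "q = 2 * m" by blast
    have pw: "(u - v) ^ m \<le> u ^ m - v ^ m" if "0 \<le> v" "v \<le> u" "0 < m" for u v :: real and m :: nat
      using that(3)
    proof (induction m)
      case (Suc m)
      show ?case
      proof (cases "m = 0")
        case False
        then have IH: "(u - v) ^ m \<le> u ^ m - v ^ m" using Suc by simp
        have "(u - v) ^ Suc m \<le> (u - v) * (u ^ m - v ^ m)"
          using IH that by (simp add: mult_left_mono)
        also have "\<dots> = u ^ Suc m - v ^ Suc m - v * (u ^ m - v ^ m) - v ^ m * (u - v)"
          by (simp add: algebra_simps)
        also have "\<dots> \<le> u ^ Suc m - v ^ Suc m"
        proof -
          have "0 \<le> v * (u ^ m - v ^ m)" "0 \<le> v ^ m * (u - v)"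
            using that power_mono[OF that(2,1), of m] by simp_all
          then show ?thesis by linarith
        qed
        finally show ?thesis .
      qed simp
    qed simp
    have "orbit_factor q x = ((1 - x)\<^sup>2) ^ m - (x\<^sup>2) ^ m"
      by (simp add: orbit_factor_def m power_mult)
    moreover have "((1 - x)\<^sup>2 - x\<^sup>2) ^ m \<le> ((1 - x)\<^sup>2) ^ m - (x\<^sup>2) ^ m"
      using x q m by (intro pw) (auto intro!: power_mono)
    ultimately have 1: "(1 - 2 * x) ^ m \<le> orbit_factor q x" using sq by simp
    moreover have 0: "0 \<le> (1 - 2 * x) ^ m" using x by simp
    ultimately have "((1 - 2 * x) ^ m)\<^sup>2 \<le> (orbit_factor q x)\<^sup>2" by (intro power_mono)
    then show ?thesis using 0 1 by (simp add: m power_mult mult.commute flip: power_mult)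
  next
    case False
    then have "orbit_factor q x = (1 - x) ^ q + x ^ q" by (simp add: orbit_factor_def)
    then have 1: "(1 - x) ^ q \<le> orbit_factor q x" and 0: "0 \<le> (1 - x) ^ q" using x by simp_all
    have "(1 - 2 * x) ^ q \<le> ((1 - x)\<^sup>2) ^ q"
      using x by (intro power_mono) (auto simp: sq)
    also have "\<dots> = ((1 - x) ^ q)\<^sup>2" by (simp add: mult.commute flip: power_mult)
    also have "\<dots> \<le> (orbit_factor q x)\<^sup>2" using 0 1 by (intro power_mono)
    finally show ?thesis using 0 1 by simp
  qed
  then show "0 \<le> orbit_factor q x" "(1 - 2 * x) ^ q \<le> (orbit_factor q x)\<^sup>2" by auto
qed

lemma orbit_poly_ge:
  assumes K: "finite K" "\<pi> permutes K" and x: "0 \<le> x" "x \<le> 1 / 2" and m: "card K \<le> 2 * m"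
  shows "(1 - 2 * x) ^ m \<le> orbit_poly \<pi> K x"
proof -
  have f: "permutation \<pi>" using K permutation_permutes by blast
  have q: "0 < card Q" if "Q \<in> orbit \<pi> ` K" for Q
    using that finite_orbit[OF permutation_self_in_orbit[OF f]] permutation_self_in_orbit[OF f]
    by (auto simp: card_gt_0_iff)
  have "((1 - 2 * x) ^ m)\<^sup>2 \<le> (1 - 2 * x) ^ card K"
    unfolding power_mult[symmetric] using x m by (intro power_decreasing) auto
  also have "\<dots> = (\<Prod>Q\<in>orbit \<pi> ` K. (1 - 2 * x) ^ card Q)"
    unfolding card_eq_sum_orbits[OF K(2,1)] by (rule power_sum)
  also have "\<dots> \<le> (\<Prod>Q\<in>orbit \<pi> ` K. (orbit_factor (card Q) x)\<^sup>2)"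
    using x orbit_factor_bounds[OF x q] by (intro prod_mono) auto
  also have "\<dots> = (orbit_poly \<pi> K x)\<^sup>2" by (simp add: orbit_poly_def prod_power_distrib)
  finally have "((1 - 2 * x) ^ m)\<^sup>2 \<le> (orbit_poly \<pi> K x)\<^sup>2" .
  moreover have "0 \<le> orbit_poly \<pi> K x"
    unfolding orbit_poly_def using orbit_factor_bounds[OF x q] by (intro prod_nonneg) auto
  ultimately show ?thesis by (rule power2_le_imp_le)
qed

text \<open>By symmetry the integral is at least twice that of (1 - 2 x)^m over the left half, which
  gives 1 / (m + 1). Rounding k / 2 up to an integer m turns k + 2 into k + 3.\<close>

lemma orbit_integral_ge:
  assumes K: "finite K" "\<pi> permutes K" "evenperm \<pi>"
  shows "2 / (real (card K) + 3) \<le> orbit_integral \<pi> K"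
proof -
  define m where "m = (card K + 1) div 2"
  have m: "card K \<le> 2 * m" "real m + 1 \<le> (real (card K) + 3) / 2"
  proof -
    have "card K \<le> 2 * m" "2 * m \<le> card K + 1" unfolding m_def by linarith+
    moreover from this(2) have "real (2 * m) \<le> real (card K + 1)" by (simp only: of_nat_le_iff)
    ultimately show "card K \<le> 2 * m" "real m + 1 \<le> (real (card K) + 3) / 2" by simp_all
  qed
  define P where "P = orbit_poly \<pi> K"
  have int: "P integrable_on {a..b}" for a b unfolding P_def by (rule orbit_poly_integrable)
  have "((\<lambda>x. (1 - 2 * x) ^ m) has_integral (- ((1 - 2 * (1 / 2)) ^ Suc m / (2 * (real m + 1))) - - ((1 - 2 * 0) ^ Suc m / (2 * (real m + 1))))) {0..1 / 2 :: real}"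
  proof (rule fundamental_theorem_of_calculus)
    fix x :: real
    have "((\<lambda>x. - ((1 - 2 * x) ^ Suc m / (2 * (real m + 1)))) has_field_derivative
      - ((1 + real m) * (- 2) * (1 - 2 * x) ^ m / (2 * (real m + 1)))) (at x within {0..1 / 2})"
      by (rule derivative_eq_intros refl | simp)+ (simp add: field_simps)
    moreover have "- ((1 + real m) * (- 2) * (1 - 2 * x) ^ m / (2 * (real m + 1))) = (1 - 2 * x) ^ m"
    proof -
      have "2 * (real m + 1) \<noteq> 0" using of_nat_0_le_iff[of m, where 'a=real] by simp
      moreover have "- ((1 + real m) * (- 2) * (1 - 2 * x) ^ m) = (1 - 2 * x) ^ m * (2 * (real m + 1))"
        by (simp add: algebra_simps)
      ultimately show ?thesis by (metis minus_divide_left nonzero_mult_div_cancel_right)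
    qed
    ultimately show "((\<lambda>x. - ((1 - 2 * x) ^ Suc m / (2 * (real m + 1)))) has_vector_derivative (1 - 2 * x) ^ m) (at x within {0..1 / 2})"
      by (simp add: has_real_derivative_iff_has_vector_derivative)
  qed simp
  then have hi: "((\<lambda>x. (1 - 2 * x) ^ m) has_integral (1 / (2 * (real m + 1)))) {0..1 / 2 :: real}" by simp
  have half: "1 / (2 * (real m + 1)) \<le> integral {0..1 / 2} P"
    by (rule has_integral_le[OF hi integrable_integral[OF int]]) (use K m in \<open>auto simp: P_def intro!: orbit_poly_ge\<close>)
  have "((\<lambda>x. P (1 - x)) has_integral integral {0..1 / 2} P) {1 / 2..1}"
    using has_integral_affinity[of P "integral {0..1 / 2} P" 0 "1 / 2" "- 1" 1] integrable_integral[OF int[of 0 "1 / 2"]]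
    by (simp add: image_affinity_atLeastAtMost)
  then have "(P has_integral integral {0..1 / 2} P) {1 / 2..1}"
    unfolding P_def orbit_poly_reflect[OF K] by simp
  then have "integral {1 / 2..1} P = integral {0..1 / 2} P" by (rule integral_unique)
  moreover have "orbit_integral \<pi> K = integral {0..1 / 2} P + integral {1 / 2..1} P"
    unfolding orbit_integral_def P_def[symmetric]
    using Henstock_Kurzweil_Integration.integral_combine[of 0 "1 / 2" 1 P] int by simp
  ultimately have "2 * (1 / (2 * (real m + 1))) \<le> orbit_integral \<pi> K" using half by linarith
  moreover have "2 / (real (card K) + 3) \<le> 2 * (1 / (2 * (real m + 1)))"
    using m(2) by (simp add: field_simps)
  ultimately show ?thesis by linarith
qed

text \<open>There are (k - 1)!^2 pairs of cycles, and their products are even. Spread evenly over k!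
  / 2 even permutations they would give 2 (k - 1)! / k factorisations each; the bound is k / (k + 3)
  of this average.\<close>

theorem cycle_factor_count_ge:
  assumes "finite K" "K \<noteq> {}" "\<pi> permutes K" "evenperm \<pi>"
  shows "fact (card K - 1) * (2 / (real (card K) + 3)) \<le> real (cycle_factor_count K \<pi>)"
  unfolding cycle_factor_count_eq[OF assms(1-3)]
  using orbit_integral_ge[OF assms(1,3,4)] by (intro mult_left_mono) auto

section \<open>Lower bounds for the density of the walk\<close>

text \<open>Every factor is an involution, so the average runs over the predecessors of
  \<open>\<pi>\<close>: \<open>rstep\<close> sends the density of the walk to the density one step
  later. The pairs with i = j make up the identity step.\<close>

definition rstep :: "nat \<Rightarrow> ((nat \<Rightarrow> nat) \<Rightarrow> real) \<Rightarrow> (nat \<Rightarrow> nat) \<Rightarrow> real" where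
  "rstep n f \<pi> = (\<Sum>(i, j)\<in>{1..n} \<times> {1..n}. f (tr i j \<circ> \<pi>)) / (real n)\<^sup>2"

abbreviation rsteps :: "nat \<Rightarrow> nat \<Rightarrow> ((nat \<Rightarrow> nat) \<Rightarrow> real) \<Rightarrow> (nat \<Rightarrow> nat) \<Rightarrow> real" where
  "rsteps n t \<equiv> rstep n ^^ t"

text \<open>
  Bounding the density from below pointwise, instead of bounding a distance, makes the notion
  superadditive in \<open>f\<close>, so that mass can be split off and dropped freely.
\<close>

definition covers :: "nat \<Rightarrow> nat \<Rightarrow> ((nat \<Rightarrow> nat) \<Rightarrow> real) \<Rightarrow> real \<Rightarrow> bool" where
  "covers n t f c \<longleftrightarrow> (\<forall>\<pi>. \<pi> permutes {1..n} \<longrightarrow> c \<le> fact n * rsteps n t f \<pi>)"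

lemma rsteps_Suc: "rsteps n (Suc t) f = rstep n (rsteps n t f)"
  by simp

lemma rsteps_Suc2: "rsteps n (Suc t) f = rsteps n t (rstep n f)"
  by (simp add: funpow_swap1)

lemma transpose_comp_permutes:
  "\<pi> permutes S \<Longrightarrow> i \<in> S \<Longrightarrow> j \<in> S \<Longrightarrow> tr i j \<circ> \<pi> permutes S"
  by (intro permutes_compose permutes_swap_id)

lemma rstep_sum: "rstep n (\<lambda>\<pi>. \<Sum>a\<in>I. w a * f a \<pi>) \<pi> = (\<Sum>a\<in>I. w a * rstep n (f a) \<pi>)"
proof -
  have "(\<Sum>p\<in>{1..n} \<times> {1..n}. case p of (i, j) \<Rightarrow> \<Sum>a\<in>I. w a * f a (tr i j \<circ> \<pi>)) =
    (\<Sum>a\<in>I. w a * (\<Sum>p\<in>{1..n} \<times> {1..n}. case p of (i, j) \<Rightarrow> f a (tr i j \<circ> \<pi>)))"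
    unfolding sum_distrib_left case_prod_beta by (rule sum.swap)
  then show ?thesis by (simp add: rstep_def) (simp add: sum_divide_distrib)
qed

lemma rsteps_sum: "rsteps n t (\<lambda>\<pi>. \<Sum>a\<in>I. w a * f a \<pi>) \<pi> = (\<Sum>a\<in>I. w a * rsteps n t (f a) \<pi>)"
proof (induction t arbitrary: \<pi>)
  case (Suc t)
  then have "rsteps n t (\<lambda>\<pi>. \<Sum>a\<in>I. w a * f a \<pi>) = (\<lambda>\<pi>. \<Sum>a\<in>I. w a * rsteps n t (f a) \<pi>)" by blast
  then show ?case unfolding rsteps_Suc by (simp add: rstep_sum)
qed simp

lemma rsteps_add: "rsteps n t (\<lambda>\<pi>. f \<pi> + g \<pi>) \<pi> = rsteps n t f \<pi> + rsteps n t g \<pi>"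
  using rsteps_sum[where n=n and t=t and w="\<lambda>_. 1" and f="\<lambda>b. if b then f else g" and I="UNIV :: bool set"] by (simp add: UNIV_bool add.commute)

lemma rsteps_cmult: "rsteps n t (\<lambda>\<pi>. c * f \<pi>) \<pi> = c * rsteps n t f \<pi>"
  using rsteps_sum[where n=n and t=t and w="\<lambda>_. c" and f="\<lambda>_. f" and I="{()}"] by simp

lemma rsteps_mono:
  assumes "\<And>\<pi>. \<pi> permutes {1..n} \<Longrightarrow> f \<pi> \<le> g \<pi>" "\<pi> permutes {1..n}"
  shows "rsteps n t f \<pi> \<le> rsteps n t g \<pi>"
  using assms(2)
proof (induction t arbitrary: \<pi>)
  case (Suc t)
  have "(\<Sum>p\<in>{1..n} \<times> {1..n}. case p of (i, j) \<Rightarrow> rsteps n t f (tr i j \<circ> \<pi>)) \<le>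
    (\<Sum>p\<in>{1..n} \<times> {1..n}. case p of (i, j) \<Rightarrow> rsteps n t g (tr i j \<circ> \<pi>))"
    using Suc.prems by (intro sum_mono) (auto intro!: Suc.IH transpose_comp_permutes)
  then show ?case unfolding rsteps_Suc rstep_def[of _ _ \<pi>] by (intro divide_right_mono) auto
qed (use assms(1) in auto)

lemma rsteps_cong:
  assumes "\<And>\<pi>. \<pi> permutes {1..n} \<Longrightarrow> f \<pi> = g \<pi>" "\<pi> permutes {1..n}"
  shows "rsteps n t f \<pi> = rsteps n t g \<pi>"
  using rsteps_mono[of n f g \<pi> t] rsteps_mono[of n g f \<pi> t] assms by force

lemma rsteps_nonneg:
  assumes "\<And>\<pi>. \<pi> permutes {1..n} \<Longrightarrow> 0 \<le> f \<pi>" "\<pi> permutes {1..n}"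
  shows "0 \<le> rsteps n t f \<pi>"
  using rsteps_mono[of n "\<lambda>\<pi>. 0 * f \<pi>" f \<pi> t] assms rsteps_cmult[where n=n and t=t and c=0] by simp

lemma rsteps_right: "rsteps n t (\<lambda>\<pi>. f (\<pi> \<circ> h)) \<pi> = rsteps n t f (\<pi> \<circ> h)"
proof (induction t arbitrary: \<pi>)
  case (Suc t)
  then have "rsteps n t (\<lambda>\<pi>. f (\<pi> \<circ> h)) = (\<lambda>\<pi>. rsteps n t f (\<pi> \<circ> h))" by blast
  then show ?case unfolding rsteps_Suc by (simp add: rstep_def o_def)
qed simp

text \<open>Moving \<open>g\<close> past a step conjugates the transposition, and the law of a step
  is invariant under conjugation. On the right no such argument is required, as steps act on the
  left.\<close>

lemma rstep_left:
  assumes g: "g permutes {1..n}"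
  shows "rstep n (\<lambda>\<pi>. f (g \<circ> \<pi>)) \<pi> = rstep n f (g \<circ> \<pi>)"
proof -
  have "(\<Sum>(i, j)\<in>{1..n} \<times> {1..n}. f (g \<circ> (tr i j \<circ> \<pi>))) =
    (\<Sum>(i, j)\<in>{1..n} \<times> {1..n}. f (tr (g i) (g j) \<circ> (g \<circ> \<pi>)))"
    using transpose_conj[OF permutes_bij[OF g]] by (simp flip: comp_assoc)
  also have "\<dots> = (\<Sum>(i, j)\<in>{1..n} \<times> {1..n}. f (tr i j \<circ> (g \<circ> \<pi>)))"
    by (rule sum.reindex_bij_betw[where h="map_prod g g" and g="\<lambda>(i, j). f (tr i j \<circ> (g \<circ> \<pi>))", simplified case_prod_map_prod])
      (intro bij_betw_map_prod permutes_imp_bij g)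
  finally show ?thesis by (simp add: rstep_def)
qed

lemma rsteps_left:
  assumes "g permutes {1..n}"
  shows "rsteps n t (\<lambda>\<pi>. f (g \<circ> \<pi>)) \<pi> = rsteps n t f (g \<circ> \<pi>)"
proof (induction t arbitrary: \<pi>)
  case (Suc t)
  then have "rsteps n t (\<lambda>\<pi>. f (g \<circ> \<pi>)) = (\<lambda>\<pi>. rsteps n t f (g \<circ> \<pi>))" by blast
  then show ?case unfolding rsteps_Suc using rstep_left[OF assms, of "rsteps n t f" \<pi>] by (simp add: o_def)
qed simp

lemma coversD: "covers n t f c \<Longrightarrow> \<pi> permutes {1..n} \<Longrightarrow> c \<le> fact n * rsteps n t f \<pi>"
  by (simp add: covers_def)

lemma covers_mono:
  assumes "covers n t f c" "\<And>\<pi>. \<pi> permutes {1..n} \<Longrightarrow> f \<pi> \<le> g \<pi>" "c' \<le> c"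
  shows "covers n t g c'"
  unfolding covers_def
proof (intro allI impI)
  fix \<pi> :: "nat \<Rightarrow> nat" assume p: "\<pi> permutes {1..n}"
  have "c' \<le> fact n * rsteps n t f \<pi>" using assms p by (auto simp: covers_def)
  also have "\<dots> \<le> fact n * rsteps n t g \<pi>" using rsteps_mono[of n f g \<pi> t] assms(2) p by simp
  finally show "c' \<le> fact n * rsteps n t g \<pi>" .
qed

lemma covers_nonneg:
  assumes "\<And>\<pi>. \<pi> permutes {1..n} \<Longrightarrow> 0 \<le> f \<pi>"
  shows "covers n t f 0"
  unfolding covers_def using rsteps_nonneg[OF assms] by simp

lemma covers_sum:
  assumes "\<And>a. a \<in> I \<Longrightarrow> covers n t (f a) (c a)" "\<And>a. a \<in> I \<Longrightarrow> 0 \<le> w a"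
  shows "covers n t (\<lambda>\<pi>. \<Sum>a\<in>I. w a * f a \<pi>) (\<Sum>a\<in>I. w a * c a)"
  unfolding covers_def rsteps_sum sum_distrib_left
  using assms by (auto simp: covers_def mult.left_commute[of "fact n"] intro!: sum_mono mult_left_mono)

lemma covers_add: "covers n t f c \<Longrightarrow> covers n t g d \<Longrightarrow> covers n t (\<lambda>\<pi>. f \<pi> + g \<pi>) (c + d)"
  unfolding covers_def rsteps_add by (auto simp: distrib_left intro: add_mono)

lemma covers_cmult: "covers n t f c \<Longrightarrow> 0 \<le> w \<Longrightarrow> covers n t (\<lambda>\<pi>. w * f \<pi>) (w * c)"
  using covers_sum[of "{()}" n t "\<lambda>_. f" "\<lambda>_. c" "\<lambda>_. w"] by simp

lemma covers_right:
  assumes "covers n t f c" "h permutes {1..n}"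
  shows "covers n t (\<lambda>\<pi>. f (\<pi> \<circ> h)) c"
  unfolding covers_def rsteps_right using assms by (auto simp: covers_def intro: permutes_compose)

lemma covers_left:
  assumes "covers n t f c" "h permutes {1..n}"
  shows "covers n t (\<lambda>\<pi>. f (h \<circ> \<pi>)) c"
  unfolding covers_def rsteps_left[OF assms(2)] using assms by (auto simp: covers_def intro: permutes_compose)

text \<open>The time in \<open>covers\<close> counts the steps still to come after the density is
  \<open>f\<close>, so induction on it proceeds from the end of the walk towards its
  beginning.\<close>

lemma covers_step: "covers n t (rstep n f) c \<Longrightarrow> covers n (Suc t) f c"
  unfolding covers_def rsteps_Suc2 .

text \<open>A step averages values, so it cannot fall below a pointwise lower bound: waiting is
  harmless.\<close>

lemma covers_Suc:
  assumes "covers n t f c" "0 < n"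
  shows "covers n (Suc t) f c"
  unfolding covers_def
proof (intro allI impI)
  fix \<pi> :: "nat \<Rightarrow> nat" assume p: "\<pi> permutes {1..n}"
  have "c * (real n)\<^sup>2 = (\<Sum>(i, j)\<in>{1..n} \<times> {1..n}. c)" by (simp add: power2_eq_square)
  also have "\<dots> \<le> (\<Sum>(i, j)\<in>{1..n} \<times> {1..n}. fact n * rsteps n t f (tr i j \<circ> \<pi>))"
    using p by (intro sum_mono) (auto intro!: coversD[OF assms(1)] transpose_comp_permutes)
  also have "\<dots> = fact n * rsteps n (Suc t) f \<pi> * (real n)\<^sup>2"
    unfolding rsteps_Suc rstep_def[of _ _ \<pi>] using assms(2) by (simp add: sum_distrib_left case_prod_beta)
  finally show "c \<le> fact n * rsteps n (Suc t) f \<pi>" using assms(2) by simp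
qed

lemma covers_later:
  assumes "covers n t f c" "0 < n" "t \<le> t'"
  shows "covers n t' f c"
  using assms(3) by (induction t' rule: dec_induct) (auto intro: assms covers_Suc)

section \<open>Growth of a uniformly permuted set\<close>

definition unif :: "'a set \<Rightarrow> ('a \<Rightarrow> 'a) \<Rightarrow> real" where
  "unif K \<pi> = (if \<pi> permutes K then 1 / fact (card K) else 0)"

lemma unif_nonneg: "0 \<le> unif K \<pi>"
  by (simp add: unif_def)

text \<open>For \<open>\<pi>\<close> permuting \<open>insert x K\<close> exactly one coset
  representative brings it back to \<open>K\<close>, namely the one with \<open>y = \<pi> x\<close>;
  here \<open>y = x\<close> stands for the identity.\<close>

lemma unif_insert:
  assumes K: "finite K" "x \<notin> K"
  shows "(real (card K) + 1) * unif (insert x K) \<pi> = unif K \<pi> + (\<Sum>y\<in>K. unif K (tr x y \<circ> \<pi>))"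
proof -
  have 1: "unif K \<pi> + (\<Sum>y\<in>K. unif K (tr x y \<circ> \<pi>)) = (\<Sum>y\<in>insert x K. unif K (tr x y \<circ> \<pi>))"
    using K by simp
  have iff: "tr x y \<circ> \<pi> permutes K \<longleftrightarrow> \<pi> permutes insert x K \<and> \<pi> x = y" if "y \<in> insert x K" for y
  proof
    assume A: "tr x y \<circ> \<pi> permutes K"
    then have "tr x y \<circ> \<pi> permutes insert x K" by (auto intro: permutes_subset)
    then have "\<pi> permutes insert x K"
      using that transpose_comp_permutes[of "tr x y \<circ> \<pi>" "insert x K" x y] by simp
    moreover have "tr x y (\<pi> x) = x" using permutes_not_in[OF A K(2)] by simp
    then have "\<pi> x = y" by (metis transpose_apply_first transpose_involutory)
    ultimately show "\<pi> permutes insert x K \<and> \<pi> x = y" by simp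
  qed (use permutes_insert_lemma[of \<pi> x K] in auto)
  show ?thesis
  proof (cases "\<pi> permutes insert x K")
    case True
    then have px: "\<pi> x \<in> insert x K" by (metis insertI1 permutes_in_image)
    have "(\<Sum>y\<in>insert x K. unif K (tr x y \<circ> \<pi>)) = (\<Sum>y\<in>insert x K. if y = \<pi> x then 1 / fact (card K) else 0)"
      using True by (intro sum.cong refl) (auto simp: unif_def iff)
    also have "\<dots> = 1 / fact (card K)" using px K by simp
    also have "\<dots> = (real (card K) + 1) * unif (insert x K) \<pi>"
    proof -
      have "1 + real (card K) \<noteq> 0" using of_nat_0_le_iff[of "card K", where 'a=real] by linarith
      then show ?thesis using True K by (simp add: unif_def add.commute)
    qed
    finally show ?thesis unfolding 1 ..
  next
    case False
    then have "(\<Sum>y\<in>insert x K. unif K (tr x y \<circ> \<pi>)) = 0"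
      by (intro sum.neutral ballI) (auto simp: unif_def iff)
    then show ?thesis unfolding 1 using False by (simp add: unif_def)
  qed
qed

lemma rsteps_unif_insert:
  assumes K: "insert x K \<subseteq> {1..n}" "x \<notin> K"
  shows "(real (card K) + 1) * rsteps n t (unif (insert x K)) \<pi> =
    rsteps n t (unif K) \<pi> + (\<Sum>y\<in>K. rsteps n t (unif K) (tr x y \<circ> \<pi>))"
proof -
  have fin: "finite K" using K by (meson finite_atLeastAtMost finite_subset insert_subset)
  have "(real (card K) + 1) * rsteps n t (unif (insert x K)) \<pi> =
    rsteps n t (\<lambda>\<pi>. unif K \<pi> + (\<Sum>y\<in>K. 1 * unif K (tr x y \<circ> \<pi>))) \<pi>"
    unfolding rsteps_cmult[symmetric] unif_insert[OF fin K(2)] by simp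
  also have "\<dots> = rsteps n t (unif K) \<pi> + (\<Sum>y\<in>K. 1 * rsteps n t (\<lambda>\<pi>. unif K (tr x y \<circ> \<pi>)) \<pi>)"
    unfolding rsteps_add rsteps_sum ..
  also have "(\<Sum>y\<in>K. 1 * rsteps n t (\<lambda>\<pi>. unif K (tr x y \<circ> \<pi>)) \<pi>) = (\<Sum>y\<in>K. rsteps n t (unif K) (tr x y \<circ> \<pi>))"
    using K by (intro sum.cong refl) (auto simp: rsteps_left permutes_swap_id subset_iff)
  finally show ?thesis .
qed

text \<open>
  Per new point the coset decomposition needs one identity step for every \<open>card K\<close> transpositions. Using each
  transposition in both of its orders (\<open>w = 2\<close>) is possible only while \<open>2 * (n - card K) \<le> n\<close>, as
  identity steps have probability \<open>1 / n\<close>.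
\<close>

lemma covers_unif_step:
  assumes K: "K \<subseteq> {1..n}" and n: "0 < n" and w: "0 \<le> w" "w \<le> 2" "w * (real n - real (card K)) \<le> real n"
    and v: "covers n t (unif K) v" and v': "\<And>x. x \<in> {1..n} - K \<Longrightarrow> covers n t (unif (insert x K)) v'"
  defines "p \<equiv> w * (real n - real (card K)) * (real (card K) + 1) / (real n)\<^sup>2"
  shows "covers n (Suc t) (unif K) (p * v' + (1 - p) * v)"
  unfolding covers_def
proof (intro allI impI)
  fix \<pi> :: "nat \<Rightarrow> nat" assume \<pi>: "\<pi> permutes {1..n}"
  let ?N = "{1..n}" and ?k = "real (card K)"
  define F where "F = (\<lambda>\<sigma>. fact n * rsteps n t (unif K) \<sigma>)"
  define F' where "F' = (\<lambda>x. fact n * rsteps n t (unif (insert x K)) \<pi>)"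
  have fin: "finite K" using K finite_subset by blast
  have cK: "real (card (?N - K)) = real n - ?k"
    using K card_mono[OF _ K] by (simp add: card_Diff_subset fin of_nat_diff)
  have ins: "(?k + 1) * F' x = F \<pi> + (\<Sum>y\<in>K. F (tr x y \<circ> \<pi>))" if "x \<in> ?N - K" for x
    using rsteps_unif_insert[of x K n t \<pi>] that K
    by (simp add: F_def F'_def sum_distrib_left[symmetric] distrib_left[symmetric] mult.left_commute[of _ "fact n"])
  define D where "D = (\<lambda>i. (i, i :: nat)) ` ?N"
  define X where "X = (?N - K) \<times> K"
  define Y where "Y = K \<times> (?N - K)"
  define Z where "Z = ?N \<times> ?N - D - X - Y"
  let ?f = "\<lambda>(i, j). F (tr i j \<circ> \<pi>)"
  have finX: "finite X" "finite Y" "finite D" "finite Z" unfolding X_def Y_def D_def Z_def using fin by auto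
  have dec: "(\<Sum>q\<in>?N \<times> ?N. h q) = (\<Sum>q\<in>D. h q) + (\<Sum>q\<in>X. h q) + (\<Sum>q\<in>Y. h q) + (\<Sum>q\<in>Z. h q)" for h :: "nat \<times> nat \<Rightarrow> real"
  proof -
    have "?N \<times> ?N = D \<union> (X \<union> (Y \<union> Z))" unfolding Z_def X_def Y_def D_def using K by auto
    moreover have "D \<inter> (X \<union> (Y \<union> Z)) = {}" "X \<inter> (Y \<union> Z) = {}" "Y \<inter> Z = {}"
      unfolding Z_def X_def Y_def D_def by auto
    ultimately show ?thesis using finX by (simp add: sum.union_disjoint)
  qed
  have sD: "(\<Sum>q\<in>D. ?f q) = real n * F \<pi>" unfolding D_def by (subst sum.reindex) (auto simp: inj_on_def)
  have sX: "(\<Sum>q\<in>X. ?f q) = (\<Sum>x\<in>?N - K. (?k + 1) * F' x) - (real n - ?k) * F \<pi>"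
  proof -
    have "(\<Sum>q\<in>X. ?f q) = (\<Sum>x\<in>?N - K. \<Sum>y\<in>K. F (tr x y \<circ> \<pi>))" unfolding X_def by (simp add: sum.cartesian_product)
    also have "\<dots> = (\<Sum>x\<in>?N - K. (?k + 1) * F' x - F \<pi>)" by (intro sum.cong refl) (simp add: ins)
    finally show ?thesis unfolding sum_subtractf sum_constant cK .
  qed
  have sY: "(\<Sum>q\<in>Y. ?f q) = (\<Sum>q\<in>X. ?f q)"
    unfolding X_def Y_def
    by (rule sum.reindex_bij_witness[where i=prod.swap and j=prod.swap]) (auto simp: transpose_commute)
  have Fv: "v \<le> ?f q" if "q \<in> ?N \<times> ?N" for q
    using that coversD[OF v transpose_comp_permutes[OF \<pi>]] by (auto simp: F_def)
  have lX: "real (card X) * v \<le> (\<Sum>q\<in>X. ?f q)"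
    using Fv K by (intro sum_bounded_below) (auto simp: X_def)
  have lZ: "real (card Z) * v \<le> (\<Sum>q\<in>Z. ?f q)"
    using Fv K by (intro sum_bounded_below) (auto simp: Z_def)
  have cX: "real (card X) = (real n - ?k) * ?k" unfolding X_def card_cartesian_product of_nat_mult cK ..
  have cZ: "real (card Z) = (real n)\<^sup>2 - real n - 2 * ((real n - ?k) * ?k)"
  proof -
    have "card Y = card X" by (simp add: X_def Y_def card_cartesian_product)
    moreover have "real (card D) = real n" unfolding D_def by (simp add: card_image inj_on_def)
    ultimately show ?thesis using dec[of "\<lambda>_. 1"] cX by (simp add: power2_eq_square)
  qed
  have F\<pi>: "v \<le> F \<pi>" using coversD[OF v \<pi>] by (simp add: F_def)
  have F': "v' \<le> F' x" if "x \<in> ?N - K" for x using coversD[OF v'[OF that] \<pi>] by (simp add: F'_def)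
  have sF': "(real n - ?k) * ((?k + 1) * v') \<le> (\<Sum>x\<in>?N - K. (?k + 1) * F' x)"
    unfolding cK[symmetric] by (intro sum_bounded_below mult_left_mono F') auto
  \<comment> \<open>For each of the n - k points \<open>x\<close> the coset decomposition is used
    with weight \<open>w\<close>. This consumes \<open>w\<close> of the two equal sums over
    \<open>X\<close> and \<open>Y\<close>, and w (n - k) of the n identity pairs; all that is left
    over keeps only the bound \<open>v\<close>.\<close>
  have "(p * v' + (1 - p) * v) * (real n)\<^sup>2 =
    w * ((real n - ?k) * ((?k + 1) * v')) + (2 - w) * (real (card X) * v) + real (card Z) * v + (real n - w * (real n - ?k)) * v"
    using n unfolding p_def cX cZ by (simp add: field_simps power2_eq_square)
  also have "\<dots> \<le> w * (\<Sum>x\<in>?N - K. (?k + 1) * F' x) + (2 - w) * (\<Sum>q\<in>X. ?f q) + (\<Sum>q\<in>Z. ?f q) + (real n - w * (real n - ?k)) * F \<pi>"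
    using sF' lX lZ F\<pi> w by (intro add_mono mult_left_mono) auto
  also have "\<dots> = (\<Sum>q\<in>?N \<times> ?N. ?f q)"
    unfolding dec sY sX sD by (simp add: algebra_simps)
  also have "\<dots> = fact n * rsteps n (Suc t) (unif K) \<pi> * (real n)\<^sup>2"
    unfolding rsteps_Suc rstep_def[of _ _ \<pi>] F_def using n by (simp add: sum_distrib_left case_prod_beta)
  finally show "p * v' + (1 - p) * v \<le> fact n * rsteps n (Suc t) (unif K) \<pi>" using n by simp
qed

text \<open>
  The first term is the eigenfunction at the full rate \<open>w = 2\<close>; the square compensates for the halved
  rate on sets smaller than \<open>n / 2\<close>.
\<close>

definition growth_potential :: "real \<Rightarrow> real \<Rightarrow> real \<Rightarrow> real" where
  "growth_potential \<delta> n k = (n - k) / k + ((n - k) / k)\<^sup>2 / \<delta>"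

lemma growth_potential_step:
  fixes n k \<delta> :: real
  assumes k: "0 < k" "k + 1 \<le> n" and \<delta>: "0 < \<delta>" "\<delta> \<le> 1" and k\<delta>: "2 / \<delta> \<le> k"
  defines "w \<equiv> if n \<le> 2 * k then 2 else 1"
  defines "p \<equiv> w * (n - k) * (k + 1) / n\<^sup>2"
  shows "p * growth_potential \<delta> n (k + 1) + (1 - p) * growth_potential \<delta> n k
    \<le> (1 - 2 * (1 - \<delta>) / n) * growth_potential \<delta> n k"
proof -
  define a where "a = (n - k) / k"
  define X where "X = n / ((n - k) * (k + 1))"
  have n: "0 < n" "0 < n - k" "0 < k + 1" using k by auto
  have a0: "0 < a" using n k by (simp add: a_def)
  have X0: "0 < X" using n by (simp add: X_def)
  have X1: "X \<le> 1"
  proof -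
    have "0 \<le> k * (n - k - 1)" using k by (intro mult_nonneg_nonneg) auto
    then have "n \<le> (n - k) * (k + 1)" by (simp add: algebra_simps)
    then show ?thesis using n by (simp add: X_def)
  qed
  \<comment> \<open>\<open>X\<close> is the relative drop of \<open>a\<close> when the set gains a
    point, and \<open>p * X = w / n\<close>. So at the full rate the linear term decays by exactly
    the factor 1 - 2 / n.\<close>
  have a': "(n - (k + 1)) / (k + 1) = a * (1 - X)"
  proof -
    have "a * (1 - X) = a - ((n - k) / k) * (n / ((n - k) * (k + 1)))" by (simp add: a_def X_def algebra_simps)
    also have "((n - k) / k) * (n / ((n - k) * (k + 1))) = n / (k * (k + 1))"
    proof -
      have "(n - k) / k * (n / ((n - k) * (k + 1))) = ((n - k) * n) / ((n - k) * (k * (k + 1)))"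
        by (simp add: mult_ac)
      then show ?thesis using n by simp
    qed
    also have "a - n / (k * (k + 1)) = (n - (k + 1)) / (k + 1)"
    proof -
      have "k \<noteq> 0" "k + 1 \<noteq> 0" using k by auto
      then show ?thesis by (simp add: a_def diff_frac_eq frac_eq_eq) (simp add: algebra_simps)
    qed
    finally show ?thesis by simp
  qed
  have pX: "p * (n * X) = w" using n by (simp add: p_def X_def power2_eq_square)
  define h h' where "h = growth_potential \<delta> n k" and "h' = growth_potential \<delta> n (k + 1)"
  have h: "h = a + a\<^sup>2 / \<delta>" by (simp add: h_def growth_potential_def a_def)
  have h': "h' = a * (1 - X) + a\<^sup>2 * (1 - X)\<^sup>2 / \<delta>"
    unfolding h'_def growth_potential_def a' by (simp add: power_mult_distrib)
  have diff: "h - h' = a * X + a\<^sup>2 / \<delta> * (2 * X - X\<^sup>2)"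
    unfolding h h' by (simp add: power2_eq_square algebra_simps diff_divide_distrib add_divide_distrib)
  have key: "2 * (1 - \<delta>) * X * h \<le> w * (h - h')"
  proof (cases "n \<le> 2 * k")
    case True
    have "2 * (1 - \<delta>) * X * h \<le> 2 * X * h"
      using X0 \<delta> a0 by (intro mult_right_mono) (auto simp: h)
    also have "\<dots> \<le> 2 * (a * X + a\<^sup>2 / \<delta> * (2 * X - X\<^sup>2))"
    proof -
      have "0 \<le> a\<^sup>2 / \<delta> * (X * (1 - X))" using \<delta> X0 X1 by simp
      moreover have "2 * X * (a + b) = 2 * (a * X + b * (2 * X - X\<^sup>2)) - 2 * (b * (X * (1 - X)))" for b
        by (simp add: power2_eq_square algebra_simps)
      ultimately show ?thesis unfolding h by simp
    qed
    finally show ?thesis using True by (simp add: w_def diff)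
  next
    case False
    \<comment> \<open>At rate 1 the linear term alone decays only half as fast as required. The
      square has relative drop 2 X - X^2, almost twice \<open>X\<close>, which makes up for the
      rate; its weight 1 / \<open>\<delta>\<close> and \<open>1 \<le> a\<close> let it carry the
      linear term as well, at the price of the factor 1 - \<open>\<delta>\<close>.\<close>
    then have a1: "1 \<le> a" using k by (simp add: a_def)
    have "X \<le> \<delta>"
    proof -
      have "X \<le> 2 / (k + 1)"
      proof -
        have "n / (n - k) \<le> 2" using False n by (simp add: divide_le_eq)
        then have "n / (n - k) / (k + 1) \<le> 2 / (k + 1)" using n by (intro divide_right_mono) auto
        then show ?thesis by (simp add: X_def)
      qed
      also have "\<dots> \<le> \<delta>" using k\<delta> \<delta> k by (simp add: field_simps)
      finally show ?thesis .
    qed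
    then have "a * X / \<delta> \<le> a" using \<delta> a0 by (simp add: field_simps)
    moreover have "1 - a \<ge> 2 - 2 * \<delta> - 2 * a" using a1 \<delta> by linarith
    ultimately have le: "2 + 2 * (a / \<delta>) - 2 * \<delta> - 2 * a \<le> 1 + 2 * (a / \<delta>) - a * X / \<delta>" by linarith
    have e1: "1 + a / \<delta> * (2 - X) = 1 + 2 * (a / \<delta>) - a * X / \<delta>" by (simp add: algebra_simps)
    have e2: "2 * (1 - \<delta>) * (1 + a / \<delta>) = 2 + 2 * (a / \<delta>) - 2 * \<delta> - 2 * a"
      using \<delta> by (simp add: algebra_simps)
    have "2 * (1 - \<delta>) * (1 + a / \<delta>) \<le> 1 + a / \<delta> * (2 - X)" using le unfolding e1 e2 .
    then have "(a * X) * (2 * (1 - \<delta>) * (1 + a / \<delta>)) \<le> (a * X) * (1 + a / \<delta> * (2 - X))"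
      using a0 X0 by (intro mult_left_mono) auto
    moreover have ab: "a\<^sup>2 / \<delta> = a * (a / \<delta>)" by (simp add: power2_eq_square)
    have "2 * (1 - \<delta>) * X * (a + a * b) = (a * X) * (2 * (1 - \<delta>) * (1 + b))"
      and "a * X + a * b * (2 * X - X\<^sup>2) = (a * X) * (1 + b * (2 - X))" for b
      by (simp_all only: power2_eq_square, algebra+)
    then have "2 * (1 - \<delta>) * X * h = (a * X) * (2 * (1 - \<delta>) * (1 + a / \<delta>))"
      and "h - h' = (a * X) * (1 + a / \<delta> * (2 - X))"
      unfolding diff unfolding h ab by blast+
    ultimately show ?thesis using False by (simp only: w_def if_False mult_1)
  qed
  have "2 * (1 - \<delta>) / n * h \<le> p * (h - h')"
  proof -
    have "p = w / (n * X)" using pX n X0 by (simp add: field_simps)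
    then have e1: "p * (h - h') = w * (h - h') / (n * X)" by simp
    have e2: "2 * (1 - \<delta>) / n * h = 2 * (1 - \<delta>) * X * h / (n * X)" using n X0 by simp
    show ?thesis unfolding e1 e2 using n X0 by (intro divide_right_mono key) simp
  qed
  then show ?thesis unfolding h_def[symmetric] h'_def[symmetric] by (simp add: algebra_simps)
qed

lemma covers_unif_full: "0 < n \<Longrightarrow> covers n t (unif {1..n}) 1"
  by (rule covers_later[of n 0]) (auto simp: covers_def unif_def)

text \<open>\<open>n * growth_potential\<close> is 0 at the full set and at least 1 at the other
  nonempty sets (the worst case is a single missing point), so it dominates the probability that the
  set is not yet full, as in Markov's inequality. The factor \<open>n\<close> in front of the decay
  is what makes the time n ln n / 2.\<close>

lemma covers_unif:
  fixes \<delta> :: real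
  assumes n: "2 \<le> n" and \<delta>: "0 < \<delta>" "\<delta> \<le> 1" and K: "K \<subseteq> {1..n}" "2 / \<delta> \<le> real (card K)"
  shows "covers n t (unif K) (1 - n * growth_potential \<delta> n (card K) * (1 - 2 * (1 - \<delta>) / n) ^ t)"
  using K
proof (induction t arbitrary: K)
  case (Suc t)
  let ?h = "growth_potential \<delta> n" and ?lam = "1 - 2 * (1 - \<delta>) / n"
  show ?case
  proof (cases "K = {1..n}")
    case False
    have fin: "finite K" using Suc.prems finite_subset by blast
    have kn: "card K < n" using psubset_card_mono[of "{1..n}" K] Suc.prems False by auto
    have k0: "0 < real (card K)" using Suc.prems(2) \<delta> by (smt (verit) divide_pos_pos)
    define w :: real where "w = (if real n \<le> 2 * real (card K) then 2 else 1)"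
    define p where "p = w * (real n - real (card K)) * (real (card K) + 1) / (real n)\<^sup>2"
    have "covers n (Suc t) (unif K) (p * (1 - n * ?h (real (card K) + 1) * ?lam ^ t) + (1 - p) * (1 - n * ?h (card K) * ?lam ^ t))"
      unfolding p_def
    proof (rule covers_unif_step)
      show "covers n t (unif (insert x K)) (1 - n * ?h (real (card K) + 1) * ?lam ^ t)" if "x \<in> {1..n} - K" for x
        using Suc.IH[of "insert x K"] that Suc.prems fin by (simp add: add.commute)
      show "w * (real n - real (card K)) \<le> real n"
        using kn by (auto simp: w_def)
    qed (use Suc n in \<open>auto simp: w_def\<close>)
    moreover have "1 - n * ?h (card K) * ?lam ^ Suc t \<le> p * (1 - n * ?h (real (card K) + 1) * ?lam ^ t) + (1 - p) * (1 - n * ?h (card K) * ?lam ^ t)"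
    proof -
      have "p * ?h (real (card K) + 1) + (1 - p) * ?h (card K) \<le> ?lam * ?h (card K)"
        unfolding p_def w_def using k0 kn \<delta> Suc.prems(2) by (intro growth_potential_step) auto
      moreover have "0 \<le> ?lam" using n \<delta> by (simp add: field_simps)
      ultimately have "n * ?lam ^ t * (p * ?h (real (card K) + 1) + (1 - p) * ?h (card K)) \<le> n * ?lam ^ t * (?lam * ?h (card K))"
        by (intro mult_left_mono) auto
      then show ?thesis by (simp add: algebra_simps)
    qed
    ultimately show ?thesis using covers_mono[OF _ order_refl] by blast
  qed (use covers_unif_full n in \<open>simp add: growth_potential_def\<close>)
next
  case 0
  show ?case
  proof (cases "K = {1..n}")
    case False
    have kn: "card K < n" using psubset_card_mono[of "{1..n}" K] 0 False by auto
    have k0: "0 < real (card K)" using 0(2) \<delta> by (smt (verit) divide_pos_pos)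
    have "1 \<le> n * ((real n - card K) / card K)"
    proof -
      have "real (card K) * 1 \<le> real n * (real n - card K)" using kn by (intro mult_mono) auto
      then show ?thesis using k0 by (simp add: field_simps)
    qed
    also have "\<dots> \<le> n * growth_potential \<delta> n (card K)"
      using \<delta> by (intro mult_left_mono) (auto simp: growth_potential_def)
    finally show ?thesis
      by (intro covers_mono[OF covers_nonneg[of n "unif K"]]) (auto simp: unif_nonneg)
  qed (use covers_unif_full n in \<open>simp add: growth_potential_def\<close>)
qed

section \<open>From even permutations to all permutations\<close>

text \<open>A probability density only if \<open>K\<close> has at least two points; below,
  \<open>K\<close> is of linear size.\<close>

definition even_unif :: "'a set \<Rightarrow> ('a \<Rightarrow> 'a) \<Rightarrow> real" where
  "even_unif K \<pi> = (if \<pi> permutes K \<and> evenperm \<pi> then 2 / fact (card K) else 0)"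

lemma even_unif_nonneg: "0 \<le> even_unif K \<pi>"
  by (simp add: even_unif_def)

lemma even_unif_transpose:
  assumes K: "finite K" and ij: "i \<in> K" "j \<in> K" "i \<noteq> j"
  shows "even_unif K (tr i j \<circ> \<pi>) = (if \<pi> permutes K \<and> \<not> evenperm \<pi> then 2 / fact (card K) else 0)"
proof -
  have iff: "tr i j \<circ> \<pi> permutes K \<longleftrightarrow> \<pi> permutes K"
    using transpose_comp_permutes[of _ K i j] ij by (metis transpose_comp_transpose_comp)
  moreover have "evenperm (tr i j \<circ> \<pi>) \<longleftrightarrow> \<not> evenperm \<pi>" if "\<pi> permutes K"
    using that K ij by (subst evenperm_comp) (auto simp: permutation_swap_id evenperm_swap intro: permutes_imp_permutation)
  ultimately show ?thesis by (auto simp: even_unif_def)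
qed

text \<open>Every transposition inside \<open>K\<close> turns \<open>even_unif K\<close> into the
  same uniform density on the odd permutations of \<open>K\<close>, and the average of the two
  densities is \<open>unif K\<close>. The n identity pairs are matched with n of the k (k - 1)
  ordered pairs in \<open>K\<close>, which uses 2 n of the n^2 pairs.\<close>

lemma covers_even_unif_step:
  assumes K: "K \<subseteq> {1..n}" and n: "0 < n" and k: "n \<le> card K * (card K - 1)"
    and v: "covers n t (even_unif K) v" and u: "covers n t (unif K) u"
  shows "covers n (Suc t) (even_unif K) (2 / n * u + (1 - 2 / n) * v)"
  unfolding covers_def
proof (intro allI impI)
  fix \<pi> :: "nat \<Rightarrow> nat" assume \<pi>: "\<pi> permutes {1..n}"
  let ?N = "{1..n}"
  have fin: "finite K" using K finite_subset by blast
  define F where "F = (\<lambda>\<sigma>. fact n * rsteps n t (even_unif K) \<sigma>)"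
  define U where "U = fact n * rsteps n t (unif K) \<pi>"
  define Od where "Od = fact n * rsteps n t (\<lambda>\<pi>. 2 * unif K \<pi> - even_unif K \<pi>) \<pi>"
  have "1 < card K"
  proof (rule ccontr)
    assume "\<not> 1 < card K"
    then have "card K = 0 \<or> card K - 1 = 0" by linarith
    then have "card K * (card K - 1) = 0" by (simp only: mult_eq_0_iff)
    then show False using k n by linarith
  qed
  then obtain i0 j0 where ij0: "i0 \<in> K" "j0 \<in> K" "i0 \<noteq> j0"
    by (metis card_le_Suc0_iff_eq fin not_less One_nat_def)
  have odd: "even_unif K (tr i j \<circ> \<sigma>) = 2 * unif K \<sigma> - even_unif K \<sigma>" if "i \<in> K" "j \<in> K" "i \<noteq> j" for i j \<sigma>
    unfolding even_unif_transpose[OF fin that] by (auto simp: even_unif_def unif_def)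
  have FO: "F (tr i j \<circ> \<pi>) = Od" if "i \<in> K" "j \<in> K" "i \<noteq> j" for i j
  proof -
    have "tr i j permutes ?N" using that K by (intro permutes_swap_id) auto
    then have "F (tr i j \<circ> \<pi>) = fact n * rsteps n t (\<lambda>\<pi>. even_unif K (tr i j \<circ> \<pi>)) \<pi>"
      unfolding F_def by (simp add: rsteps_left)
    then show ?thesis unfolding Od_def odd[OF that] .
  qed
  have UFO: "2 * U = F \<pi> + Od"
  proof -
    have "rsteps n t (\<lambda>\<pi>. 2 * unif K \<pi>) \<pi> = rsteps n t (\<lambda>\<pi>. even_unif K \<pi> + (2 * unif K \<pi> - even_unif K \<pi>)) \<pi>"
      by simp
    also have "\<dots> = rsteps n t (even_unif K) \<pi> + rsteps n t (\<lambda>\<pi>. 2 * unif K \<pi> - even_unif K \<pi>) \<pi>"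
      by (rule rsteps_add)
    finally show ?thesis unfolding rsteps_cmult U_def F_def Od_def by (simp add: algebra_simps)
  qed
  have vO: "v \<le> Od"
    unfolding FO[OF ij0, symmetric] F_def using ij0 K by (intro coversD[OF v] transpose_comp_permutes \<pi>) auto
  have uU: "u \<le> U" unfolding U_def by (intro coversD[OF u] \<pi>)
  define D where "D = (\<lambda>i. (i, i :: nat)) ` ?N"
  define E where "E = K \<times> K - D"
  define Z where "Z = ?N \<times> ?N - D - E"
  let ?f = "\<lambda>(i, j). F (tr i j \<circ> \<pi>)"
  have dec: "(\<Sum>q\<in>?N \<times> ?N. h q) = (\<Sum>q\<in>D. h q) + (\<Sum>q\<in>E. h q) + (\<Sum>q\<in>Z. h q)" for h :: "nat \<times> nat \<Rightarrow> real"
  proof -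
    have "?N \<times> ?N = D \<union> (E \<union> Z)" unfolding Z_def E_def D_def using K by auto
    moreover have "D \<inter> (E \<union> Z) = {}" "E \<inter> Z = {}" unfolding Z_def E_def by auto
    moreover have "finite D" "finite E" "finite Z" using fin by (auto simp: D_def E_def Z_def)
    ultimately show ?thesis by (simp add: sum.union_disjoint)
  qed
  have sD: "(\<Sum>q\<in>D. ?f q) = real n * F \<pi>" unfolding D_def by (subst sum.reindex) (auto simp: inj_on_def)
  have sE: "(\<Sum>q\<in>E. ?f q) = real (card E) * Od"
  proof -
    have "(\<Sum>q\<in>E. ?f q) = (\<Sum>q\<in>E. Od)" using K by (intro sum.cong refl) (auto simp: E_def D_def intro!: FO)
    then show ?thesis by simp
  qed
  have cE: "n \<le> card E"
  proof -
    have "K \<times> K \<inter> D = (\<lambda>i. (i, i)) ` K" using K by (auto simp: D_def)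
    then have "card (K \<times> K \<inter> D) = card K" by (simp add: card_image inj_on_def)
    then have "card E = card K * card K - card K"
      unfolding E_def using fin by (simp add: card_Diff_subset_Int card_cartesian_product)
    then show ?thesis using k by (simp add: right_diff_distrib')
  qed
  have lZ: "real (card Z) * v \<le> (\<Sum>q\<in>Z. ?f q)"
    using coversD[OF v transpose_comp_permutes[OF \<pi>]]
    by (intro sum_bounded_below) (auto simp: Z_def F_def)
  have cZ: "real (card Z) = (real n)\<^sup>2 - real n - real (card E)"
  proof -
    have "real (card D) = real n" unfolding D_def by (simp add: card_image inj_on_def)
    then show ?thesis using dec[of "\<lambda>_. 1"] by (simp add: power2_eq_square)
  qed
  have "(2 / n * u + (1 - 2 / n) * v) * (real n)\<^sup>2 = 2 * real n * u + (real (card E) - real n) * v + real (card Z) * v"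
    using n unfolding cZ by (simp add: field_simps power2_eq_square)
  also have "\<dots> \<le> 2 * real n * U + (real (card E) - real n) * Od + (\<Sum>q\<in>Z. ?f q)"
    using uU vO lZ cE by (intro add_mono mult_left_mono) auto
  also have "\<dots> = (\<Sum>q\<in>?N \<times> ?N. ?f q)"
  proof -
    have "2 * real n * U = real n * (F \<pi> + Od)" using UFO by (simp flip: UFO)
    then show ?thesis unfolding dec sD sE by (simp add: algebra_simps)
  qed
  also have "\<dots> = fact n * rsteps n (Suc t) (even_unif K) \<pi> * (real n)\<^sup>2"
    unfolding rsteps_Suc rstep_def[of _ _ \<pi>] F_def using n by (simp add: sum_distrib_left case_prod_beta)
  finally show "2 / n * u + (1 - 2 / n) * v \<le> fact n * rsteps n (Suc t) (even_unif K) \<pi>" using n by simp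
qed

text \<open>The repairing step arrives after a geometric waiting time. What is then left of the
  \<open>s\<close> steps is added to the growth phase, where extra time does no harm.\<close>

lemma covers_even_unif:
  assumes K: "K \<subseteq> {1..n}" and n: "0 < n" and k: "n \<le> card K * (card K - 1)"
    and u: "covers n t (unif K) u"
  shows "covers n (t + s) (even_unif K) (u * (1 - (1 - 2 / n) ^ s))"
proof (induction s)
  case 0
  show ?case by (simp, intro covers_nonneg even_unif_nonneg)
next
  case (Suc s)
  have "covers n (t + s) (unif K) u" using u n by (rule covers_later) simp
  from covers_even_unif_step[OF K n k Suc this]
  show ?case by (simp add: algebra_simps)
qed

section \<open>Products of random cycles\<close>

definition conv :: "nat \<Rightarrow> ((nat \<Rightarrow> nat) \<Rightarrow> real) \<Rightarrow> ((nat \<Rightarrow> nat) \<Rightarrow> real) \<Rightarrow> (nat \<Rightarrow> nat) \<Rightarrow> real" where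
  "conv n f h \<pi> = (\<Sum>\<sigma> | \<sigma> permutes {1..n}. f \<sigma> * h (inv \<sigma> \<circ> \<pi>))"

lemma sum_permutes_left:
  assumes "g permutes S"
  shows "(\<Sum>\<sigma> | \<sigma> permutes S. F (g \<circ> \<sigma>)) = (\<Sum>\<sigma> | \<sigma> permutes S. F \<sigma>)"
proof (rule sum.reindex_bij_witness[where i="\<lambda>\<sigma>. inv g \<circ> \<sigma>" and j="\<lambda>\<sigma>. g \<circ> \<sigma>"])
  show "inv g \<circ> (g \<circ> \<sigma>) = \<sigma>" "g \<circ> (inv g \<circ> \<sigma>) = \<sigma>" for \<sigma>
    using permutes_inv_o[OF assms] by (simp_all flip: comp_assoc)
qed (auto intro: permutes_compose permutes_inv assms)

lemma conv_left:
  assumes g: "g permutes {1..n}"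
  shows "conv n (\<lambda>\<sigma>. f (g \<circ> \<sigma>)) h \<pi> = conv n f h (g \<circ> \<pi>)"
proof -
  have "inv (g \<circ> \<sigma>) \<circ> (g \<circ> \<pi>) = inv \<sigma> \<circ> \<pi>" if "\<sigma> permutes {1..n}" for \<sigma>
  proof -
    have "inv (g \<circ> \<sigma>) = inv \<sigma> \<circ> inv g" using permutes_bij[OF g] permutes_bij[OF that] by (rule o_inv_distrib)
    then show ?thesis using permutes_inv_o(2)[OF g] by (simp add: comp_assoc) (simp flip: comp_assoc)
  qed
  then have "conv n (\<lambda>\<sigma>. f (g \<circ> \<sigma>)) h \<pi> = (\<Sum>\<sigma> | \<sigma> permutes {1..n}. f (g \<circ> \<sigma>) * h (inv (g \<circ> \<sigma>) \<circ> (g \<circ> \<pi>)))"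
    unfolding conv_def by simp
  also have "\<dots> = conv n f h (g \<circ> \<pi>)"
    unfolding conv_def by (rule sum_permutes_left[OF g, where F="\<lambda>\<sigma>. f \<sigma> * h (inv \<sigma> \<circ> (g \<circ> \<pi>))"])
  finally show ?thesis .
qed

lemma conv_right: "conv n f (\<lambda>\<sigma>. h (\<sigma> \<circ> g)) \<pi> = conv n f h (\<pi> \<circ> g)"
  unfolding conv_def by (simp add: comp_assoc)

lemma conv_sum_left: "conv n (\<lambda>\<sigma>. \<Sum>a\<in>I. w a * f a \<sigma>) h \<pi> = (\<Sum>a\<in>I. w a * conv n (f a) h \<pi>)"
  unfolding conv_def sum_distrib_left sum_distrib_right by (subst sum.swap) (simp add: mult_ac)

lemma conv_sum_right: "conv n f (\<lambda>\<sigma>. \<Sum>a\<in>I. w a * h a \<sigma>) \<pi> = (\<Sum>a\<in>I. w a * conv n f (h a) \<pi>)"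
  unfolding conv_def sum_distrib_left by (subst sum.swap) (simp add: mult_ac)

lemma conv_cong:
  assumes "\<And>\<sigma>. \<sigma> permutes {1..n} \<Longrightarrow> f \<sigma> = f' \<sigma>" "\<And>\<sigma>. \<sigma> permutes {1..n} \<Longrightarrow> h \<sigma> = h' \<sigma>" "\<pi> permutes {1..n}"
  shows "conv n f h \<pi> = conv n f' h' \<pi>"
  unfolding conv_def
proof (intro sum.cong refl)
  fix \<sigma> :: "nat \<Rightarrow> nat" assume "\<sigma> \<in> {\<sigma>. \<sigma> permutes {1..n}}"
  then have "\<sigma> permutes {1..n}" "inv \<sigma> \<circ> \<pi> permutes {1..n}"
    using assms(3) permutes_compose permutes_inv by blast+
  then show "f \<sigma> * h (inv \<sigma> \<circ> \<pi>) = f' \<sigma> * h' (inv \<sigma> \<circ> \<pi>)" using assms(1,2) by simp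
qed

lemma conv_nonneg:
  assumes "\<And>\<sigma>. \<sigma> permutes {1..n} \<Longrightarrow> 0 \<le> f \<sigma>" "\<And>\<sigma>. \<sigma> permutes {1..n} \<Longrightarrow> 0 \<le> h \<sigma>" "\<pi> permutes {1..n}"
  shows "0 \<le> conv n f h \<pi>"
  unfolding conv_def
proof (intro sum_nonneg)
  fix \<sigma> :: "nat \<Rightarrow> nat" assume "\<sigma> \<in> {\<sigma>. \<sigma> permutes {1..n}}"
  then have "\<sigma> permutes {1..n}" "inv \<sigma> \<circ> \<pi> permutes {1..n}"
    using assms(3) permutes_compose permutes_inv by blast+
  then show "0 \<le> f \<sigma> * h (inv \<sigma> \<circ> \<pi>)" using assms(1,2) by simp
qed

text \<open>New steps multiply on the left, so they change only the left factor of a product; the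
  right factor is carried along untouched.\<close>

lemma rstep_conv: "rstep n (conv n f h) \<pi> = conv n (rstep n f) h \<pi>"
proof -
  have "(\<Sum>(i, j)\<in>{1..n} \<times> {1..n}. conv n f h (tr i j \<circ> \<pi>)) =
    (\<Sum>(i, j)\<in>{1..n} \<times> {1..n}. conv n (\<lambda>\<sigma>. f (tr i j \<circ> \<sigma>)) h \<pi>)"
    by (intro sum.cong refl) (auto simp: conv_left permutes_swap_id)
  also have "\<dots> = (\<Sum>p\<in>{1..n} \<times> {1..n}. 1 * conv n (\<lambda>\<sigma>. f (tr (fst p) (snd p) \<circ> \<sigma>)) h \<pi>)"
    by (simp add: case_prod_beta)
  also have "\<dots> = conv n (\<lambda>\<sigma>. \<Sum>p\<in>{1..n} \<times> {1..n}. 1 * f (tr (fst p) (snd p) \<circ> \<sigma>)) h \<pi>"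
    by (rule conv_sum_left[symmetric])
  finally have "rstep n (conv n f h) \<pi> = conv n (\<lambda>\<sigma>. \<Sum>p\<in>{1..n} \<times> {1..n}. 1 * f (tr (fst p) (snd p) \<circ> \<sigma>)) h \<pi> / (real n)\<^sup>2"
    by (simp add: rstep_def)
  also have "\<dots> = conv n (rstep n f) h \<pi>"
    unfolding conv_def rstep_def by (subst sum_divide_distrib) (simp add: case_prod_beta)
  finally show ?thesis .
qed

section \<open>Uniform cycles and the product of two of them\<close>

definition cyc_unif :: "'a set \<Rightarrow> ('a \<Rightarrow> 'a) \<Rightarrow> real" where
  "cyc_unif A \<pi> = (if \<pi> \<in> cycles_on A then 1 / fact (card A - 1) else 0)"

lemma cyc_unif_nonneg: "0 \<le> cyc_unif A \<pi>"
  by (simp add: cyc_unif_def)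

lemma cyc_unif_insert:
  assumes A: "finite A" "x \<notin> A" "A \<noteq> {}"
  shows "cyc_unif (insert x A) \<pi> = (\<Sum>y\<in>A. 1 / card A * cyc_unif A (tr x y \<circ> \<pi>))"
proof -
  have k: "0 < card A" using A by (simp add: card_gt_0_iff)
  have fk: "fact (card (insert x A) - 1) = real (card A) * fact (card A - 1)"
    using A k by (simp add: fact_reduce[of "card A"])
  have iff: "tr x y \<circ> \<pi> \<in> cycles_on A \<longleftrightarrow> \<pi> \<in> cycles_on (insert x A) \<and> \<pi> x = y" if y: "y \<in> A" for y
  proof
    assume B: "tr x y \<circ> \<pi> \<in> cycles_on A"
    then have p: "tr x y \<circ> \<pi> permutes A" by (simp add: cycles_on_def)
    have "tr x y (\<pi> x) = x" using permutes_not_in[OF p A(2)] by simp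
    then have "\<pi> x = y" by (metis transpose_apply_first transpose_involutory)
    moreover have "tr x y \<circ> (tr x y \<circ> \<pi>) \<in> cycles_on (insert x A)"
      using cycles_on_transpose_comp_iff[OF p A(1,2) y] B by simp
    ultimately show "\<pi> \<in> cycles_on (insert x A) \<and> \<pi> x = y" by simp
  next
    assume B: "\<pi> \<in> cycles_on (insert x A) \<and> \<pi> x = y"
    then have p: "tr x y \<circ> \<pi> permutes A" using permutes_insert_lemma[of \<pi> x A] by (auto simp: cycles_on_def)
    then show "tr x y \<circ> \<pi> \<in> cycles_on A" using cycles_on_transpose_comp_iff[OF p A(1,2) y] B by simp
  qed
  show ?thesis
  proof (cases "\<pi> \<in> cycles_on (insert x A)")
    case True
    have "\<pi> x \<noteq> x"
    proof
      assume "\<pi> x = x"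
      then have "orbit \<pi> x = {x}" by (simp add: orbit_eq_singleton_iff)
      then show False using True orbit_cyclic_eq3[of \<pi> "insert x A" x] A by (auto simp: cycles_on_def)
    qed
    moreover have "\<pi> x \<in> insert x A" using True by (metis (mono_tags) cycles_on_def insertI1 mem_Collect_eq permutes_in_image)
    ultimately have px: "\<pi> x \<in> A" by simp
    have "(\<Sum>y\<in>A. 1 / card A * cyc_unif A (tr x y \<circ> \<pi>)) = (\<Sum>y\<in>A. if y = \<pi> x then 1 / card A * (1 / fact (card A - 1)) else 0)"
      using True by (intro sum.cong refl) (auto simp: cyc_unif_def iff)
    then show ?thesis using px A True fk by (simp add: cyc_unif_def)
  next
    case False
    then have "(\<Sum>y\<in>A. 1 / card A * cyc_unif A (tr x y \<circ> \<pi>)) = 0"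
      by (intro sum.neutral ballI) (auto simp: cyc_unif_def iff)
    then show ?thesis using False by (simp add: cyc_unif_def)
  qed
qed

lemma cyc_unif_inv:
  assumes "bij \<pi>" "finite A"
  shows "cyc_unif A (inv \<pi>) = cyc_unif A \<pi>"
proof -
  have "inv \<sigma> \<in> cycles_on A" if "\<sigma> \<in> cycles_on A" for \<sigma> :: "'a \<Rightarrow> 'a"
    using that orbit_inv_eq[of \<sigma>] assms(2)
    by (auto simp: cycles_on_def cyclic_on_def intro: permutes_inv permutes_imp_permutation)
  then have "inv \<pi> \<in> cycles_on A \<longleftrightarrow> \<pi> \<in> cycles_on A"
    using inv_inv_eq[OF assms(1)] by metis
  then show ?thesis by (simp add: cyc_unif_def)
qed

text \<open>The left version read for inverses. In the second factor of a convolution the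
  transposition has to be split off on this side to end up outside the product.\<close>

lemma cyc_unif_insert_right:
  assumes A: "finite A" "x \<notin> A" "A \<noteq> {}" and \<pi>: "bij \<pi>"
  shows "cyc_unif (insert x A) \<pi> = (\<Sum>y\<in>A. 1 / card A * cyc_unif A (\<pi> \<circ> tr x y))"
proof -
  have "cyc_unif A (tr x y \<circ> inv \<pi>) = cyc_unif A (\<pi> \<circ> tr x y)" for y
  proof -
    have "inv (\<pi> \<circ> tr x y) = tr x y \<circ> inv \<pi>" using \<pi> by (simp add: o_inv_distrib)
    moreover have "bij (\<pi> \<circ> tr x y)" using \<pi> by (simp add: bij_comp)
    ultimately show ?thesis using cyc_unif_inv[of "\<pi> \<circ> tr x y" A] A by simp
  qed
  then show ?thesis
    using cyc_unif_insert[OF A, of "inv \<pi>"] cyc_unif_inv[OF \<pi>, of "insert x A"] A by simp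
qed

lemma covers_conv_cyc_insert_left:
  assumes c: "covers n t (conv n (cyc_unif A) h) c" and A: "insert x A \<subseteq> {1..n}" "x \<notin> A" "A \<noteq> {}"
  shows "covers n t (conv n (cyc_unif (insert x A)) h) c"
proof -
  have fin: "finite A" using A by (meson finite_atLeastAtMost finite_subset insert_subset)
  have "covers n t (\<lambda>\<pi>. \<Sum>y\<in>A. 1 / card A * conv n (\<lambda>\<sigma>. cyc_unif A (tr x y \<circ> \<sigma>)) h \<pi>) (\<Sum>y\<in>A. 1 / card A * c)"
  proof (rule covers_sum)
    fix y assume "y \<in> A"
    then have p: "tr x y permutes {1..n}" using A by (intro permutes_swap_id) auto
    show "covers n t (conv n (\<lambda>\<sigma>. cyc_unif A (tr x y \<circ> \<sigma>)) h) c"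
      unfolding conv_left[OF p] by (rule covers_left[OF c p])
  qed simp
  moreover have "(\<Sum>y\<in>A. 1 / card A * c) = c" using fin A by simp
  moreover have "conv n (cyc_unif (insert x A)) h = (\<lambda>\<pi>. \<Sum>y\<in>A. 1 / card A * conv n (\<lambda>\<sigma>. cyc_unif A (tr x y \<circ> \<sigma>)) h \<pi>)"
    unfolding conv_sum_left[symmetric] by (simp add: cyc_unif_insert[OF fin A(2,3), abs_def])
  ultimately show ?thesis by simp
qed

lemma covers_conv_cyc_insert_right:
  assumes c: "covers n t (conv n h (cyc_unif A)) c" and A: "insert x A \<subseteq> {1..n}" "x \<notin> A" "A \<noteq> {}"
  shows "covers n t (conv n h (cyc_unif (insert x A))) c"
proof -
  have fin: "finite A" using A by (meson finite_atLeastAtMost finite_subset insert_subset)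
  have cov: "covers n t (\<lambda>\<pi>. \<Sum>y\<in>A. 1 / card A * conv n h (\<lambda>\<sigma>. cyc_unif A (\<sigma> \<circ> tr x y)) \<pi>) (\<Sum>y\<in>A. 1 / card A * c)"
  proof (rule covers_sum)
    fix y assume "y \<in> A"
    then have p: "tr x y permutes {1..n}" using A by (intro permutes_swap_id) auto
    show "covers n t (conv n h (\<lambda>\<sigma>. cyc_unif A (\<sigma> \<circ> tr x y))) c"
      unfolding conv_right by (rule covers_right[OF c p])
  qed simp
  have c_eq: "(\<Sum>y\<in>A. 1 / card A * c) = c" using fin A by simp
  have e: "conv n h (cyc_unif (insert x A)) \<pi> = (\<Sum>y\<in>A. 1 / card A * conv n h (\<lambda>\<sigma>. cyc_unif A (\<sigma> \<circ> tr x y)) \<pi>)"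
    if "\<pi> permutes {1..n}" for \<pi>
    unfolding conv_sum_right[symmetric]
    using cyc_unif_insert_right[OF fin A(2,3) permutes_bij] that by (intro conv_cong) blast+
  show ?thesis by (rule covers_mono[OF cov]) (simp_all only: e c_eq order_refl)
qed

text \<open>Points of \<open>A - B\<close> are cut out of the left cycle by transpositions on its
  left, points of \<open>B - A\<close> out of the right cycle by transpositions on its right. All of
  them stand outside the product, where translations do not affect \<open>covers\<close>.\<close>

lemma covers_conv_cyc:
  assumes c: "covers n t (conv n (cyc_unif (A \<inter> B)) (cyc_unif (A \<inter> B))) c"
    and AB: "A \<subseteq> {1..n}" "B \<subseteq> {1..n}" "A \<inter> B \<noteq> {}"
  shows "covers n t (conv n (cyc_unif A) (cyc_unif B)) c"
proof -
  have fin: "finite (A - B)" "finite (B - A)" using AB by (auto intro: finite_subset)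
  have 1: "covers n t (conv n (cyc_unif (A \<inter> B \<union> D)) (cyc_unif (A \<inter> B))) c" if "D \<subseteq> A - B" for D
    using finite_subset[OF that fin(1)] that
  proof (induction D rule: finite_induct)
    case (insert x D)
    have eq: "A \<inter> B \<union> insert x D = insert x (A \<inter> B \<union> D)" by blast
    have "insert x (A \<inter> B \<union> D) \<subseteq> {1..n}" "x \<notin> A \<inter> B \<union> D" "A \<inter> B \<union> D \<noteq> {}" "D \<subseteq> A - B"
      using insert.prems insert.hyps AB by blast+
    then show ?case unfolding eq using insert.IH by (intro covers_conv_cyc_insert_left)
  qed (use c in simp)
  have 2: "covers n t (conv n (cyc_unif A) (cyc_unif (A \<inter> B \<union> D))) c" if "D \<subseteq> B - A" for D
    using finite_subset[OF that fin(2)] that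
  proof (induction D rule: finite_induct)
    case empty
    have "A \<inter> B \<union> (A - B) = A" by auto
    then show ?case using 1[of "A - B"] by simp
  next
    case (insert x D)
    have eq: "A \<inter> B \<union> insert x D = insert x (A \<inter> B \<union> D)" by blast
    have "insert x (A \<inter> B \<union> D) \<subseteq> {1..n}" "x \<notin> A \<inter> B \<union> D" "A \<inter> B \<union> D \<noteq> {}" "D \<subseteq> B - A"
      using insert.prems insert.hyps AB by blast+
    then show ?case unfolding eq using insert.IH by (intro covers_conv_cyc_insert_right)
  qed
  have "A \<inter> B \<union> (B - A) = B" by auto
  then show ?thesis using 2[of "B - A"] by simp
qed

lemma conv_cyc_ge_even_unif:
  assumes K: "K \<subseteq> {1..n}" "K \<noteq> {}"
  shows "card K / (real (card K) + 3) * even_unif K \<pi> \<le> conv n (cyc_unif K) (cyc_unif K) \<pi>"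
proof (cases "\<pi> permutes K \<and> evenperm \<pi>")
  case True
  have fin: "finite K" using K finite_subset by blast
  have k: "0 < card K" using fin K by (simp add: card_gt_0_iff)
  have p: "permutation \<pi>" using True fin by (auto intro: permutes_imp_permutation)
  \<comment> \<open>\<open>inv \<pi> \<circ> c\<close> is the inverse of the second factor
    \<open>inv c \<circ> \<pi>\<close> in \<open>conv\<close>, so \<open>C\<close> is counted by
    \<open>cycle_factor_count\<close> at \<open>inv \<pi>\<close>, which is even too.\<close>
  define C where "C = {c \<in> cycles_on K. inv \<pi> \<circ> c \<in> cycles_on K}"
  have sub: "C \<subseteq> {\<sigma>. \<sigma> permutes {1..n}}" using K by (auto simp: C_def cycles_on_def intro: permutes_subset)
  have cyc: "cyc_unif K (inv \<sigma> \<circ> \<pi>) = 1 / fact (card K - 1)" if "\<sigma> \<in> C" for \<sigma>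
  proof -
    have b: "bij \<sigma>" "bij \<pi>" using that True by (auto simp: C_def cycles_on_def permutes_bij)
    then have "inv (inv \<pi> \<circ> \<sigma>) = inv \<sigma> \<circ> \<pi>" by (simp add: o_inv_distrib bij_imp_bij_inv inv_inv_eq)
    then have "cyc_unif K (inv \<sigma> \<circ> \<pi>) = cyc_unif K (inv \<pi> \<circ> \<sigma>)"
      using cyc_unif_inv[of "inv \<pi> \<circ> \<sigma>" K] b fin by (simp add: bij_comp bij_imp_bij_inv)
    then show ?thesis using that by (simp add: cyc_unif_def C_def)
  qed
  have "card K / (real (card K) + 3) * even_unif K \<pi> = fact (card K - 1) * (2 / (real (card K) + 3)) / (fact (card K - 1) * fact (card K - 1))"
    using True k by (simp add: even_unif_def fact_reduce[of "card K"])
  also have "\<dots> \<le> real (cycle_factor_count K (inv \<pi>)) / (fact (card K - 1) * fact (card K - 1))"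
    using True p by (intro divide_right_mono cycle_factor_count_ge fin K permutes_inv) (auto simp: evenperm_inv)
  also have "\<dots> = (\<Sum>\<sigma>\<in>C. cyc_unif K \<sigma> * cyc_unif K (inv \<sigma> \<circ> \<pi>))"
  proof -
    have "(\<Sum>\<sigma>\<in>C. cyc_unif K \<sigma> * cyc_unif K (inv \<sigma> \<circ> \<pi>)) = (\<Sum>\<sigma>\<in>C. 1 / (fact (card K - 1) * fact (card K - 1)))"
    proof (intro sum.cong refl)
      fix \<sigma> assume s: "\<sigma> \<in> C"
      then have "cyc_unif K \<sigma> = 1 / fact (card K - 1)" by (simp add: C_def cyc_unif_def)
      then show "cyc_unif K \<sigma> * cyc_unif K (inv \<sigma> \<circ> \<pi>) = 1 / (fact (card K - 1) * fact (card K - 1))"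
        using cyc[OF s] by simp
    qed
    then show ?thesis by (simp add: C_def cycle_factor_count_def)
  qed
  also have "\<dots> \<le> conv n (cyc_unif K) (cyc_unif K) \<pi>"
    unfolding conv_def by (intro sum_mono2 sub finite_permutations mult_nonneg_nonneg cyc_unif_nonneg) auto
  finally show ?thesis .
next
  case False
  then have "even_unif K \<pi> = 0" by (simp add: even_unif_def)
  moreover have "0 \<le> conv n (cyc_unif K) (cyc_unif K) \<pi>"
    unfolding conv_def by (intro sum_nonneg mult_nonneg_nonneg cyc_unif_nonneg)
  ultimately show ?thesis by simp
qed

section \<open>Splitting off one cycle of a permutation\<close>

lemma permutes_commute:
  assumes "p permutes A" "q permutes B" "A \<inter> B = {}"
  shows "p \<circ> q = q \<circ> p"
proof
  fix x
  consider "x \<in> A" "x \<notin> B" "p x \<in> A" "p x \<notin> B" | "x \<notin> A" "x \<in> B" "q x \<in> B" "q x \<notin> A" | "x \<notin> A" "x \<notin> B"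
    using assms by (metis disjoint_iff permutes_in_image)
  then show "(p \<circ> q) x = (q \<circ> p) x"
    using assms(1,2) by cases (simp_all add: permutes_not_in)
qed

text \<open>Start both cycles at the same point \<open>a\<close> and let \<open>s\<close> match
  their j-th iterates for j below \<open>card A\<close>. The last step closes up because both cycles
  are back at \<open>a\<close> at time \<open>card A\<close>.\<close>

lemma cycles_on_conj:
  assumes c: "c \<in> cycles_on A" and c0: "c0 \<in> cycles_on A" and A: "finite A"
  obtains s where "s permutes A" "s \<circ> c0 \<circ> inv s = c"
proof -
  obtain a where a: "a \<in> A" "A = orbit c a"
    using c unfolding cycles_on_def cyclic_on_def by blast
  have a0: "A = orbit c0 a" using orbit_cyclic_eq3[of c0 A a] c0 a(1) by (simp add: cycles_on_def)
  have pc: "c permutes A" "c0 permutes A" using c c0 by (auto simp: cycles_on_def)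
  have perm: "permutation c" "permutation c0" using permutes_imp_permutation[OF A] pc by blast+
  let ?f = "\<lambda>j. (c ^^ j) a" and ?h = "\<lambda>j. (c0 ^^ j) a"
  define p where "p = card A"
  have 1: "0 < p" "?f p = a" "A = ?f ` {..<p}" "inj_on ?f {..<p}"
  proof -
    obtain q where q: "0 < q" "?f q = a" "orbit c a = ?f ` {..<q}" "inj_on ?f {..<q}" "card (orbit c a) = q"
      by (rule orbit_period[OF perm(1), of a])
    have "p = q" using q(5) unfolding p_def a(2)[symmetric] .
    then show "0 < p" "?f p = a" "A = ?f ` {..<p}" "inj_on ?f {..<p}"
      using q(1-4) unfolding a(2)[symmetric] by blast+
  qed
  have 2: "?h p = a" "A = ?h ` {..<p}" "inj_on ?h {..<p}"
  proof -
    obtain q where q: "0 < q" "?h q = a" "orbit c0 a = ?h ` {..<q}" "inj_on ?h {..<q}" "card (orbit c0 a) = q"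
      by (rule orbit_period[OF perm(2), of a])
    have "p = q" using q(5) unfolding p_def a0[symmetric] .
    then show "?h p = a" "A = ?h ` {..<p}" "inj_on ?h {..<p}"
      using q(1-4) unfolding a0[symmetric] by blast+
  qed
  define s where "s = (\<lambda>x. if x \<in> A then ?f (inv_into {..<p} ?h x) else x)"
  have s: "s (?h j) = ?f j" if "j < p" for j
  proof -
    have "?h j \<in> A" using 2(2) that by auto
    then show ?thesis unfolding s_def using inv_into_f_f[OF 2(3)] that by simp
  qed
  have "bij_betw ?f {..<p} A" "bij_betw ?h {..<p} A" using 1 2 by (auto simp: bij_betw_def)
  then have "bij_betw (?f \<circ> inv_into {..<p} ?h) A A" by (blast intro: bij_betw_trans bij_betw_inv_into)
  then have bb: "bij_betw s A A" by (rule bij_betw_cong[THEN iffD1, rotated]) (simp add: s_def)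
  then have sp: "s permutes A" by (rule bij_imp_permutes) (simp add: s_def)
  have "s \<circ> c0 = c \<circ> s"
  proof
    fix x
    show "(s \<circ> c0) x = (c \<circ> s) x"
    proof (cases "x \<in> A")
      case True
      then obtain j where j: "j < p" "x = ?h j" using 2(2) by auto
      have "s (?h (Suc j)) = ?f (Suc j)"
      proof (cases "Suc j < p")
        case False
        then have "Suc j = p" using j by simp
        then show ?thesis using 1 2 s[of 0] by simp
      qed (rule s)
      then show ?thesis using j s[of j] by simp
    next
      case False
      then show ?thesis using pc by (simp add: s_def permutes_not_in)
    qed
  qed
  then have "s \<circ> c0 \<circ> inv s = c" using permutes_inv_o(1)[OF sp] by (simp add: comp_assoc)
  then show thesis using that sp by blast
qed

definition mass :: "nat \<Rightarrow> ((nat \<Rightarrow> nat) \<Rightarrow> real) \<Rightarrow> real" where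
  "mass n f = (\<Sum>\<sigma> | \<sigma> permutes {1..n}. f \<sigma>)"

lemma mass_cyc_unif:
  assumes "A \<subseteq> {1..n}" "A \<noteq> {}"
  shows "mass n (cyc_unif A) = 1"
proof -
  have fin: "finite A" using assms finite_subset by blast
  have "mass n (cyc_unif A) = (\<Sum>\<sigma>\<in>cycles_on A. 1 / fact (card A - 1))"
    unfolding mass_def cyc_unif_def
  proof (rule sum.mono_neutral_cong_right)
    show "cycles_on A \<subseteq> {\<sigma>. \<sigma> permutes {1..n}}"
      using assms by (auto simp: cycles_on_def intro: permutes_subset)
  qed (auto simp: finite_permutations)
  then show ?thesis using card_cycles_on[OF fin assms(2)] by simp
qed

text \<open>Outside \<open>A\<close> the factor \<open>r\<close> has to agree with \<open>a\<close>,
  so it can only be the restriction of \<open>a\<close> to the complement of \<open>A\<close>;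
  dividing it out leaves the cycle.\<close>

lemma cyclic_factor:
  assumes a: "a permutes N" and A: "A \<subseteq> N" and cyc: "cyclic_on a A"
  obtains r where "r permutes N - A" "inv r \<circ> a \<in> cycles_on A"
    "\<And>r'. r' permutes N - A \<Longrightarrow> inv r' \<circ> a \<in> cycles_on A \<Longrightarrow> r' = r"
proof -
  define r where "r = perm_restrict a (N - A)"
  have r: "r permutes N - A" unfolding r_def using a cyc by (rule perm_restrict_diff_cyclic)
  have rN: "r permutes N" using r by (auto intro: permutes_subset)
  have rA: "inv r (a x) = a x" if "x \<in> A" for x
    using cyclic_on_inI[OF cyc that] permutes_inv[OF r] by (simp add: permutes_not_in)
  have "inv r \<circ> a permutes A"
  proof (rule permutes_superset)
    show "inv r \<circ> a permutes N" using a rN by (intro permutes_compose permutes_inv)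
    fix x assume "x \<in> N - A"
    then have "r x = a x" by (simp add: r_def perm_restrict_def)
    then show "(inv r \<circ> a) x = x" using permutes_inverses(2)[OF r] by (metis comp_apply)
  qed
  moreover have "cyclic_on (inv r \<circ> a) A"
    using cyc rA cyclic_cong[of A "inv r \<circ> a" a] by simp
  ultimately have 1: "inv r \<circ> a \<in> cycles_on A" by (simp add: cycles_on_def)
  have "r' = r" if r': "r' permutes N - A" "inv r' \<circ> a \<in> cycles_on A" for r'
  proof
    fix x
    show "r' x = r x"
    proof (cases "x \<in> N - A")
      case True
      moreover have "inv r' \<circ> a permutes A" using r'(2) by (simp add: cycles_on_def)
      ultimately have "(inv r' \<circ> a) x = x" using permutes_not_in[of "inv r' \<circ> a" A x] by blast
      then have "r' x = a x" using permutes_inverses(1)[OF r'(1)] by (metis comp_apply)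
      then show ?thesis using True by (simp add: r_def perm_restrict_def)
    qed (use r r' in \<open>simp add: permutes_not_in\<close>)
  qed
  then show thesis using that r 1 by blast
qed

lemma cyclic_on_of_factor:
  assumes r: "r permutes N - A" and c: "inv r \<circ> a \<in> cycles_on A"
  shows "cyclic_on a A"
proof -
  have c': "cyclic_on (inv r \<circ> a) A" using c by (simp add: cycles_on_def)
  have "(inv r \<circ> a) x = a x" if "x \<in> A" for x
  proof -
    have "inv r (a x) \<in> A" using cyclic_on_inI[OF c' that] by simp
    then have "r (inv r (a x)) = inv r (a x)" using r by (simp add: permutes_not_in)
    then show ?thesis using permutes_inverses(1)[OF r] by simp
  qed
  then show ?thesis using c' cyclic_cong[of A "inv r \<circ> a" a] by blast
qed

lemma factor_left_right:
  assumes r: "r permutes N - A"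
  shows "inv r \<circ> a \<in> cycles_on A \<longleftrightarrow> a \<circ> inv r \<in> cycles_on A"
proof -
  note i = permutes_inv_o[OF r]
  show ?thesis
  proof
    assume c: "inv r \<circ> a \<in> cycles_on A"
    then have "(inv r \<circ> a) \<circ> r = r \<circ> (inv r \<circ> a)"
      using r by (intro permutes_commute[where A=A and B="N - A"]) (auto simp: cycles_on_def)
    then have "a = (inv r \<circ> a) \<circ> r" using i by (simp flip: comp_assoc)
    then have "a \<circ> inv r = inv r \<circ> a" using i(1) by (metis comp_assoc comp_id)
    then show "a \<circ> inv r \<in> cycles_on A" using c by simp
  next
    assume c: "a \<circ> inv r \<in> cycles_on A"
    then have "(a \<circ> inv r) \<circ> r = r \<circ> (a \<circ> inv r)"
      using r by (intro permutes_commute[where A=A and B="N - A"]) (auto simp: cycles_on_def)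
    then have "a = r \<circ> (a \<circ> inv r)" using i by (simp add: comp_assoc)
    then have "inv r \<circ> a = a \<circ> inv r" using i(2) by (metis comp_assoc id_comp)
    then show "inv r \<circ> a \<in> cycles_on A" using c by simp
  qed
qed

text \<open>Invariance is asked only under conjugation by permutations of \<open>A\<close>: once one
  cycle with support \<open>A\<close> has been selected, invariance under all of
  \<open>{1..n}\<close> is lost.\<close>

definition cycle_invariant :: "nat \<Rightarrow> nat set \<Rightarrow> ((nat \<Rightarrow> nat) \<Rightarrow> real) \<Rightarrow> bool" where
  "cycle_invariant n A f \<longleftrightarrow>
    (\<forall>a. a permutes {1..n} \<longrightarrow> 0 \<le> f a \<and> (f a \<noteq> 0 \<longrightarrow> cyclic_on a A) \<and>
      (\<forall>s. s permutes A \<longrightarrow> f (s \<circ> a \<circ> inv s) = f a))"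

lemma cycle_invariantD:
  assumes "cycle_invariant n A f" "a permutes {1..n}"
  shows "0 \<le> f a" "f a \<noteq> 0 \<Longrightarrow> cyclic_on a A" "s permutes A \<Longrightarrow> f (s \<circ> a \<circ> inv s) = f a"
  using assms unfolding cycle_invariant_def by blast+

text \<open>Given the rest \<open>r\<close> of the permutation, the cycle on \<open>A\<close> is
  uniform: permutations of \<open>A\<close> commute with \<open>r\<close>, and conjugation by them
  is transitive on \<open>cycles_on A\<close>, so \<open>f (r \<circ> c)\<close> is the same for all
  cycles \<open>c\<close>. Both orders of the factors are provided, so that \<open>r\<close> can
  stand on the outer side of either factor of a convolution.\<close>

lemma cycle_invariant_decompose:
  assumes f: "cycle_invariant n A f" and A: "A \<subseteq> {1..n}" "A \<noteq> {}"
  obtains W where "\<And>r. r permutes {1..n} - A \<Longrightarrow> 0 \<le> W r"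
    "\<And>a. a permutes {1..n} \<Longrightarrow> f a = (\<Sum>r | r permutes {1..n} - A. W r * cyc_unif A (inv r \<circ> a))"
    "\<And>a. a permutes {1..n} \<Longrightarrow> f a = (\<Sum>r | r permutes {1..n} - A. W r * cyc_unif A (a \<circ> inv r))"
    "mass n f = (\<Sum>r | r permutes {1..n} - A. W r)"
proof -
  let ?N = "{1..n}"
  have fin: "finite A" using A finite_subset by blast
  have "card (cycles_on A) \<noteq> 0" using card_cycles_on[OF fin A(2)] by simp
  then obtain c0 where c0: "c0 \<in> cycles_on A" by fastforce
  define W where "W = (\<lambda>r. fact (card A - 1) * f (r \<circ> c0))"
  have c0N: "c0 permutes ?N" using c0 A by (auto simp: cycles_on_def intro: permutes_subset)
  have rN: "r permutes ?N" if "r permutes ?N - A" for r using that by (auto intro: permutes_subset)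
  have W0: "0 \<le> W r" if "r permutes ?N - A" for r
    unfolding W_def using cycle_invariantD(1)[OF f permutes_compose[OF c0N rN[OF that]]] by simp
  have dec: "f a = (\<Sum>r | r permutes ?N - A. W r * cyc_unif A (inv r \<circ> a))" if a: "a permutes ?N" for a
  proof (cases "cyclic_on a A")
    case True
    obtain r where r: "r permutes ?N - A" "inv r \<circ> a \<in> cycles_on A"
      "\<And>r'. r' permutes ?N - A \<Longrightarrow> inv r' \<circ> a \<in> cycles_on A \<Longrightarrow> r' = r"
      using cyclic_factor[OF a A(1) True] by metis
    have "(\<Sum>r | r permutes ?N - A. W r * cyc_unif A (inv r \<circ> a)) = (\<Sum>r' | r' permutes ?N - A. if r' = r then W r * (1 / fact (card A - 1)) else 0)"
    proof (intro sum.cong refl)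
      fix q assume q: "q \<in> {r. r permutes ?N - A}"
      show "W q * cyc_unif A (inv q \<circ> a) = (if q = r then W r * (1 / fact (card A - 1)) else 0)"
      proof (cases "q = r")
        case False
        then have "inv q \<circ> a \<notin> cycles_on A" using r(3) q by blast
        then show ?thesis using False by (simp add: cyc_unif_def)
      qed (use r(2) in \<open>simp add: cyc_unif_def\<close>)
    qed
    also have "\<dots> = f (r \<circ> c0)"
      using r(1) finite_permutations[of "?N - A"] by (simp add: W_def)
    also have "\<dots> = f a"
    proof -
      obtain s where s: "s permutes A" "s \<circ> c0 \<circ> inv s = inv r \<circ> a" using cycles_on_conj[OF r(2) c0 fin] by metis
      have "s \<circ> r = r \<circ> s" using s(1) r(1) by (rule permutes_commute) auto
      then have "s \<circ> (r \<circ> c0) \<circ> inv s = r \<circ> (s \<circ> c0 \<circ> inv s)" by (metis comp_assoc)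
      also have "\<dots> = a" using s(2) permutes_inv_o(1)[OF r(1)] by (simp flip: comp_assoc)
      finally have "s \<circ> (r \<circ> c0) \<circ> inv s = a" .
      then show ?thesis
        using cycle_invariantD(3)[OF f permutes_compose[OF c0N rN[OF r(1)]] s(1)] by simp
    qed
    finally show ?thesis ..
  next
    case False
    then have "f a = 0" using cycle_invariantD(2)[OF f a] by blast
    moreover have "cyc_unif A (inv r \<circ> a) = 0" if "r permutes ?N - A" for r
      using cyclic_on_of_factor[OF that, of a] False by (auto simp: cyc_unif_def)
    ultimately show ?thesis by simp
  qed
  have dec2: "f a = (\<Sum>r | r permutes ?N - A. W r * cyc_unif A (a \<circ> inv r))" if a: "a permutes ?N" for a
    unfolding dec[OF a] by (intro sum.cong refl) (simp add: cyc_unif_def factor_left_right)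
  have "mass n f = (\<Sum>a | a permutes ?N. \<Sum>r | r permutes ?N - A. W r * cyc_unif A (inv r \<circ> a))"
    unfolding mass_def by (intro sum.cong refl) (simp add: dec)
  also have "\<dots> = (\<Sum>r | r permutes ?N - A. W r * (\<Sum>a | a permutes ?N. cyc_unif A (inv r \<circ> a)))"
    unfolding sum_distrib_left by (rule sum.swap)
  also have "\<dots> = (\<Sum>r | r permutes ?N - A. W r)"
  proof (intro sum.cong refl)
    fix r assume "r \<in> {r. r permutes ?N - A}"
    then have "inv r permutes ?N" using rN permutes_inv by blast
    then have "(\<Sum>a | a permutes ?N. cyc_unif A (inv r \<circ> a)) = mass n (cyc_unif A)"
      unfolding mass_def by (rule sum_permutes_left)
    then show "W r * (\<Sum>a | a permutes ?N. cyc_unif A (inv r \<circ> a)) = W r" using mass_cyc_unif[OF A] by simp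
  qed
  finally show thesis using that W0 dec dec2 by blast
qed

text \<open>The rests of both permutations are pulled out, to the left of the first factor and to
  the right of the second. What stays inside is a product of two uniform cycles, mixed with total
  weight \<open>mass n f * mass n g\<close>.\<close>

lemma covers_conv_cycle_invariant:
  assumes f: "cycle_invariant n A f" and A: "A \<subseteq> {1..n}" "A \<noteq> {}"
    and g: "cycle_invariant n B g" and B: "B \<subseteq> {1..n}" "B \<noteq> {}"
    and c: "covers n t (conv n (cyc_unif A) (cyc_unif B)) c"
  shows "covers n t (conv n f g) (mass n f * mass n g * c)"
proof -
  let ?N = "{1..n}"
  obtain W where W: "\<And>r. r permutes ?N - A \<Longrightarrow> 0 \<le> W r"
    "\<And>a. a permutes ?N \<Longrightarrow> f a = (\<Sum>r | r permutes ?N - A. W r * cyc_unif A (inv r \<circ> a))"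
    "\<And>a. a permutes ?N \<Longrightarrow> f a = (\<Sum>r | r permutes ?N - A. W r * cyc_unif A (a \<circ> inv r))"
    "mass n f = (\<Sum>r | r permutes ?N - A. W r)"
    by (rule cycle_invariant_decompose[OF f A]) (rule that)
  obtain V where V: "\<And>r. r permutes ?N - B \<Longrightarrow> 0 \<le> V r"
    "\<And>a. a permutes ?N \<Longrightarrow> g a = (\<Sum>r | r permutes ?N - B. V r * cyc_unif B (inv r \<circ> a))"
    "\<And>a. a permutes ?N \<Longrightarrow> g a = (\<Sum>r | r permutes ?N - B. V r * cyc_unif B (a \<circ> inv r))"
    "mass n g = (\<Sum>r | r permutes ?N - B. V r)"
    by (rule cycle_invariant_decompose[OF g B]) (rule that)
  have ip: "inv r permutes ?N" if "r permutes ?N - D" for r D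
    using permutes_inv[OF that] by (rule permutes_subset) auto
  let ?CC = "conv n (cyc_unif A) (cyc_unif B)"
  have eq: "conv n f g \<pi> = (\<Sum>r | r permutes ?N - A. W r * (\<Sum>q | q permutes ?N - B. V q * ?CC (inv r \<circ> (\<pi> \<circ> inv q))))"
    if \<pi>: "\<pi> permutes ?N" for \<pi>
  proof -
    have "conv n f g \<pi> = conv n (\<lambda>a. \<Sum>r | r permutes ?N - A. W r * cyc_unif A (inv r \<circ> a))
      (\<lambda>a. \<Sum>r | r permutes ?N - B. V r * cyc_unif B (a \<circ> inv r)) \<pi>"
      using W(2) V(3) \<pi> by (rule conv_cong)
    also have "\<dots> = (\<Sum>r | r permutes ?N - A. W r * (\<Sum>q | q permutes ?N - B. V q *
      conv n (\<lambda>a. cyc_unif A (inv r \<circ> a)) (\<lambda>a. cyc_unif B (a \<circ> inv q)) \<pi>))"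
      unfolding conv_sum_left conv_sum_right ..
    also have "\<dots> = (\<Sum>r | r permutes ?N - A. W r * (\<Sum>q | q permutes ?N - B. V q * ?CC (inv r \<circ> (\<pi> \<circ> inv q))))"
      unfolding conv_right using ip by (intro sum.cong refl) (simp add: conv_left)
    finally show ?thesis .
  qed
  have "covers n t (\<lambda>\<pi>. \<Sum>r | r permutes ?N - A. W r * (\<Sum>q | q permutes ?N - B. V q * ?CC (inv r \<circ> (\<pi> \<circ> inv q))))
    (\<Sum>r | r permutes ?N - A. W r * (\<Sum>q | q permutes ?N - B. V q * c))"
  proof (intro covers_sum)
    fix r q assume "r \<in> {r. r permutes ?N - A}" "q \<in> {q. q permutes ?N - B}"
    then have "inv r permutes ?N" "inv q permutes ?N" using ip by blast+
    then show "covers n t (\<lambda>\<pi>. ?CC (inv r \<circ> (\<pi> \<circ> inv q))) c"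
      using covers_right[OF covers_left[OF c, of "inv r"], of "inv q"] by simp
  qed (use W(1) V(1) in auto)
  moreover have "(\<Sum>r | r permutes ?N - A. W r * (\<Sum>q | q permutes ?N - B. V q * c)) = mass n f * mass n g * c"
    unfolding W(4) V(4) by (simp flip: sum_distrib_left sum_distrib_right)
  ultimately have cov: "covers n t (\<lambda>\<pi>. \<Sum>r | r permutes ?N - A. W r * (\<Sum>q | q permutes ?N - B. V q * ?CC (inv r \<circ> (\<pi> \<circ> inv q))))
    (mass n f * mass n g * c)" by simp
  show ?thesis by (rule covers_mono[OF cov]) (simp_all only: eq order_refl)
qed

section \<open>Random sets intersect\<close>

text \<open>Second moment method for a uniform element of \<open>S\<close>: the condition on
  \<open>q\<close> is a form of negative correlation, which bounds the variance of the number of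
  \<open>x\<close> with \<open>P x s\<close> by its mean. It serves both for intersections of random
  sets and for untouched cards.\<close>

lemma chebyshev_count:
  fixes P :: "'i \<Rightarrow> 's \<Rightarrow> bool"
  assumes I: "finite I" and S: "finite S"
    and one: "\<And>x. x \<in> I \<Longrightarrow> real (card {s \<in> S. P x s}) = p * real (card S)"
    and two: "\<And>x y. x \<in> I \<Longrightarrow> y \<in> I \<Longrightarrow> x \<noteq> y \<Longrightarrow> real (card {s \<in> S. P x s \<and> P y s}) \<le> q * real (card S)"
  defines "\<mu> \<equiv> real (card I) * p"
  assumes q: "real (card I) * (real (card I) - 1) * q \<le> \<mu>\<^sup>2" and u: "u < \<mu>"
  shows "real (card {s \<in> S. real (card {x \<in> I. P x s}) \<le> u}) * (\<mu> - u)\<^sup>2 \<le> \<mu> * real (card S)"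
proof -
  let ?i = "real (card I)" and ?M = "real (card S)"
  define X where "X = (\<lambda>s. real (card {x \<in> I. P x s}))"
  have Xsum: "X s = (\<Sum>x\<in>I. if P x s then 1 else 0)" for s
    unfolding X_def using I by (simp flip: sum.inter_filter)
  have S1: "(\<Sum>s\<in>S. X s) = \<mu> * ?M"
  proof -
    have "(\<Sum>s\<in>S. X s) = (\<Sum>x\<in>I. \<Sum>s\<in>S. if P x s then 1 else 0)" unfolding Xsum by (rule sum.swap)
    also have "\<dots> = (\<Sum>x\<in>I. p * ?M)" using S one by (intro sum.cong refl) (simp flip: sum.inter_filter)
    finally show ?thesis by (simp add: \<mu>_def)
  qed
  have S2: "(\<Sum>s\<in>S. (X s)\<^sup>2) \<le> \<mu> * ?M + \<mu>\<^sup>2 * ?M"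
  proof -
    have "(\<Sum>s\<in>S. (X s)\<^sup>2) = (\<Sum>s\<in>S. \<Sum>x\<in>I. \<Sum>y\<in>I. if P x s \<and> P y s then 1 else 0)"
      unfolding Xsum power2_eq_square sum_product by (intro sum.cong refl) auto
    also have "\<dots> = (\<Sum>x\<in>I. \<Sum>s\<in>S. \<Sum>y\<in>I. if P x s \<and> P y s then 1 else 0)"
      by (rule sum.swap)
    also have "\<dots> = (\<Sum>x\<in>I. \<Sum>y\<in>I. \<Sum>s\<in>S. if P x s \<and> P y s then 1 else 0)"
      by (rule sum.cong[OF refl]) (rule sum.swap)
    also have "\<dots> \<le> (\<Sum>x\<in>I. \<Sum>y\<in>I. (if y = x then p * ?M - q * ?M else 0) + q * ?M)"
    proof (intro sum_mono)
      fix x y assume "x \<in> I" "y \<in> I"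
      then show "(\<Sum>s\<in>S. if P x s \<and> P y s then 1 else 0) \<le> (if y = x then p * ?M - q * ?M else 0) + q * ?M"
        using S one[of x] two[of x y] by (cases "y = x") (simp_all flip: sum.inter_filter)
    qed
    also have "\<dots> = (\<Sum>x\<in>I. p * ?M - q * ?M + ?i * (q * ?M))"
      using I by (intro sum.cong refl) (simp add: sum.distrib)
    also have "\<dots> = \<mu> * ?M + (?i * (?i - 1) * q) * ?M" by (simp add: \<mu>_def algebra_simps)
    also have "\<dots> \<le> \<mu> * ?M + \<mu>\<^sup>2 * ?M" using q by (intro add_left_mono mult_right_mono) auto
    finally show ?thesis .
  qed
  have V: "(\<Sum>s\<in>S. (X s - \<mu>)\<^sup>2) \<le> \<mu> * ?M"
  proof -
    have "(\<Sum>s\<in>S. (X s - \<mu>)\<^sup>2) = (\<Sum>s\<in>S. (X s)\<^sup>2 - 2 * \<mu> * X s + \<mu>\<^sup>2)"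
      by (intro sum.cong refl) (simp add: power2_eq_square algebra_simps)
    also have "\<dots> = (\<Sum>s\<in>S. (X s)\<^sup>2) - 2 * \<mu> * (\<Sum>s\<in>S. X s) + ?M * \<mu>\<^sup>2"
      by (simp only: sum.distrib sum_subtractf sum_distrib_left[symmetric] sum_constant)
    also have "\<dots> \<le> \<mu> * ?M" unfolding S1 using S2 by (simp add: power2_eq_square algebra_simps)
    finally show ?thesis .
  qed
  let ?T = "{s \<in> S. real (card {x \<in> I. P x s}) \<le> u}"
  have "real (card ?T) * (\<mu> - u)\<^sup>2 \<le> (\<Sum>s\<in>?T. (X s - \<mu>)\<^sup>2)"
  proof (rule sum_bounded_below)
    fix s assume "s \<in> ?T"
    then have "(\<mu> - u)\<^sup>2 \<le> (\<mu> - X s)\<^sup>2" using u by (intro power_mono) (auto simp: X_def)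
    then show "(\<mu> - u)\<^sup>2 \<le> (X s - \<mu>)\<^sup>2" by (simp add: power2_commute)
  qed
  also have "\<dots> \<le> (\<Sum>s\<in>S. (X s - \<mu>)\<^sup>2)" using S by (intro sum_mono2) auto
  finally show ?thesis using V by simp
qed

lemma card_supersets:
  assumes "finite N" "D \<subseteq> N" "card D \<le> a"
  shows "card {A. A \<subseteq> N \<and> card A = a \<and> D \<subseteq> A} = (card N - card D) choose (a - card D)"
proof -
  have finD: "finite D" using assms finite_subset by blast
  have "bij_betw ((\<union>) D) {A. A \<subseteq> N - D \<and> card A = a - card D} {A. A \<subseteq> N \<and> card A = a \<and> D \<subseteq> A}"
  proof (rule bij_betw_byWitness[where f'="\<lambda>A. A - D"])
    show "(\<union>) D ` {A. A \<subseteq> N - D \<and> card A = a - card D} \<subseteq> {A. A \<subseteq> N \<and> card A = a \<and> D \<subseteq> A}"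
    proof clarify
      fix A assume A: "A \<subseteq> N - D" "card A = a - card D"
      then have "finite A" "D \<inter> A = {}" using assms(1) finite_subset by blast+
      then have "card (D \<union> A) = a" using A assms(3) finD by (simp add: card_Un_disjoint)
      then show "D \<union> A \<subseteq> N \<and> card (D \<union> A) = a \<and> D \<subseteq> D \<union> A" using A assms(2) by blast
    qed
    show "(\<lambda>A. A - D) ` {A. A \<subseteq> N \<and> card A = a \<and> D \<subseteq> A} \<subseteq> {A. A \<subseteq> N - D \<and> card A = a - card D}"
      using finD by (auto simp: card_Diff_subset)
  qed auto
  then have "card {A. A \<subseteq> N \<and> card A = a \<and> D \<subseteq> A} = card {A. A \<subseteq> N - D \<and> card A = a - card D}"
    by (rule bij_betw_same_card[symmetric])
  then show ?thesis using n_subsets[of "N - D" "a - card D"] assms finD by (simp add: card_Diff_subset)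
qed

text \<open>A hypergeometric count: memberships of two distinct points are negatively correlated.
  With deviation \<open>\<mu> / 2\<close> Chebyshev gives the probability 4 /
  \<open>\<mu>\<close>.\<close>

lemma card_small_intersection:
  fixes N :: "'a set"
  assumes N: "finite N" and B: "B \<subseteq> N" "B \<noteq> {}" and a: "1 < a"
  defines "S \<equiv> {A. A \<subseteq> N \<and> card A = a}" and "\<mu> \<equiv> real a * real (card B) / real (card N)"
  shows "real (card {A \<in> S. real (card (A \<inter> B)) \<le> \<mu> / 2}) * \<mu> \<le> 4 * real (card S)"
proof (cases "S = {}")
  case False
  let ?n = "real (card N)" and ?a = "real a" and ?b = "real (card B)"
  have finB: "finite B" using B N finite_subset by blast
  have finS: "finite S" using N by (auto simp: S_def)
  have b: "0 < card B" using B finB by (simp add: card_gt_0_iff)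
  have an: "a \<le> card N" using False N by (auto simp: S_def intro: card_mono)
  have bn: "card B \<le> card N" using B N by (simp add: card_mono)
  have n0: "?n > 1" using a an by simp
  have \<mu>0: "0 < \<mu>" using a b n0 by (simp add: \<mu>_def)
  have cS: "card S = card N choose a" unfolding S_def using N by (rule n_subsets)
  define p1 where "p1 = real ((card N - 1) choose (a - 1))"
  define p2 where "p2 = real ((card N - 2) choose (a - 2))"
  have p1: "?n * p1 = ?a * real (card S)"
    unfolding p1_def cS using times_binomial_minus1_eq[of a "card N"] a by (simp flip: of_nat_mult)
  have p2: "?n * (?n - 1) * p2 = ?a * (?a - 1) * real (card S)"
  proof -
    have "(a - 1) * ((card N - 1) choose (a - 1)) = (card N - 1) * ((card N - 1 - 1) choose (a - 1 - 1))"
      by (rule times_binomial_minus1_eq) (use a in simp)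
    then have "real (a - 1) * p1 = real (card N - 1) * p2"
      unfolding p1_def p2_def by (simp add: numeral_2_eq_2 flip: of_nat_mult)
    then have "(?a - 1) * p1 = (?n - 1) * p2" using a an by (simp add: of_nat_diff)
    then have "?n * ((?n - 1) * p2) = (?a - 1) * (?n * p1)" by simp
    then show ?thesis unfolding p1 by (simp add: mult_ac)
  qed
  define q where "q = ?a * (?a - 1) / (?n * (?n - 1))"
  have \<mu>_eq: "?b * (?a / ?n) = \<mu>" by (simp add: \<mu>_def)
  have "real (card {A \<in> S. real (card {x \<in> B. x \<in> A}) \<le> \<mu> / 2}) * (?b * (?a / ?n) - \<mu> / 2)\<^sup>2 \<le> ?b * (?a / ?n) * real (card S)"
  proof (rule chebyshev_count[OF finB finS, where q=q])
    fix x assume x: "x \<in> B"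
    have "{A \<in> S. x \<in> A} = {A. A \<subseteq> N \<and> card A = a \<and> {x} \<subseteq> A}" by (auto simp: S_def)
    then have "real (card {A \<in> S. x \<in> A}) = p1"
      using card_supersets[OF N, of "{x}" a] x B a by (auto simp: p1_def)
    then show "real (card {A \<in> S. x \<in> A}) = ?a / ?n * real (card S)" using p1 n0 by (simp add: field_simps)
    fix y assume y: "y \<in> B" "x \<noteq> y"
    have "{A \<in> S. x \<in> A \<and> y \<in> A} = {A. A \<subseteq> N \<and> card A = a \<and> {x, y} \<subseteq> A}" by (auto simp: S_def)
    then have "real (card {A \<in> S. x \<in> A \<and> y \<in> A}) = p2"
      using card_supersets[OF N, of "{x, y}" a] x y B a by (auto simp: p2_def numeral_2_eq_2)
    then show "real (card {A \<in> S. x \<in> A \<and> y \<in> A}) \<le> q * real (card S)"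
      using p2 n0 by (simp add: q_def field_simps)
  next
    have "?a * ?b \<le> ?a * ?n" using bn by (intro mult_left_mono) auto
    moreover have "1 * ?n \<le> ?b * ?n" using b by (intro mult_right_mono) auto
    ultimately have "(?a - 1) * (?b - 1) * ?n \<le> ?a * ?b * (?n - 1)" by (simp add: algebra_simps)
    then have "(?a - 1) * (?b - 1) / (?n - 1) \<le> \<mu>"
      using n0 unfolding \<mu>_def by (simp add: field_simps)
    then have "\<mu> * ((?a - 1) * (?b - 1) / (?n - 1)) \<le> \<mu> * \<mu>" using \<mu>0 by (intro mult_left_mono) auto
    moreover have "?b * (?b - 1) * q = \<mu> * ((?a - 1) * (?b - 1) / (?n - 1))" by (simp add: q_def \<mu>_def)
    ultimately show "?b * (?b - 1) * q \<le> (?b * (?a / ?n))\<^sup>2" unfolding \<mu>_eq by (simp add: power2_eq_square)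
  qed (use \<mu>_eq \<mu>0 in auto)
  moreover have "{x \<in> B. x \<in> A} = A \<inter> B" for A by auto
  ultimately have "(real (card {A \<in> S. real (card (A \<inter> B)) \<le> \<mu> / 2}) * \<mu>) * \<mu> \<le> (4 * real (card S)) * \<mu>"
    unfolding \<mu>_eq by (simp add: power2_eq_square field_simps)
  then show ?thesis using \<mu>0 by simp
qed simp

lemma permutes_image_exists:
  assumes N: "finite N" and A: "A \<subseteq> N" "A' \<subseteq> N" "card A = card A'"
  obtains g where "g permutes N" "g ` A = A'"
proof -
  have fin: "finite A" "finite A'" using A N finite_subset by blast+
  obtain h1 where h1: "bij_betw h1 A A'" using finite_same_card_bij[OF fin A(3)] by blast
  have "card (N - A) = card (N - A')" using A fin by (simp add: card_Diff_subset)
  then obtain h2 where h2: "bij_betw h2 (N - A) (N - A')"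
    using finite_same_card_bij[of "N - A" "N - A'"] N by blast
  define g where "g = (\<lambda>x. if x \<in> A then h1 x else if x \<in> N then h2 x else x)"
  have b1: "bij_betw g A A'" using h1 by (rule bij_betw_cong[THEN iffD1, rotated]) (simp add: g_def)
  have b2: "bij_betw g (N - A) (N - A')" using h2 by (rule bij_betw_cong[THEN iffD1, rotated]) (simp add: g_def)
  have "bij_betw g (A \<union> (N - A)) (A' \<union> (N - A'))" using b1 b2 by (rule bij_betw_combine) auto
  moreover have "A \<union> (N - A) = N" "A' \<union> (N - A') = N" using A by auto
  ultimately have "g permutes N" by (intro bij_imp_permutes) (use A in \<open>auto simp: g_def\<close>)
  then show thesis using that bij_betw_imp_surj_on[OF b1] by blast
qed

section \<open>Class functions supported on permutations with a long cycle\<close>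

definition class_fun :: "nat \<Rightarrow> ((nat \<Rightarrow> nat) \<Rightarrow> real) \<Rightarrow> bool" where
  "class_fun n f \<longleftrightarrow> (\<forall>g a. g permutes {1..n} \<longrightarrow> a permutes {1..n} \<longrightarrow> f (g \<circ> a \<circ> inv g) = f a)"

definition long_cycles :: "nat \<Rightarrow> (nat \<Rightarrow> nat) \<Rightarrow> nat set set" where
  "long_cycles n a = {A. A \<subseteq> {1..n} \<and> cyclic_on a A \<and> n \<le> 4 * card A}"

text \<open>
  Sharing the mass equally among the long cycles keeps the choice of a cycle equivariant under conjugation.
\<close>

definition cycle_part :: "nat \<Rightarrow> ((nat \<Rightarrow> nat) \<Rightarrow> real) \<Rightarrow> nat set \<Rightarrow> (nat \<Rightarrow> nat) \<Rightarrow> real" where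
  "cycle_part n f A a = (if A \<in> long_cycles n a then f a / real (card (long_cycles n a)) else 0)"

lemma finite_long_cycles: "finite (long_cycles n a)"
  unfolding long_cycles_def by (rule finite_subset[of _ "Pow {1..n}"]) auto

lemma long_cycles_conj_subset:
  assumes g: "g permutes {1..n}"
  shows "(`) g ` long_cycles n a \<subseteq> long_cycles n (g \<circ> a \<circ> inv g)"
proof clarify
  fix A assume A: "A \<in> long_cycles n a"
  then have "cyclic_on (g \<circ> a \<circ> inv g) (g ` A)"
    by (intro cyclic_on_image[of a]) (auto simp: long_cycles_def permutes_inverses[OF g])
  moreover have "g ` A \<subseteq> {1..n}" using A permutes_image[OF g] by (auto simp: long_cycles_def)
  moreover have "card (g ` A) = card A" by (rule card_image) (rule permutes_inj_on[OF g])
  ultimately show "g ` A \<in> long_cycles n (g \<circ> a \<circ> inv g)" using A by (simp add: long_cycles_def)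
qed

lemma long_cycles_conj:
  assumes g: "g permutes {1..n}"
  shows "long_cycles n (g \<circ> a \<circ> inv g) = (`) g ` long_cycles n a"
proof
  have ig: "inv g permutes {1..n}" using g by (rule permutes_inv)
  have ii: "inv (inv g) = g" using permutes_bij[OF g] by (rule inv_inv_eq)
  have "inv g \<circ> (g \<circ> a \<circ> inv g) \<circ> inv (inv g) = a"
    unfolding ii using permutes_inv_o(2)[OF g] by (simp add: comp_assoc) (simp flip: comp_assoc)
  then have 1: "(`) (inv g) ` long_cycles n (g \<circ> a \<circ> inv g) \<subseteq> long_cycles n a"
    using long_cycles_conj_subset[OF ig, of "g \<circ> a \<circ> inv g"] by simp
  show "long_cycles n (g \<circ> a \<circ> inv g) \<subseteq> (`) g ` long_cycles n a"
  proof
    fix A assume A: "A \<in> long_cycles n (g \<circ> a \<circ> inv g)"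
    then have "inv g ` A \<in> long_cycles n a" using 1 by blast
    moreover have "A = g ` (inv g ` A)"
      by (simp add: image_image permutes_inverses(1)[OF g])
    ultimately show "A \<in> (`) g ` long_cycles n a" by blast
  qed
qed (rule long_cycles_conj_subset[OF g])

lemma cycle_part_conj:
  assumes f: "class_fun n f" and g: "g permutes {1..n}" and a: "a permutes {1..n}"
  shows "cycle_part n f (g ` A) (g \<circ> a \<circ> inv g) = cycle_part n f A a"
proof -
  have inj: "inj ((`) g)" using permutes_inj[OF g] by (simp add: inj_image_eq_iff inj_def)
  have "g ` A \<in> (`) g ` long_cycles n a \<longleftrightarrow> A \<in> long_cycles n a"
    using inj by (simp add: inj_image_mem_iff)
  moreover have "card ((`) g ` long_cycles n a) = card (long_cycles n a)"
    by (rule card_image) (rule inj_on_subset[OF inj subset_UNIV])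
  moreover have "f (g \<circ> a \<circ> inv g) = f a" using f g a unfolding class_fun_def by blast
  ultimately show ?thesis unfolding cycle_part_def long_cycles_conj[OF g] by simp
qed

lemma cycle_part_invariant:
  assumes f: "class_fun n f" "\<And>a. a permutes {1..n} \<Longrightarrow> 0 \<le> f a" and A: "A \<subseteq> {1..n}"
  shows "cycle_invariant n A (cycle_part n f A)"
  unfolding cycle_invariant_def
proof (intro allI impI conjI)
  fix a :: "nat \<Rightarrow> nat" assume a: "a permutes {1..n}"
  show "0 \<le> cycle_part n f A a" using f(2)[OF a] by (simp add: cycle_part_def)
  show "cyclic_on a A" if "cycle_part n f A a \<noteq> 0"
    using that by (auto simp: cycle_part_def long_cycles_def split: if_splits)
  fix s assume s: "s permutes A"
  then have "s permutes {1..n}" using A by (rule permutes_subset)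
  from cycle_part_conj[OF f(1) this a, of A] show "cycle_part n f A (s \<circ> a \<circ> inv s) = cycle_part n f A a"
    using permutes_image[OF s] by simp
qed

text \<open>Conjugation by a permutation taking \<open>A\<close> to \<open>A'\<close> carries one
  part to the other. So given its size, the support of the selected cycle is a uniform random
  set.\<close>

lemma mass_cycle_part_card:
  assumes f: "class_fun n f" and A: "A \<subseteq> {1..n}" "A' \<subseteq> {1..n}" "card A = card A'"
  shows "mass n (cycle_part n f A) = mass n (cycle_part n f A')"
proof -
  obtain g where g: "g permutes {1..n}" "g ` A = A'" using permutes_image_exists[of "{1..n}" A A'] A by auto
  have i: "inv g permutes {1..n}" using g(1) by (rule permutes_inv)
  have ii: "inv (inv g) = g" using permutes_bij[OF g(1)] by (rule inv_inv_eq)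
  note c = permutes_inv_o[OF g(1)]
  have "mass n (cycle_part n f A') = (\<Sum>a | a permutes {1..n}. cycle_part n f A' (g \<circ> a \<circ> inv g))"
    unfolding mass_def
  proof (rule sum.reindex_bij_witness[where j="\<lambda>a. inv g \<circ> a \<circ> g" and i="\<lambda>a. g \<circ> a \<circ> inv g"])
    have e: "g \<circ> (inv g \<circ> a \<circ> g) \<circ> inv g = a" "inv g \<circ> (g \<circ> a \<circ> inv g) \<circ> g = a" for a
      by (simp_all add: fun_eq_iff permutes_inverses[OF g(1)])
    fix a :: "nat \<Rightarrow> nat"
    show "g \<circ> (inv g \<circ> a \<circ> g) \<circ> inv g = a" "inv g \<circ> (g \<circ> a \<circ> inv g) \<circ> g = a"
      "cycle_part n f A' (g \<circ> (inv g \<circ> a \<circ> g) \<circ> inv g) = cycle_part n f A' a"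
      unfolding e by (rule refl)+
  qed (use g(1) i in \<open>blast intro: permutes_compose\<close>)+
  also have "\<dots> = mass n (cycle_part n f A)"
    unfolding mass_def g(2)[symmetric] by (intro sum.cong refl) (simp add: cycle_part_conj[OF f g(1)])
  finally show ?thesis ..
qed

lemma cycle_part_sum:
  assumes "f a \<noteq> 0 \<Longrightarrow> long_cycles n a \<noteq> {}"
  shows "f a = (\<Sum>A\<in>Pow {1..n}. cycle_part n f A a)"
proof -
  have "(\<Sum>A\<in>Pow {1..n}. cycle_part n f A a) = (\<Sum>A\<in>long_cycles n a. f a / real (card (long_cycles n a)))"
    unfolding cycle_part_def by (rule sum.mono_neutral_cong_right) (auto simp: long_cycles_def)
  then show ?thesis using assms finite_long_cycles[of n a] by (cases "f a = 0") auto
qed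

lemma mass_cycle_part_nonneg:
  assumes "\<And>a. a permutes {1..n} \<Longrightarrow> 0 \<le> f a"
  shows "0 \<le> mass n (cycle_part n f A)"
  unfolding mass_def using assms by (intro sum_nonneg) (simp add: cycle_part_def)

lemma mass_cycle_part_zero:
  assumes "card A * 4 < n"
  shows "mass n (cycle_part n f A) = 0"
  unfolding mass_def using assms by (intro sum.neutral) (auto simp: cycle_part_def long_cycles_def)

lemma mass_cycle_part_sum:
  assumes "\<And>a. a permutes {1..n} \<Longrightarrow> f a \<noteq> 0 \<Longrightarrow> long_cycles n a \<noteq> {}"
  shows "mass n f = (\<Sum>A\<in>Pow {1..n}. mass n (cycle_part n f A))"
proof -
  have "mass n f = (\<Sum>a | a permutes {1..n}. \<Sum>A\<in>Pow {1..n}. cycle_part n f A a)"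
    unfolding mass_def using assms by (intro sum.cong refl cycle_part_sum) auto
  also have "\<dots> = (\<Sum>A\<in>Pow {1..n}. mass n (cycle_part n f A))" unfolding mass_def by (rule sum.swap)
  finally show ?thesis .
qed

text \<open>The sets are grouped by size because uniformity holds only within one size a. Since a
  and \<open>card B\<close> are at least n / 4, the mean size of the intersection is at least n /
  16; falling below n / 32 means losing half of the mean, and 4 / \<open>\<mu>\<close> is at most 64
  / n.\<close>

lemma mass_good_intersection:
  assumes n: "8 \<le> n" and f: "class_fun n f" "\<And>a. a permutes {1..n} \<Longrightarrow> 0 \<le> f a"
    "\<And>a. a permutes {1..n} \<Longrightarrow> f a \<noteq> 0 \<Longrightarrow> long_cycles n a \<noteq> {}"
    and B: "B \<subseteq> {1..n}" "n \<le> 4 * card B"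
  shows "mass n f * (1 - 64 / n) \<le> (\<Sum>A | A \<subseteq> {1..n} \<and> n \<le> 32 * card (A \<inter> B). mass n (cycle_part n f A))"
proof -
  let ?N = "{1..n}"
  define m where "m = (\<lambda>A. mass n (cycle_part n f A))"
  have m0: "0 \<le> m A" for A unfolding m_def by (rule mass_cycle_part_nonneg[OF f(2)])
  have B0: "B \<noteq> {}" using B n by auto
  have "(\<Sum>A | A \<subseteq> ?N \<and> \<not> n \<le> 32 * card (A \<inter> B). m A) \<le> 64 / n * (\<Sum>A\<in>Pow ?N. m A)"
  proof -
    have grp: "(\<Sum>A\<in>Pow ?N. h A) = (\<Sum>a\<le>n. \<Sum>A | A \<subseteq> ?N \<and> card A = a. h A)" for h :: "nat set \<Rightarrow> real"
    proof -
      have "card A \<le> n" if "A \<subseteq> ?N" for A using card_mono[OF _ that] by simp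
      then have "(\<Sum>a\<le>n. \<Sum>A | A \<in> Pow ?N \<and> card A = a. h A) = (\<Sum>A\<in>Pow ?N. h A)"
        by (intro sum.group) auto
      then show ?thesis by simp
    qed
    have "(\<Sum>A | A \<subseteq> ?N \<and> \<not> n \<le> 32 * card (A \<inter> B). m A) = (\<Sum>A\<in>Pow ?N. if \<not> n \<le> 32 * card (A \<inter> B) then m A else 0)"
      by (subst sum.inter_filter[symmetric]) auto
    also have "\<dots> = (\<Sum>a\<le>n. \<Sum>A | A \<subseteq> ?N \<and> card A = a. if \<not> n \<le> 32 * card (A \<inter> B) then m A else 0)"
      by (rule grp)
    also have "\<dots> \<le> (\<Sum>a\<le>n. \<Sum>A | A \<subseteq> ?N \<and> card A = a. 64 / n * m A)"
    proof (rule sum_mono)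
      fix a assume a: "a \<in> {..n}"
      define S where "S = {A. A \<subseteq> ?N \<and> card A = a}"
      have finS: "finite S" unfolding S_def by (rule finite_subset[of _ "Pow ?N"]) auto
      show "(\<Sum>A\<in>{A. A \<subseteq> ?N \<and> card A = a}. if \<not> n \<le> 32 * card (A \<inter> B) then m A else 0) \<le> (\<Sum>A\<in>{A. A \<subseteq> ?N \<and> card A = a}. 64 / n * m A)"
        unfolding S_def[symmetric]
      proof (cases "a * 4 < n \<or> S = {}")
        case True
        then have "m A = 0" if "A \<in> S" for A
          using that mass_cycle_part_zero[of A n f] by (auto simp: S_def m_def)
        then show "(\<Sum>A\<in>S. if \<not> n \<le> 32 * card (A \<inter> B) then m A else 0) \<le> (\<Sum>A\<in>S. 64 / n * m A)"
          by (intro sum_mono) auto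
      next
        case False
        then obtain A0 where A0: "A0 \<in> S" by auto
        have mA: "m A = m A0" if "A \<in> S" for A
          using that A0 mass_cycle_part_card[OF f(1), of A A0] by (auto simp: S_def m_def)
        have a4: "n \<le> 4 * a" using False by simp
        define \<mu> where "\<mu> = real a * real (card B) / real (card ?N)"
        have \<mu>: "real n / 16 \<le> \<mu>"
        proof -
          have "real n / 4 * (real n / 4) \<le> real a * real (card B)" using a4 B(2) by (intro mult_mono) auto
          then show ?thesis using n unfolding \<mu>_def by (simp add: field_simps)
        qed
        let ?T = "{A \<in> S. \<not> n \<le> 32 * card (A \<inter> B)}" and ?T' = "{A \<in> S. real (card (A \<inter> B)) \<le> \<mu> / 2}"
        have "?T \<subseteq> ?T'" using \<mu> by auto
        then have "card ?T \<le> card ?T'" using finS by (intro card_mono) auto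
        then have "real (card ?T) * (real n / 16) \<le> real (card ?T') * \<mu>" using \<mu> by (intro mult_mono) auto
        also have "\<dots> \<le> 4 * real (card S)"
          using card_small_intersection[of ?N B a] B(1) B0 a4 n unfolding S_def \<mu>_def by auto
        finally have "real (card ?T) \<le> 64 / n * real (card S)" using n by (simp add: field_simps)
        then have "real (card ?T) * m A0 \<le> 64 / n * real (card S) * m A0" using m0 by (rule mult_right_mono)
        moreover have "(\<Sum>A\<in>S. if \<not> n \<le> 32 * card (A \<inter> B) then m A else 0) = real (card ?T) * m A0"
          using mA by (subst sum.inter_filter[OF finS, symmetric]) simp
        moreover have "(\<Sum>A\<in>S. 64 / n * m A) = 64 / n * real (card S) * m A0"
          using mA by simp
        ultimately show "(\<Sum>A\<in>S. if \<not> n \<le> 32 * card (A \<inter> B) then m A else 0) \<le> (\<Sum>A\<in>S. 64 / n * m A)" by simp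
      qed
    qed
    also have "\<dots> = 64 / n * (\<Sum>A\<in>Pow ?N. m A)" unfolding grp[symmetric] by (rule sum_distrib_left[symmetric])
    finally show ?thesis .
  qed
  moreover have "(\<Sum>A\<in>Pow ?N. m A) = (\<Sum>A | A \<subseteq> ?N \<and> n \<le> 32 * card (A \<inter> B). m A) + (\<Sum>A | A \<subseteq> ?N \<and> \<not> n \<le> 32 * card (A \<inter> B). m A)"
  proof -
    have "Pow ?N = {A. A \<subseteq> ?N \<and> n \<le> 32 * card (A \<inter> B)} \<union> {A. A \<subseteq> ?N \<and> \<not> n \<le> 32 * card (A \<inter> B)}" by auto
    moreover have "finite {A. A \<subseteq> ?N \<and> P A}" for P by (rule finite_subset[of _ "Pow ?N"]) auto
    ultimately show ?thesis by (simp only:) (rule sum.union_disjoint, auto)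
  qed
  moreover have "mass n f = (\<Sum>A\<in>Pow ?N. m A)" unfolding m_def by (rule mass_cycle_part_sum[OF f(3)])
  moreover have "mass n f * (1 - 64 / n) = mass n f - 64 / n * mass n f" by (simp add: right_diff_distrib)
  ultimately show ?thesis unfolding m_def[symmetric] by simp
qed

text \<open>Both functions are split into their cycle parts and the product is expanded. Pairs of
  supports with too small an intersection are dropped; for every fixed support in the second factor
  this costs at most the share 64 / n of the first.\<close>

lemma covers_conv_class_fun:
  assumes n: "8 \<le> n"
    and f: "class_fun n f" "\<And>a. a permutes {1..n} \<Longrightarrow> 0 \<le> f a"
      "\<And>a. a permutes {1..n} \<Longrightarrow> f a \<noteq> 0 \<Longrightarrow> long_cycles n a \<noteq> {}"
    and g: "class_fun n g" "\<And>a. a permutes {1..n} \<Longrightarrow> 0 \<le> g a"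
      "\<And>a. a permutes {1..n} \<Longrightarrow> g a \<noteq> 0 \<Longrightarrow> long_cycles n a \<noteq> {}"
    and c: "0 \<le> c" "\<And>K. K \<subseteq> {1..n} \<Longrightarrow> n \<le> 32 * card K \<Longrightarrow> covers n t (conv n (cyc_unif K) (cyc_unif K)) c"
  shows "covers n t (conv n f g) (c * (1 - 64 / n) * mass n f * mass n g)"
proof -
  let ?N = "{1..n}"
  define F where "F = cycle_part n f"
  define G where "G = cycle_part n g"
  define C where "C = (\<lambda>A B. if n \<le> 32 * card (A \<inter> B) then mass n (F A) * mass n (G B) * c else 0)"
  have F0: "0 \<le> mass n (F A)" and G0: "0 \<le> mass n (G A)" for A
    unfolding F_def G_def using mass_cycle_part_nonneg f(2) g(2) by blast+
  have cov: "covers n t (conv n (F A) (G B)) (C A B)" if A: "A \<subseteq> ?N" and B: "B \<subseteq> ?N" for A B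
  proof (cases "n \<le> 32 * card (A \<inter> B)")
    case True
    then have ne: "A \<inter> B \<noteq> {}" using n by auto
    have "covers n t (conv n (cyc_unif A) (cyc_unif B)) c"
      by (rule covers_conv_cyc[OF c(2)]) (use True A B ne in auto)
    then have "covers n t (conv n (F A) (G B)) (mass n (F A) * mass n (G B) * c)"
      unfolding F_def G_def using A B ne f g
      by (intro covers_conv_cycle_invariant[where A=A and B=B] cycle_part_invariant) auto
    then show ?thesis using True by (simp add: C_def)
  next
    case False
    have "covers n t (conv n (F A) (G B)) 0"
      using f(2) g(2) by (intro covers_nonneg conv_nonneg) (auto simp: F_def G_def cycle_part_def)
    then show ?thesis using False by (simp add: C_def)
  qed
  have "covers n t (\<lambda>\<pi>. \<Sum>B\<in>Pow ?N. 1 * (\<Sum>A\<in>Pow ?N. 1 * conv n (F A) (G B) \<pi>)) (\<Sum>B\<in>Pow ?N. 1 * (\<Sum>A\<in>Pow ?N. 1 * C A B))"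
    by (intro covers_sum cov) auto
  moreover have "(\<Sum>B\<in>Pow ?N. 1 * (\<Sum>A\<in>Pow ?N. 1 * conv n (F A) (G B) \<pi>)) \<le> conv n f g \<pi>" if "\<pi> permutes ?N" for \<pi>
  proof -
    have "conv n f g \<pi> = conv n (\<lambda>a. \<Sum>A\<in>Pow ?N. 1 * F A a) (\<lambda>a. \<Sum>B\<in>Pow ?N. 1 * G B a) \<pi>"
      by (rule conv_cong) (use f(3) g(3) cycle_part_sum[of f _ n] cycle_part_sum[of g _ n] that in \<open>auto simp: F_def G_def\<close>)
    then show ?thesis unfolding conv_sum_right conv_sum_left by simp
  qed
  moreover have "c * (1 - 64 / n) * mass n f * mass n g \<le> (\<Sum>B\<in>Pow ?N. 1 * (\<Sum>A\<in>Pow ?N. 1 * C A B))"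
  proof -
    have "mass n f * (1 - 64 / n) * c * mass n (G B) \<le> (\<Sum>A\<in>Pow ?N. C A B)" if B: "B \<subseteq> ?N" for B
    proof (cases "n \<le> 4 * card B")
      case True
      have "mass n f * (1 - 64 / n) * (c * mass n (G B)) \<le> (\<Sum>A | A \<subseteq> ?N \<and> n \<le> 32 * card (A \<inter> B). mass n (F A)) * (c * mass n (G B))"
        unfolding F_def using n f B True c(1) G0 by (intro mult_right_mono mass_good_intersection) auto
      also have "\<dots> = (\<Sum>A\<in>Pow ?N. C A B)"
      proof -
        have "(\<Sum>A\<in>Pow ?N. C A B) = (\<Sum>A | A \<in> Pow ?N \<and> n \<le> 32 * card (A \<inter> B). mass n (F A) * mass n (G B) * c)"
          unfolding C_def by (subst sum.inter_filter) auto
        then show ?thesis by (simp add: sum_distrib_left sum_distrib_right mult_ac)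
      qed
      finally show ?thesis by (simp add: mult_ac)
    next
      case False
      then have "mass n (G B) = 0" unfolding G_def by (intro mass_cycle_part_zero) simp
      then have "C A B = 0" for A by (simp add: C_def)
      then show ?thesis using \<open>mass n (G B) = 0\<close> by simp
    qed
    then have "(\<Sum>B\<in>Pow ?N. mass n f * (1 - 64 / n) * c * mass n (G B)) \<le> (\<Sum>B\<in>Pow ?N. \<Sum>A\<in>Pow ?N. C A B)"
      by (intro sum_mono) auto
    moreover have "mass n g = (\<Sum>B\<in>Pow ?N. mass n (G B))" unfolding G_def by (rule mass_cycle_part_sum[OF g(3)])
    then have "(\<Sum>B\<in>Pow ?N. mass n f * (1 - 64 / n) * c * mass n (G B)) = mass n f * (1 - 64 / n) * c * mass n g"
      by (simp only: sum_distrib_left)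
    ultimately show ?thesis by (simp add: mult_ac)
  qed
  ultimately show ?thesis by (rule covers_mono)
qed

section \<open>Running the walk until a long cycle appears\<close>

definition id_mass :: "(nat \<Rightarrow> nat) \<Rightarrow> real" where
  "id_mass \<pi> = (if \<pi> = id then 1 else 0)"

primrec killed :: "nat \<Rightarrow> nat \<Rightarrow> (nat \<Rightarrow> nat) \<Rightarrow> real" where
  "killed n 0 = id_mass"
| "killed n (Suc j) = (\<lambda>\<pi>. if long_cycles n \<pi> = {} then rstep n (killed n j) \<pi> else 0)"

text \<open>The mass whose first long cycle appears in step \<open>j + 1\<close>; together with
  \<open>killed n (Suc j)\<close> it makes up one step from \<open>killed n j\<close>.\<close>

definition stopped :: "nat \<Rightarrow> nat \<Rightarrow> (nat \<Rightarrow> nat) \<Rightarrow> real" where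
  "stopped n j = (\<lambda>\<pi>. if long_cycles n \<pi> = {} then 0 else rstep n (killed n j) \<pi>)"

lemma rstep_split: "rstep n (killed n j) \<pi> = killed n (Suc j) \<pi> + stopped n j \<pi>"
  by (simp add: stopped_def)

lemma rstep_nonneg:
  assumes "\<And>\<pi>. \<pi> permutes {1..n} \<Longrightarrow> 0 \<le> f \<pi>" "\<pi> permutes {1..n}"
  shows "0 \<le> rstep n f \<pi>"
  using rsteps_nonneg[OF assms, where t=1] by simp

lemma killed_nonneg: "\<pi> permutes {1..n} \<Longrightarrow> 0 \<le> killed n j \<pi>"
  by (induction j arbitrary: \<pi>) (auto simp: id_mass_def intro: rstep_nonneg)

lemma class_fun_rstep:
  assumes "class_fun n f"
  shows "class_fun n (rstep n f)"
  unfolding class_fun_def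
proof (intro allI impI)
  fix g a :: "nat \<Rightarrow> nat" assume g: "g permutes {1..n}" and a: "a permutes {1..n}"
  have "rstep n f (g \<circ> a \<circ> inv g) = rstep n (\<lambda>\<pi>. f (g \<circ> \<pi>)) (a \<circ> inv g)"
    unfolding comp_assoc by (rule rstep_left[OF g, symmetric])
  also have "\<dots> = rstep n (\<lambda>\<pi>. f (g \<circ> (\<pi> \<circ> inv g))) a"
    using rsteps_right[where n=n and t=1 and f="\<lambda>\<pi>. f (g \<circ> \<pi>)" and h="inv g" and \<pi>=a] by (simp add: o_def)
  also have "\<dots> = rstep n f a"
    using rsteps_cong[of n "\<lambda>\<pi>. f (g \<circ> (\<pi> \<circ> inv g))" f a 1] assms g a unfolding class_fun_def by (simp add: comp_assoc)
  finally show "rstep n f (g \<circ> a \<circ> inv g) = rstep n f a" .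
qed

lemma class_fun_killed: "class_fun n (killed n j)"
proof (induction j)
  case 0
  have "g \<circ> a \<circ> inv g = id \<longleftrightarrow> a = id" if g: "g permutes {1..n}" for g a :: "nat \<Rightarrow> nat"
  proof
    assume "g \<circ> a \<circ> inv g = id"
    then have "inv g \<circ> (g \<circ> a \<circ> inv g) \<circ> g = inv g \<circ> id \<circ> g" by simp
    then show "a = id" by (simp add: fun_eq_iff permutes_inverses[OF g])
  qed (use permutes_inv_o[OF g] in auto)
  then show ?case by (auto simp: class_fun_def id_mass_def)
next
  case (Suc j)
  then have "class_fun n (rstep n (killed n j))" by (rule class_fun_rstep)
  then show ?case by (auto simp: class_fun_def long_cycles_conj)
qed

lemma class_fun_stopped: "class_fun n (stopped n j)"
  using class_fun_rstep[OF class_fun_killed, of n j] by (auto simp: class_fun_def stopped_def long_cycles_conj)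

text \<open>The step is self-adjoint, since each transposition is its own inverse. This moves the
  drift from the density to the test function.\<close>

lemma mass_rstep_weighted:
  "(\<Sum>\<sigma> | \<sigma> permutes {1..n}. rstep n f \<sigma> * h \<sigma>) = (\<Sum>\<sigma> | \<sigma> permutes {1..n}. f \<sigma> * rstep n h \<sigma>)"
proof -
  let ?P = "{1..n} \<times> {1..n}" and ?G = "{\<sigma>. \<sigma> permutes {1..n}}"
  have "(\<Sum>\<sigma>\<in>?G. (\<Sum>(i, j)\<in>?P. f (tr i j \<circ> \<sigma>)) * h \<sigma>) = (\<Sum>p\<in>?P. \<Sum>\<sigma>\<in>?G. f (tr (fst p) (snd p) \<circ> \<sigma>) * h \<sigma>)"
    unfolding sum_distrib_right case_prod_beta by (rule sum.swap)
  also have "\<dots> = (\<Sum>p\<in>?P. \<Sum>\<sigma>\<in>?G. f \<sigma> * h (tr (fst p) (snd p) \<circ> \<sigma>))"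
  proof (rule sum.cong[OF refl])
    fix p assume "p \<in> ?P"
    then have "tr (fst p) (snd p) permutes {1..n}" by (intro permutes_swap_id) auto
    from sum_permutes_left[OF this, of "\<lambda>\<sigma>. f \<sigma> * h (tr (fst p) (snd p) \<circ> \<sigma>)"]
    show "(\<Sum>\<sigma>\<in>?G. f (tr (fst p) (snd p) \<circ> \<sigma>) * h \<sigma>) = (\<Sum>\<sigma>\<in>?G. f \<sigma> * h (tr (fst p) (snd p) \<circ> \<sigma>))"
      by simp
  qed
  also have "\<dots> = (\<Sum>\<sigma>\<in>?G. f \<sigma> * (\<Sum>(i, j)\<in>?P. h (tr i j \<circ> \<sigma>)))"
    unfolding sum_distrib_left case_prod_beta by (rule sum.swap)
  finally have "(\<Sum>\<sigma>\<in>?G. (\<Sum>(i, j)\<in>?P. f (tr i j \<circ> \<sigma>)) * h \<sigma>) / (real n)\<^sup>2 = (\<Sum>\<sigma>\<in>?G. f \<sigma> * (\<Sum>(i, j)\<in>?P. h (tr i j \<circ> \<sigma>))) / (real n)\<^sup>2"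
    by simp
  then show ?thesis unfolding rstep_def sum_divide_distrib[of _ ?G] by simp
qed

lemma mass_rstep:
  assumes "0 < n"
  shows "mass n (rstep n f) = mass n f"
proof -
  have "rstep n (\<lambda>_. 1) \<sigma> = 1" for \<sigma> using assms by (simp add: rstep_def power2_eq_square)
  then show ?thesis using mass_rstep_weighted[of n f "\<lambda>_. 1"] by (simp add: mass_def)
qed

lemma mass_killed_decreasing:
  assumes "0 < n"
  shows "mass n (killed n (Suc j)) \<le> mass n (killed n j)"
proof -
  have "mass n (killed n (Suc j)) \<le> mass n (rstep n (killed n j))"
    unfolding mass_def by (intro sum_mono) (auto intro: rstep_nonneg killed_nonneg)
  then show ?thesis using mass_rstep[OF assms] by simp
qed

definition num_orbits :: "nat \<Rightarrow> (nat \<Rightarrow> nat) \<Rightarrow> real" where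
  "num_orbits n \<sigma> = real (card (orbit \<sigma> ` {1..n}))"

lemma num_orbits_merge:
  assumes "permutation f" "j \<notin> orbit f i" "i \<in> {1..n}" "j \<in> {1..n}"
  shows "num_orbits n (tr i j \<circ> f) = num_orbits n f - 1"
proof -
  let ?O = "orbit f ` {1..n}"
  note m = orbit_image_transpose_comp_merge[OF assms(1-3)]
  have ne: "orbit f i \<noteq> orbit f j"
    using assms(2) permutation_self_in_orbit[OF assms(1), of j] by auto
  have "card (orbit (tr i j \<circ> f) ` {1..n}) = Suc (card (?O - {orbit f i, orbit f j}))"
    unfolding m(1) using m(2) by (intro card_insert_disjoint) auto
  also have "card (?O - {orbit f i, orbit f j}) = card ?O - 2"
    using assms ne by (subst card_Diff_subset) auto
  moreover have "2 \<le> card ?O"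
    using card_mono[of ?O "{orbit f i, orbit f j}"] assms ne by auto
  ultimately show ?thesis unfolding num_orbits_def by linarith
qed

lemma num_orbits_split:
  assumes f: "permutation f" and ij: "i \<in> {1..n}" "j \<in> {1..n}"
  shows "num_orbits n (tr i j \<circ> f) \<le> num_orbits n f + 1"
proof (cases "i = j \<or> j \<notin> orbit f i")
  case True
  then show ?thesis using num_orbits_merge[OF f _ ij] by auto
next
  case False
  obtain p where p: "orbit f i = (\<lambda>k. (f ^^ k) i) ` {..<p}" "card (orbit f i) = p"
    by (rule orbit_period[OF f])
  obtain k where k: "k < p" "j = (f ^^ k) i" using False p(1) by auto
  then have "0 < k" using False by (cases k) auto
  then have "j \<notin> orbit (tr i j \<circ> f) i" using orbit_transpose_comp_split(2)[OF f, of k i] k p by simp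
  from num_orbits_merge[OF permutation_transpose_comp[OF f] this ij]
  show ?thesis by simp
qed

text \<open>For a uniform pair (i, j) the point j lies in the cycle of i with probability at most
  1/4, and then at most one cycle is gained; otherwise two cycles merge. The drift is at most 1/4 -
  3/4.\<close>

lemma rstep_num_orbits:
  assumes \<sigma>: "\<sigma> permutes {1..n}" and short: "long_cycles n \<sigma> = {}" and n: "0 < n"
  shows "rstep n (num_orbits n) \<sigma> \<le> num_orbits n \<sigma> - 1 / 2"
proof -
  have f: "permutation \<sigma>" using permutes_imp_permutation[OF _ \<sigma>] by simp
  have small: "real (card (orbit \<sigma> i)) \<le> real n / 4" if "i \<in> {1..n}" for i
  proof -
    have "orbit \<sigma> i \<notin> long_cycles n \<sigma>" using short by blast
    then have "\<not> n \<le> 4 * card (orbit \<sigma> i)"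
      using permutes_orbit_subset[OF \<sigma> that] cyclic_on_orbit'[OF f] by (simp add: long_cycles_def)
    then show ?thesis by simp
  qed
  have "(\<Sum>(i, j)\<in>{1..n} \<times> {1..n}. num_orbits n (tr i j \<circ> \<sigma>)) \<le>
    (\<Sum>(i, j)\<in>{1..n} \<times> {1..n}. num_orbits n \<sigma> - 1 + (if j \<in> orbit \<sigma> i then 2 else 0))"
    using num_orbits_merge[OF f] num_orbits_split[OF f] by (intro sum_mono) fastforce
  also have "\<dots> = (\<Sum>i\<in>{1..n}. \<Sum>j\<in>{1..n}. num_orbits n \<sigma> - 1 + (if j \<in> orbit \<sigma> i then 2 else 0))"
    by (simp add: sum.cartesian_product)
  also have "\<dots> \<le> (\<Sum>i\<in>{1..n}. real n * (num_orbits n \<sigma> - 1 / 2))"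
  proof (rule sum_mono)
    fix i assume i: "i \<in> {1..n}"
    have "(\<Sum>j\<in>{1..n}. if j \<in> orbit \<sigma> i then 2 else 0 :: real) = 2 * real (card (orbit \<sigma> i))"
    proof -
      have "{j \<in> {1..n}. j \<in> orbit \<sigma> i} = orbit \<sigma> i" using permutes_orbit_subset[OF \<sigma> i] by blast
      then show ?thesis by (subst sum.inter_filter[symmetric]) simp_all
    qed
    then have e: "(\<Sum>j\<in>{1..n}. num_orbits n \<sigma> - 1 + (if j \<in> orbit \<sigma> i then 2 else 0)) =
      real n * (num_orbits n \<sigma> - 1) + 2 * real (card (orbit \<sigma> i))"
      by (simp only: sum.distrib) simp
    show "(\<Sum>j\<in>{1..n}. num_orbits n \<sigma> - 1 + (if j \<in> orbit \<sigma> i then 2 else 0)) \<le> real n * (num_orbits n \<sigma> - 1 / 2)"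
      unfolding e using small[OF i] by (simp add: algebra_simps)
  qed
  also have "\<dots> = (num_orbits n \<sigma> - 1 / 2) * (real n)\<^sup>2" by (simp add: power2_eq_square)
  finally show ?thesis unfolding rstep_def using n by (simp add: pos_divide_le_eq)
qed

text \<open>The expected number of cycles on the surviving mass starts at n, stays nonnegative and
  loses at least half the surviving mass in every step, while that mass never increases.\<close>

lemma mass_killed_le:
  assumes n: "5 \<le> n" and s: "0 < s"
  shows "mass n (killed n s) \<le> 2 * real n / real s"
proof -
  let ?G = "{\<sigma>. \<sigma> permutes {1..n}}"
  define E where "E = (\<lambda>j. \<Sum>\<sigma>\<in>?G. killed n j \<sigma> * num_orbits n \<sigma>)"
  have n0: "0 < n" using n by simp
  \<comment> \<open>At time 0 nothing has been killed yet, so it must be checked that the identity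
    has no long cycle; this holds as soon as n is at least 5.\<close>
  have supp: "killed n j \<sigma> = 0" if "long_cycles n \<sigma> \<noteq> {}" for j \<sigma>
  proof (cases j)
    case 0
    have "long_cycles n id = {}"
    proof -
      have "orbit id x = {x}" for x :: nat by (simp add: orbit_eq_singleton_iff)
      then show ?thesis using n by (auto simp: long_cycles_def cyclic_on_def)
    qed
    then show ?thesis using 0 that by (auto simp: id_mass_def)
  qed (use that in simp)
  have step: "E (Suc j) + mass n (killed n j) / 2 \<le> E j" for j
  proof -
    have "E (Suc j) \<le> (\<Sum>\<sigma>\<in>?G. rstep n (killed n j) \<sigma> * num_orbits n \<sigma>)"
      unfolding E_def by (intro sum_mono mult_right_mono) (auto simp: num_orbits_def intro: rstep_nonneg killed_nonneg)
    also have "\<dots> = (\<Sum>\<sigma>\<in>?G. killed n j \<sigma> * rstep n (num_orbits n) \<sigma>)" by (rule mass_rstep_weighted)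
    also have "\<dots> \<le> (\<Sum>\<sigma>\<in>?G. killed n j \<sigma> * (num_orbits n \<sigma> - 1 / 2))"
    proof (rule sum_mono)
      fix \<sigma> assume "\<sigma> \<in> ?G"
      then have \<sigma>: "\<sigma> permutes {1..n}" by simp
      show "killed n j \<sigma> * rstep n (num_orbits n) \<sigma> \<le> killed n j \<sigma> * (num_orbits n \<sigma> - 1 / 2)"
        using supp[of \<sigma> j] rstep_num_orbits[OF \<sigma> _ n0] killed_nonneg[OF \<sigma>, of j]
        by (cases "long_cycles n \<sigma> = {}") (auto intro: mult_left_mono)
    qed
    also have "\<dots> = E j - mass n (killed n j) / 2"
      unfolding E_def mass_def by (simp add: right_diff_distrib sum_subtractf sum_divide_distrib)
    finally show ?thesis by simp
  qed
  have dec: "mass n (killed n s) \<le> mass n (killed n j)" if "j \<le> s" for j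
    using that by (induction rule: dec_induct) (use mass_killed_decreasing[OF n0] order_trans in blast)+
  have "E j + real j * (mass n (killed n s) / 2) \<le> E 0" if "j \<le> s" for j
    using that
  proof (induction j)
    case (Suc j)
    then have "mass n (killed n s) / 2 \<le> mass n (killed n j) / 2" using dec[of j] by simp
    moreover have "E j + real j * (mass n (killed n s) / 2) \<le> E 0" using Suc by simp
    moreover have "real (Suc j) * (mass n (killed n s) / 2) = real j * (mass n (killed n s) / 2) + mass n (killed n s) / 2"
      by (simp add: algebra_simps)
    ultimately show ?case using step[of j] by linarith
  qed simp
  from this[of s] have "E s + real s * (mass n (killed n s) / 2) \<le> E 0" by simp
  moreover have "0 \<le> E s" unfolding E_def num_orbits_def by (intro sum_nonneg mult_nonneg_nonneg killed_nonneg) auto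
  moreover have "E 0 = real n"
  proof -
    have "E 0 = (\<Sum>\<sigma>\<in>?G. if \<sigma> = id then num_orbits n id else 0)"
      unfolding E_def by (intro sum.cong refl) (simp add: id_mass_def)
    also have "\<dots> = num_orbits n id" using finite_permutations[of "{1..n}"] by simp
    also have "\<dots> = real n"
    proof -
      have "orbit id x = {x}" for x :: nat by (simp add: orbit_eq_singleton_iff)
      then have "orbit id ` {1..n} = (\<lambda>x. {x}) ` {1..n}" by auto
      then show ?thesis unfolding num_orbits_def by (simp add: card_image)
    qed
    finally show ?thesis .
  qed
  ultimately have "real s * (mass n (killed n s) / 2) \<le> real n" by linarith
  then show ?thesis using s by (simp add: field_simps)
qed

lemma mass_id: "mass n id_mass = 1"
  unfolding mass_def id_mass_def using finite_permutations[of "{1..n}"] by simp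

lemma conv_id_left: "conv n id_mass h \<pi> = h \<pi>"
proof -
  have "conv n id_mass h \<pi> = (\<Sum>\<sigma> | \<sigma> permutes {1..n}. if \<sigma> = id then h \<pi> else 0)"
    unfolding conv_def by (intro sum.cong refl) (simp add: id_mass_def)
  then show ?thesis using finite_permutations[of "{1..n}"] by simp
qed

lemma conv_id_right:
  assumes "\<pi> permutes {1..n}"
  shows "conv n f id_mass \<pi> = f \<pi>"
proof -
  have "inv \<sigma> \<circ> \<pi> = id \<longleftrightarrow> \<sigma> = \<pi>" if "\<sigma> permutes {1..n}" for \<sigma>
    using permutes_inv_o[OF that] by (metis comp_assoc comp_id id_comp)
  then have "conv n f id_mass \<pi> = (\<Sum>\<sigma> | \<sigma> permutes {1..n}. if \<sigma> = \<pi> then f \<pi> else 0)"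
    unfolding conv_def by (intro sum.cong refl) (simp add: id_mass_def)
  then show ?thesis using finite_permutations[of "{1..n}"] assms by simp
qed

lemma covers_run:
  assumes n: "0 < n" and h: "\<And>\<pi>. \<pi> permutes {1..n} \<Longrightarrow> 0 \<le> h \<pi>"
    and c: "\<And>f. class_fun n f \<Longrightarrow> (\<And>a. a permutes {1..n} \<Longrightarrow> 0 \<le> f a) \<Longrightarrow>
      (\<And>a. a permutes {1..n} \<Longrightarrow> f a \<noteq> 0 \<Longrightarrow> long_cycles n a \<noteq> {}) \<Longrightarrow> covers n t (conv n f h) (c * mass n f)"
  shows "covers n (t + s) h (c * (1 - mass n (killed n s)))"
proof -
  have "covers n (t + r) (conv n (killed n j) h) (c * (mass n (killed n j) - mass n (killed n s)))" if "j + r = s" for r j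
    using that
  proof (induction r arbitrary: j)
    case 0
    have "covers n t (conv n (killed n j) h) 0"
      by (intro covers_nonneg conv_nonneg killed_nonneg h)
    then show ?case using 0 by simp
  next
    case (Suc r)
    have "covers n t (conv n (stopped n j) h) (c * mass n (stopped n j))"
      by (rule c[OF class_fun_stopped]) (auto simp: stopped_def intro: rstep_nonneg killed_nonneg split: if_splits)
    then have "covers n (t + r) (conv n (stopped n j) h) (c * mass n (stopped n j))"
      by (rule covers_later[OF _ n]) simp
    with Suc have cov: "covers n (t + r) (\<lambda>\<pi>. conv n (killed n (Suc j)) h \<pi> + conv n (stopped n j) h \<pi>)
      (c * (mass n (killed n (Suc j)) - mass n (killed n s)) + c * mass n (stopped n j))"
      by (intro covers_add) auto
    have e1: "(\<lambda>\<pi>. conv n (killed n (Suc j)) h \<pi> + conv n (stopped n j) h \<pi>) = rstep n (conv n (killed n j) h)"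
    proof
      fix \<pi>
      show "conv n (killed n (Suc j)) h \<pi> + conv n (stopped n j) h \<pi> = rstep n (conv n (killed n j) h) \<pi>"
        unfolding rstep_conv conv_def rstep_split sum.distrib[symmetric] by (intro sum.cong refl) (simp only: distrib_right)
    qed
    have e2: "mass n (killed n j) = mass n (killed n (Suc j)) + mass n (stopped n j)"
    proof -
      have "mass n (rstep n (killed n j)) = mass n (killed n (Suc j)) + mass n (stopped n j)"
        unfolding mass_def rstep_split by (rule sum.distrib)
      then show ?thesis using mass_rstep[OF n] by simp
    qed
    have e3: "c * (mass n (killed n (Suc j)) - mass n (killed n s)) + c * mass n (stopped n j) = c * (mass n (killed n j) - mass n (killed n s))"
      unfolding e2 by (simp only: ring_distribs)
    have "covers n (Suc (t + r)) (conv n (killed n j) h) (c * (mass n (killed n j) - mass n (killed n s)))"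
      using cov unfolding e1 e3 by (rule covers_step)
    then show ?case by simp
  qed
  from this[of 0 s] have "covers n (t + s) (conv n id_mass h) (c * (1 - mass n (killed n s)))"
    by (simp add: mass_id)
  then show ?thesis by (simp add: conv_id_left[abs_def])
qed

text \<open>The permutation at which the first run stops becomes the right factor \<open>g\<close>,
  and the second run starts afresh from the identity on its left. Hence \<open>covers_run\<close> is
  applied twice, the inner time for the run that comes later.\<close>

lemma covers_two_runs:
  assumes n: "64 \<le> n" and c: "0 \<le> c"
    "\<And>K. K \<subseteq> {1..n} \<Longrightarrow> n \<le> 32 * card K \<Longrightarrow> covers n t (conv n (cyc_unif K) (cyc_unif K)) c"
  shows "covers n (t + 2 * s) id_mass (c * (1 - 64 / n) * (1 - mass n (killed n s))\<^sup>2)"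
proof -
  have one: "covers n (t + s) g (c * (1 - 64 / n) * mass n g * (1 - mass n (killed n s)))"
    if g: "class_fun n g" "\<And>a. a permutes {1..n} \<Longrightarrow> 0 \<le> g a"
      "\<And>a. a permutes {1..n} \<Longrightarrow> g a \<noteq> 0 \<Longrightarrow> long_cycles n a \<noteq> {}" for g
  proof (rule covers_run)
    fix f assume f: "class_fun n f" "\<And>a. a permutes {1..n} \<Longrightarrow> 0 \<le> f a"
      "\<And>a. a permutes {1..n} \<Longrightarrow> f a \<noteq> 0 \<Longrightarrow> long_cycles n a \<noteq> {}"
    have "covers n t (conv n f g) (c * (1 - 64 / n) * mass n f * mass n g)"
      using n f g c by (intro covers_conv_class_fun) auto
    then show "covers n t (conv n f g) (c * (1 - 64 / n) * mass n g * mass n f)" by (simp add: mult_ac)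
  qed (use n g in auto)
  have "covers n (t + s + s) id_mass (c * (1 - 64 / n) * (1 - mass n (killed n s)) * (1 - mass n (killed n s)))"
  proof (rule covers_run)
    fix f assume f: "class_fun n f" "\<And>a. a permutes {1..n} \<Longrightarrow> 0 \<le> f a"
      "\<And>a. a permutes {1..n} \<Longrightarrow> f a \<noteq> 0 \<Longrightarrow> long_cycles n a \<noteq> {}"
    show "covers n (t + s) (conv n f id_mass) (c * (1 - 64 / n) * (1 - mass n (killed n s)) * mass n f)"
      by (rule covers_mono[OF one[OF f]]) (simp_all add: conv_id_right mult_ac)
  qed (use n in \<open>auto simp: id_mass_def\<close>)
  then show ?thesis unfolding power2_eq_square mult_2 by (simp add: mult.assoc add.assoc)
qed

section \<open>Separation of the walk\<close>

lemma pmf_rt_walk: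
  assumes n: "0 < n"
  shows "pmf (rt_walk n t) \<pi> = rsteps n t id_mass \<pi>"
proof (induction t arbitrary: \<pi>)
  case 0
  show ?case by (simp add: id_mass_def)
next
  case (Suc t)
  let ?P = "{1..n} \<times> {1..n}"
  have P: "finite ?P" "?P \<noteq> {}" using n by auto
  have "rt_walk n (Suc t) = bind_pmf (rt_walk n t) (\<lambda>\<pi>. bind_pmf (pmf_of_set ?P) (\<lambda>p. return_pmf (tr (fst p) (snd p) \<circ> \<pi>)))"
    using n by (simp add: rt_step_eq_uniform_pair map_pmf_def bind_assoc_pmf bind_return_pmf case_prod_beta)
  also have "\<dots> = bind_pmf (pmf_of_set ?P) (\<lambda>p. map_pmf (\<lambda>\<pi>. tr (fst p) (snd p) \<circ> \<pi>) (rt_walk n t))"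
    unfolding map_pmf_def by (rule bind_commute_pmf)
  finally have "pmf (rt_walk n (Suc t)) \<pi> = (\<Sum>p\<in>?P. pmf (map_pmf (\<lambda>\<pi>. tr (fst p) (snd p) \<circ> \<pi>) (rt_walk n t)) \<pi>) / real (card ?P)"
    by (simp only: pmf_bind_pmf_of_set[OF P(2,1)])
  also have "\<dots> = (\<Sum>p\<in>?P. rsteps n t id_mass (tr (fst p) (snd p) \<circ> \<pi>)) / (real n)\<^sup>2"
  proof -
    have "pmf (map_pmf (\<lambda>\<pi>. tr i j \<circ> \<pi>) (rt_walk n t)) \<pi> = rsteps n t id_mass (tr i j \<circ> \<pi>)" for i j
    proof -
      have "inj (\<lambda>\<pi>. tr i j \<circ> \<pi>)" by (metis injI transpose_comp_transpose_comp)
      then have "pmf (map_pmf (\<lambda>\<pi>. tr i j \<circ> \<pi>) (rt_walk n t)) (tr i j \<circ> (tr i j \<circ> \<pi>)) = pmf (rt_walk n t) (tr i j \<circ> \<pi>)"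
        by (rule pmf_map_inj')
      then show ?thesis unfolding transpose_comp_transpose_comp Suc .
    qed
    then show ?thesis by (simp add: power2_eq_square)
  qed
  also have "\<dots> = rsteps n (Suc t) id_mass \<pi>"
    unfolding rsteps_Suc rstep_def[of _ _ \<pi>] by (simp add: case_prod_beta)
  finally show ?case .
qed

lemma finite_separation_image: "finite ((\<lambda>\<pi>. 1 - fact n * pmf p \<pi>) ` {\<pi>. \<pi> permutes {1..n}})"
  using finite_permutations[of "{1..n}"] by simp

lemma separation_ge:
  "\<pi> permutes {1..n} \<Longrightarrow> 1 - fact n * pmf p \<pi> \<le> separation n p"
  unfolding separation_def using finite_separation_image by (intro Max_ge) auto

lemma separation_le:
  assumes "\<And>\<pi>. \<pi> permutes {1..n} \<Longrightarrow> 1 - fact n * pmf p \<pi> \<le> c"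
  shows "separation n p \<le> c"
proof -
  have "id permutes {1..n}" by simp
  then have "(\<lambda>\<pi>. 1 - fact n * pmf p \<pi>) ` {\<pi>. \<pi> permutes {1..n}} \<noteq> {}" by blast
  then show ?thesis unfolding separation_def using finite_separation_image assms
    by (subst Max_le_iff) auto
qed

lemma sep_le_1: "sep n t \<le> 1"
  unfolding sep_def by (rule separation_le) simp

text \<open>Otherwise all n! permutations would have probability above 1 / n!.\<close>

lemma sep_nonneg: "0 \<le> sep n t"
proof (rule ccontr)
  assume neg: "\<not> 0 \<le> sep n t"
  let ?G = "{\<pi>. \<pi> permutes {1..n}}"
  have fin: "finite ?G" using finite_permutations[of "{1..n}"] by simp
  have "1 / fact n < pmf (rt_walk n t) \<pi>" if "\<pi> \<in> ?G" for \<pi>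
  proof -
    have "1 - fact n * pmf (rt_walk n t) \<pi> < 0"
      using separation_ge[of \<pi> n "rt_walk n t"] that neg by (simp add: sep_def)
    then show ?thesis by (simp add: field_simps)
  qed
  then have "(\<Sum>\<pi>\<in>?G. 1 / fact n) < (\<Sum>\<pi>\<in>?G. pmf (rt_walk n t) \<pi>)"
    using fin permutes_id[of "{1..n}"] by (intro sum_strict_mono) blast+
  also have "\<dots> \<le> 1"
    using fin measure_measure_pmf_finite[OF fin, of "rt_walk n t"] by (metis measure_pmf.prob_le_1)
  finally show False using card_permutations[of "{1..n}" n] by simp
qed

lemma sep_le_covers:
  assumes "covers n t id_mass c" "0 < n"
  shows "sep n t \<le> 1 - c"
  unfolding sep_def
proof (rule separation_le)
  fix \<pi> :: "nat \<Rightarrow> nat" assume "\<pi> permutes {1..n}"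
  from coversD[OF assms(1) this] show "1 - fact n * pmf (rt_walk n t) \<pi> \<le> 1 - c"
    by (simp add: pmf_rt_walk[OF assms(2)])
qed

section \<open>Cards that have not been touched\<close>

fun trans_prod :: "(nat \<times> nat) list \<Rightarrow> nat \<Rightarrow> nat" where
  "trans_prod [] = id"
| "trans_prod (p # ps) = tr (fst p) (snd p) \<circ> trans_prod ps"

definition words :: "nat set \<Rightarrow> nat \<Rightarrow> (nat \<times> nat) list set" where
  "words A t = {ps. set ps \<subseteq> A \<times> A \<and> length ps = t}"

lemma finite_words: "finite A \<Longrightarrow> finite (words A t)"
  unfolding words_def by (intro finite_lists_length_eq) auto

lemma card_words: "finite A \<Longrightarrow> real (card (words A t)) = ((real (card A))\<^sup>2) ^ t"
  unfolding words_def by (simp add: card_lists_length_eq card_cartesian_product power2_eq_square)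

lemma words_Suc: "words A (Suc t) = (\<lambda>(p, ps). p # ps) ` ((A \<times> A) \<times> words A t)"
  unfolding words_def by (auto simp: length_Suc_conv image_iff)

text \<open>Every step is a uniform ordered pair, so probabilities become proportions of words, to
  which the counting form of Chebyshev's inequality applies.\<close>

lemma rsteps_id_mass_eq_card:
  assumes n: "0 < n"
  shows "rsteps n t id_mass \<pi> = real (card {ps \<in> words {1..n} t. trans_prod ps = \<pi>}) / ((real n)\<^sup>2) ^ t"
proof (induction t arbitrary: \<pi>)
  case 0
  have "{ps \<in> words {1..n} 0. trans_prod ps = \<pi>} = (if \<pi> = id then {[]} else {})"
    by (auto simp: words_def)
  then show ?case by (simp add: id_mass_def)
next
  case (Suc t)
  let ?N = "{1..n}"
  have iff: "tr i j \<circ> \<sigma> = \<pi> \<longleftrightarrow> \<sigma> = tr i j \<circ> \<pi>" for i j and \<sigma> :: "nat \<Rightarrow> nat"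
    by (metis transpose_comp_transpose_comp)
  have set_eq: "{ps \<in> words ?N (Suc t). trans_prod ps = \<pi>} =
    (\<lambda>(p, ps). p # ps) ` (SIGMA p:?N \<times> ?N. {ps \<in> words ?N t. trans_prod ps = tr (fst p) (snd p) \<circ> \<pi>})"
  proof (intro set_eqI iffI)
    fix qs assume "qs \<in> {ps \<in> words ?N (Suc t). trans_prod ps = \<pi>}"
    then have "qs \<in> (\<lambda>(p, ps). p # ps) ` ((?N \<times> ?N) \<times> words ?N t)" and tq: "trans_prod qs = \<pi>"
      unfolding words_Suc by (simp_all only: mem_Collect_eq)
    then obtain r where r: "r \<in> (?N \<times> ?N) \<times> words ?N t" "qs = (\<lambda>(p, ps). p # ps) r" by blast
    define p ps where "p = fst r" and "ps = snd r"
    have q: "qs = p # ps" "p \<in> ?N \<times> ?N" "ps \<in> words ?N t"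
      using r unfolding p_def ps_def by (simp_all only: case_prod_beta mem_Times_iff)
    then have q: "qs = p # ps" "p \<in> ?N \<times> ?N" "ps \<in> words ?N t" "tr (fst p) (snd p) \<circ> trans_prod ps = \<pi>"
      using tq by (simp_all only: trans_prod.simps)
    have "trans_prod ps = tr (fst p) (snd p) \<circ> \<pi>" using iff[THEN iffD1, OF q(4)] .
    then have "(p, ps) \<in> (SIGMA p:?N \<times> ?N. {ps \<in> words ?N t. trans_prod ps = tr (fst p) (snd p) \<circ> \<pi>})"
      using q(2,3) by blast
    then show "qs \<in> (\<lambda>(p, ps). p # ps) ` (SIGMA p:?N \<times> ?N. {ps \<in> words ?N t. trans_prod ps = tr (fst p) (snd p) \<circ> \<pi>})"
      by (rule rev_image_eqI) (simp add: q(1))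
  next
    fix qs assume "qs \<in> (\<lambda>(p, ps). p # ps) ` (SIGMA p:?N \<times> ?N. {ps \<in> words ?N t. trans_prod ps = tr (fst p) (snd p) \<circ> \<pi>})"
    then obtain r where r: "r \<in> (SIGMA p:?N \<times> ?N. {ps \<in> words ?N t. trans_prod ps = tr (fst p) (snd p) \<circ> \<pi>})"
      "qs = (\<lambda>(p, ps). p # ps) r" by blast
    define p ps where "p = fst r" and "ps = snd r"
    have q: "qs = p # ps" "p \<in> ?N \<times> ?N" "ps \<in> words ?N t" "trans_prod ps = tr (fst p) (snd p) \<circ> \<pi>"
      using r unfolding p_def ps_def by (simp_all only: case_prod_beta mem_Sigma_iff split: prod.splits) auto
    then have "trans_prod qs = \<pi>" by (simp only: trans_prod.simps transpose_comp_transpose_comp)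
    moreover have "qs \<in> words ?N (Suc t)"
      unfolding words_Suc q(1) using q(2,3) by (intro image_eqI[where x="(p, ps)"]) (simp_all only: case_prod_conv mem_Times_iff fst_conv snd_conv)
    ultimately show "qs \<in> {ps \<in> words ?N (Suc t). trans_prod ps = \<pi>}" by simp
  qed
  have "card {ps \<in> words ?N (Suc t). trans_prod ps = \<pi>} = card (SIGMA p:?N \<times> ?N. {ps \<in> words ?N t. trans_prod ps = tr (fst p) (snd p) \<circ> \<pi>})"
    unfolding set_eq by (rule card_image) (auto simp: inj_on_def)
  also have "\<dots> = (\<Sum>p\<in>?N \<times> ?N. card {ps \<in> words ?N t. trans_prod ps = tr (fst p) (snd p) \<circ> \<pi>})"
    by (rule card_SigmaI) (auto simp: finite_words)
  finally have e: "card {ps \<in> words ?N (Suc t). trans_prod ps = \<pi>} =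
    (\<Sum>p\<in>?N \<times> ?N. card {ps \<in> words ?N t. trans_prod ps = tr (fst p) (snd p) \<circ> \<pi>})" .
  have "rsteps n (Suc t) id_mass \<pi> = (\<Sum>p\<in>?N \<times> ?N. rsteps n t id_mass (tr (fst p) (snd p) \<circ> \<pi>)) / (real n)\<^sup>2"
    unfolding rsteps_Suc rstep_def[of _ _ \<pi>] case_prod_beta ..
  also have "\<dots> = (\<Sum>p\<in>?N \<times> ?N. real (card {ps \<in> words ?N t. trans_prod ps = tr (fst p) (snd p) \<circ> \<pi>})) / ((real n)\<^sup>2) ^ t / (real n)\<^sup>2"
    by (simp only: Suc sum_divide_distrib)
  also have "\<dots> = real (card {ps \<in> words ?N (Suc t). trans_prod ps = \<pi>}) / ((real n)\<^sup>2) ^ Suc t"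
    unfolding e of_nat_sum by (simp only: divide_divide_eq_left power_Suc mult.commute)
  finally show ?case .
qed

lemma trans_prod_untouched:
  assumes "set ps \<subseteq> A \<times> A" "x \<notin> A"
  shows "trans_prod ps x = x"
  using assms by (induction ps) (auto simp: Transposition.transpose_def)

text \<open>A pair (x, x) moves nothing but counts as touching \<open>x\<close>; thus the words that
  leave \<open>x\<close> untouched are all words over the alphabet without \<open>x\<close>, and are
  easily counted.\<close>

definition untouched :: "nat \<Rightarrow> (nat \<times> nat) list \<Rightarrow> nat set" where
  "untouched n ps = {x \<in> {1..n}. set ps \<subseteq> ({1..n} - {x}) \<times> ({1..n} - {x})}"

text \<open>Here \<open>\<mu>\<close> is the mean number of untouched cards, and two cards are
  negatively correlated; having at most one untouched card is a deviation of at least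
  \<open>\<mu> - 1\<close>.\<close>

lemma card_few_untouched:
  fixes n t :: nat
  assumes n: "2 \<le> n"
  defines "\<mu> \<equiv> real n * (((real n - 1) / real n)\<^sup>2) ^ t"
  assumes \<mu>: "1 < \<mu>"
  shows "real (card {ps \<in> words {1..n} t. card (untouched n ps) \<le> 1}) / ((real n)\<^sup>2) ^ t \<le> \<mu> / (\<mu> - 1)\<^sup>2"
proof -
  let ?N = "{1..n}" and ?W = "words {1..n} t"
  define p where "p = (((real n - 1) / real n)\<^sup>2) ^ t"
  define M where "M = ((real n)\<^sup>2) ^ t"
  have M0: "0 < M" using n by (simp add: M_def)
  have cW: "real (card ?W) = M" unfolding M_def by (simp add: card_words)
  have \<mu>_eq: "real (card ?N) * p = \<mu>" by (simp add: \<mu>_def p_def)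
  have "real (card {ps \<in> ?W. real (card {x \<in> ?N. x \<in> untouched n ps}) \<le> 1}) * (real (card ?N) * p - 1)\<^sup>2 \<le> real (card ?N) * p * real (card ?W)"
  proof (rule chebyshev_count[where q="p\<^sup>2"])
    fix x assume x: "x \<in> ?N"
    have "{ps \<in> ?W. x \<in> untouched n ps} = words (?N - {x}) t"
      using x unfolding untouched_def words_def by auto
    then have "real (card {ps \<in> ?W. x \<in> untouched n ps}) = ((real n - 1)\<^sup>2) ^ t"
      using x n by (simp add: card_words of_nat_diff)
    also have "(real n - 1)\<^sup>2 = ((real n - 1) / real n)\<^sup>2 * (real n)\<^sup>2"
      using n by (simp add: power_divide)
    finally show "real (card {ps \<in> ?W. x \<in> untouched n ps}) = p * real (card ?W)"
      unfolding cW p_def M_def power_mult_distrib .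
    fix y assume y: "y \<in> ?N" "x \<noteq> y"
    have "{ps \<in> ?W. x \<in> untouched n ps \<and> y \<in> untouched n ps} = words (?N - {x, y}) t"
      using x y unfolding untouched_def words_def by auto
    moreover have "card (?N - {x, y}) = n - 2" using x y by (subst card_Diff_subset) auto
    ultimately have "real (card {ps \<in> ?W. x \<in> untouched n ps \<and> y \<in> untouched n ps}) = ((real n - 2)\<^sup>2) ^ t"
      using n by (simp add: card_words of_nat_diff)
    also have "\<dots> \<le> ((((real n - 1) / real n)\<^sup>2)\<^sup>2 * (real n)\<^sup>2) ^ t"
    proof (intro power_mono)
      \<comment> \<open>Negative correlation for a single entry of a pair: 1 - 2 / n is at most (1 -
        1 / n)^2.\<close>
      have "(real n - 2) * real n \<le> (real n - 1)\<^sup>2" by (simp add: power2_eq_square algebra_simps)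
      then have "real n - 2 \<le> (real n - 1)\<^sup>2 / real n" using n by (simp add: field_simps)
      then have "(real n - 2)\<^sup>2 \<le> ((real n - 1)\<^sup>2 / real n)\<^sup>2" using n by (intro power_mono) auto
      also have "\<dots> = (((real n - 1) / real n)\<^sup>2)\<^sup>2 * (real n)\<^sup>2" using n by (simp add: power2_eq_square field_simps)
      finally show "(real n - 2)\<^sup>2 \<le> (((real n - 1) / real n)\<^sup>2)\<^sup>2 * (real n)\<^sup>2" .
    qed simp
    also have "\<dots> = p\<^sup>2 * M"
    proof -
      have "((((real n - 1) / real n)\<^sup>2)\<^sup>2) ^ t = p\<^sup>2"
        unfolding p_def power_mult[symmetric] by (simp add: mult_ac)
      then show ?thesis unfolding M_def power_mult_distrib by (simp only:)
    qed
    finally show "real (card {ps \<in> ?W. x \<in> untouched n ps \<and> y \<in> untouched n ps}) \<le> p\<^sup>2 * real (card ?W)"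
      unfolding cW .
  next
    have "real n * (real n - 1) * p\<^sup>2 \<le> real n * real n * p\<^sup>2" by (intro mult_right_mono mult_left_mono) auto
    then show "real (card ?N) * (real (card ?N) - 1) * p\<^sup>2 \<le> (real (card ?N) * p)\<^sup>2"
      by (simp add: power_mult_distrib power2_eq_square mult_ac)
  qed (use \<mu> \<mu>_eq in \<open>auto simp: finite_words\<close>)
  moreover have "{x \<in> ?N. x \<in> untouched n ps} = untouched n ps" for ps by (auto simp: untouched_def)
  ultimately have "real (card {ps \<in> ?W. card (untouched n ps) \<le> 1}) * (\<mu> - 1)\<^sup>2 \<le> \<mu> * M"
    unfolding \<mu>_eq cW by simp
  then show ?thesis using \<mu> M0 by (fold M_def) (simp add: field_simps)
qed

text \<open>The mean number of fixed points of a uniform permutation is 1, so by Markov's inequality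
  at most half of the permutations have two or more.\<close>

lemma card_few_fixed_points:
  assumes n: "1 \<le> n"
  shows "fact n \<le> 2 * real (card {\<pi>. \<pi> permutes {1..n} \<and> card {x \<in> {1..n}. \<pi> x = x} \<le> 1})"
proof -
  let ?N = "{1..n}" and ?G = "{\<pi>. \<pi> permutes {1..n}}"
  define fx where "fx = (\<lambda>\<pi>. card {x \<in> ?N. \<pi> x = x})"
  have finG: "finite ?G" using finite_permutations[of ?N] by simp
  have cG: "card ?G = fact n" using card_permutations[of ?N n] by simp
  have "(\<Sum>\<pi>\<in>?G. fx \<pi>) = (\<Sum>\<pi>\<in>?G. \<Sum>x\<in>?N. if \<pi> x = x then 1 else 0)"
    unfolding fx_def by (simp flip: sum.inter_filter)
  also have "\<dots> = (\<Sum>x\<in>?N. \<Sum>\<pi>\<in>?G. if \<pi> x = x then 1 else 0)" by (rule sum.swap)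
  also have "\<dots> = (\<Sum>x\<in>?N. fact (n - 1))"
  proof (intro sum.cong refl)
    fix x assume x: "x \<in> ?N"
    have "{\<pi> \<in> ?G. \<pi> x = x} = {\<pi>. \<pi> permutes ?N - {x}}"
    proof (intro set_eqI iffI)
      fix \<pi> assume "\<pi> \<in> {\<pi> \<in> ?G. \<pi> x = x}"
      then show "\<pi> \<in> {\<pi>. \<pi> permutes ?N - {x}}" by (auto intro: permutes_superset)
    next
      fix \<pi> assume "\<pi> \<in> {\<pi>. \<pi> permutes ?N - {x}}"
      then show "\<pi> \<in> {\<pi> \<in> ?G. \<pi> x = x}" by (auto intro: permutes_subset simp: permutes_not_in)
    qed
    moreover have "card {\<pi>. \<pi> permutes ?N - {x}} = fact (n - 1)"
      using x by (intro card_permutations) auto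
    ultimately show "(\<Sum>\<pi>\<in>?G. if \<pi> x = x then 1 else 0) = fact (n - 1)"
      using finG by (simp flip: sum.inter_filter)
  qed
  also have "\<dots> = fact n" using n by (simp add: fact_reduce)
  finally have tot: "(\<Sum>\<pi>\<in>?G. fx \<pi>) = fact n" .
  let ?L = "{\<pi> \<in> ?G. fx \<pi> \<le> 1}" and ?M = "{\<pi> \<in> ?G. \<not> fx \<pi> \<le> 1}"
  have "card ?M * 2 \<le> (\<Sum>\<pi>\<in>?M. fx \<pi>)" by (rule order_trans[OF _ sum_bounded_below[of ?M 2 fx]]) auto
  also have "\<dots> \<le> (\<Sum>\<pi>\<in>?G. fx \<pi>)" using finG by (intro sum_mono2) auto
  finally have "2 * card ?M \<le> fact n" using tot by simp
  moreover have "card ?G = card ?L + card ?M"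
  proof -
    have "?G = ?L \<union> ?M" by auto
    then have "card ?G = card (?L \<union> ?M)" by (rule arg_cong)
    also have "\<dots> = card ?L + card ?M" using finG by (intro card_Un_disjoint) auto
    finally show ?thesis .
  qed
  ultimately have "fact n \<le> 2 * card ?L" using cG by linarith
  then have "real (fact n) \<le> real (2 * card ?L)" by (simp only: of_nat_le_iff)
  then show ?thesis by (simp add: fx_def conj_commute)
qed

text \<open>With s the separation, each of the at least n! / 2 permutations with at most one fixed
  point has probability at least (1 - s) / n!. Untouched cards are fixed points, so (1 - s) / 2 is
  at most the probability of having at most one untouched card.\<close>

lemma sep_ge:
  fixes n t :: nat
  assumes n: "2 \<le> n"
  defines "\<mu> \<equiv> real n * (((real n - 1) / real n)\<^sup>2) ^ t"
  assumes \<mu>: "1 < \<mu>"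
  shows "1 - 2 * (\<mu> / (\<mu> - 1)\<^sup>2) \<le> sep n t"
proof -
  let ?N = "{1..n}" and ?W = "words {1..n} t"
  define H where "H = {\<pi>. \<pi> permutes ?N \<and> card {x \<in> ?N. \<pi> x = x} \<le> 1}"
  have finH: "finite H" unfolding H_def using finite_permutations[of ?N] by (auto intro: rev_finite_subset)
  have n0: "0 < n" using n by simp
  have "fact n \<le> 2 * real (card H)" unfolding H_def by (rule card_few_fixed_points) (use n in simp)
  have "(\<Sum>\<pi>\<in>H. pmf (rt_walk n t) \<pi>) = (\<Sum>\<pi>\<in>H. real (card {ps \<in> ?W. trans_prod ps = \<pi>})) / ((real n)\<^sup>2) ^ t"
    unfolding pmf_rt_walk[OF n0] rsteps_id_mass_eq_card[OF n0] by (rule sum_divide_distrib[symmetric])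
  also have "(\<Sum>\<pi>\<in>H. real (card {ps \<in> ?W. trans_prod ps = \<pi>})) = real (card (\<Union>\<pi>\<in>H. {ps \<in> ?W. trans_prod ps = \<pi>}))"
    using finH finite_words[of ?N t] by (subst card_UN_disjoint) auto
  also have "\<dots> \<le> real (card {ps \<in> ?W. card (untouched n ps) \<le> 1})"
  proof (intro of_nat_mono card_mono)
    show "(\<Union>\<pi>\<in>H. {ps \<in> ?W. trans_prod ps = \<pi>}) \<subseteq> {ps \<in> ?W. card (untouched n ps) \<le> 1}"
    proof clarify
      fix ps assume ps: "ps \<in> ?W" "trans_prod ps \<in> H"
      have "untouched n ps \<subseteq> {x \<in> ?N. trans_prod ps x = x}"
        unfolding untouched_def using trans_prod_untouched[of ps "?N - {x}" x for x] by blast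
      then have "card (untouched n ps) \<le> card {x \<in> ?N. trans_prod ps x = x}" by (intro card_mono) auto
      then show "card (untouched n ps) \<le> 1" using ps(2) by (simp add: H_def)
    qed
  qed (simp add: finite_words)
  finally have "(\<Sum>\<pi>\<in>H. pmf (rt_walk n t) \<pi>) \<le> real (card {ps \<in> ?W. card (untouched n ps) \<le> 1}) / ((real n)\<^sup>2) ^ t"
    by (simp add: divide_right_mono)
  also have "\<dots> \<le> \<mu> / (\<mu> - 1)\<^sup>2"
    unfolding \<mu>_def by (rule card_few_untouched[OF n \<mu>[unfolded \<mu>_def]])
  finally have le: "(\<Sum>\<pi>\<in>H. pmf (rt_walk n t) \<pi>) \<le> \<mu> / (\<mu> - 1)\<^sup>2" .
  define s where "s = sep n t"
  have "(1 - s) / fact n \<le> pmf (rt_walk n t) \<pi>" if "\<pi> \<in> H" for \<pi>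
    using separation_ge[of \<pi> n "rt_walk n t"] that by (simp add: H_def s_def sep_def field_simps)
  then have "real (card H) * ((1 - s) / fact n) \<le> (\<Sum>\<pi>\<in>H. pmf (rt_walk n t) \<pi>)"
    by (intro sum_bounded_below) auto
  then have "real (card H) * ((1 - s) / fact n) \<le> \<mu> / (\<mu> - 1)\<^sup>2" using le by simp
  moreover have "(fact n / 2) * ((1 - s) / fact n) \<le> real (card H) * ((1 - s) / fact n)"
    using \<open>fact n \<le> 2 * real (card H)\<close> sep_le_1[of n t] by (intro mult_right_mono) (auto simp: s_def)
  ultimately have "(fact n / 2) * ((1 - s) / fact n) \<le> \<mu> / (\<mu> - 1)\<^sup>2" by (rule order_trans[rotated])
  then have "(1 - s) / 2 \<le> \<mu> / (\<mu> - 1)\<^sup>2" by simp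
  then show ?thesis by (simp add: s_def)
qed

section \<open>The cutoff\<close>

lemma growth_potential_le:
  assumes "0 < \<delta>" "0 < n" "k \<le> n" "n \<le> 32 * k"
  shows "growth_potential \<delta> n k \<le> 31 + 961 / \<delta>"
proof -
  have k: "0 < k" using assms by linarith
  have a: "(n - k) / k \<le> 31" "0 \<le> (n - k) / k" using assms k by (simp_all add: field_simps)
  then have "((n - k) / k)\<^sup>2 \<le> 31\<^sup>2" by (intro power_mono) auto
  then have "((n - k) / k)\<^sup>2 / \<delta> \<le> 961 / \<delta>" using assms(1) by (intro divide_right_mono) auto
  then show ?thesis using a by (simp add: growth_potential_def)
qed

text \<open>The five factors account, in this order, for growth, parity repair, the density of a
  product of two cycles, the size of the intersection and the two runs. The same \<open>s\<close> is
  allotted to each run and to the parity repair, hence \<open>3 * s\<close>.\<close>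

lemma sep_upper_bound:
  fixes \<delta> :: real
  assumes n: "64 \<le> n" "2048 \<le> n" and \<delta>: "0 < \<delta>" "\<delta> \<le> 1" "64 / \<delta> \<le> n"
    and s: "0 < s" "2 * real n \<le> real s" and T: "t + 3 * s \<le> T"
    and E: "0 \<le> E" "E \<le> 1 - n * (31 + 961 / \<delta>) * (1 - 2 * (1 - \<delta>) / n) ^ t"
  shows "sep n T \<le> 1 - E * (1 - exp (- 2 * real s / n)) * (n / (real n + 96)) * (1 - 64 / n) * (1 - 2 * real n / real s)\<^sup>2"
proof -
  have n0: "0 < n" using n by simp
  define p where "p = 1 - exp (- 2 * real s / n)"
  have p: "0 \<le> p" "p \<le> 1 - (1 - 2 / n) ^ s"
  proof -
    show "0 \<le> p" by (simp add: p_def)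
    have "(1 - 2 / n) ^ s \<le> exp (- 2 / n) ^ s"
      using n exp_ge_add_one_self[of "- 2 / n"] by (intro power_mono) (auto simp: field_simps)
    also have "\<dots> = exp (- 2 * real s / n)" by (simp add: mult.commute flip: exp_of_nat_mult)
    finally show "p \<le> 1 - (1 - 2 / n) ^ s" by (simp add: p_def)
  qed
  define c where "c = E * p * (n / (real n + 96))"
  have c0: "0 \<le> c" using E p by (simp add: c_def)
  have cov: "covers n (t + s) (conv n (cyc_unif K) (cyc_unif K)) c" if K: "K \<subseteq> {1..n}" "n \<le> 32 * card K" for K
  proof -
    let ?k = "real (card K)"
    have kn: "?k \<le> n" using card_mono[OF _ K(1)] by simp
    have k0: "0 < card K" using K n0 by auto
    have "real n \<le> 32 * ?k" using K(2) by linarith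
    have "covers n t (unif K) (1 - n * growth_potential \<delta> n (card K) * (1 - 2 * (1 - \<delta>) / n) ^ t)"
    proof (rule covers_unif)
      \<comment> \<open>The bound 64 / \<open>\<delta>\<close> on n is 32 times what the growth
        phase asks of \<open>card K\<close>.\<close>
      show "2 / \<delta> \<le> ?k" using \<delta>(3) \<open>real n \<le> 32 * ?k\<close> by simp
    qed (use n \<delta> K in auto)
    then have u: "covers n t (unif K) E"
    proof (rule covers_mono)
      have "0 \<le> 1 - 2 * (1 - \<delta>) / n" using n \<delta> by (simp add: field_simps)
      then have "n * growth_potential \<delta> n (card K) * (1 - 2 * (1 - \<delta>) / n) ^ t \<le> n * (31 + 961 / \<delta>) * (1 - 2 * (1 - \<delta>) / n) ^ t"
        using growth_potential_le[OF \<delta>(1) _ kn \<open>real n \<le> 32 * ?k\<close>] n0 by (intro mult_right_mono mult_left_mono) auto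
      then show "E \<le> 1 - n * growth_potential \<delta> n (card K) * (1 - 2 * (1 - \<delta>) / n) ^ t" using E by linarith
    qed simp
    have big: "n \<le> card K * (card K - 1)"
    proof -
      have "33 \<le> card K" using K(2) n(2) by linarith
      then have "card K * 32 \<le> card K * (card K - 1)" by (intro mult_left_mono) auto
      then show ?thesis using K(2) by linarith
    qed
    have "covers n (t + s) (even_unif K) (E * (1 - (1 - 2 / n) ^ s))"
      by (rule covers_even_unif[OF K(1) n0 big u])
    then have "covers n (t + s) (even_unif K) (E * p)"
      by (rule covers_mono) (use p E in \<open>auto intro: mult_left_mono\<close>)
    then have "covers n (t + s) (\<lambda>\<pi>. (card K / (?k + 3)) * even_unif K \<pi>) ((card K / (?k + 3)) * (E * p))"
      by (rule covers_cmult) simp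
    then show ?thesis
    proof (rule covers_mono)
      fix \<pi> :: "nat \<Rightarrow> nat"
      show "card K / (?k + 3) * even_unif K \<pi> \<le> conv n (cyc_unif K) (cyc_unif K) \<pi>"
        using k0 by (intro conv_cyc_ge_even_unif K) auto
      \<comment> \<open>The right-hand side increases with \<open>card K\<close>, and 96 is 3 times
        32.\<close>
      have "n / (real n + 96) \<le> ?k / (?k + 3)"
        using \<open>real n \<le> 32 * ?k\<close> k0 n0 by (simp add: frac_le_eq field_simps)
      then have "E * p * (n / (real n + 96)) \<le> E * p * (?k / (?k + 3))" using E p by (intro mult_left_mono) auto
      then show "c \<le> card K / (?k + 3) * (E * p)" by (simp add: c_def mult.commute)
    qed
  qed
  have "covers n (t + s + 2 * s) id_mass (c * (1 - 64 / n) * (1 - mass n (killed n s))\<^sup>2)"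
    using n(1) c0 cov by (rule covers_two_runs)
  then have "covers n T id_mass (c * (1 - 64 / n) * (1 - mass n (killed n s))\<^sup>2)"
    by (rule covers_later) (use n0 T in auto)
  then have "sep n T \<le> 1 - c * (1 - 64 / n) * (1 - mass n (killed n s))\<^sup>2"
    using n0 by (rule sep_le_covers)
  moreover have "c * (1 - 64 / n) * (1 - 2 * real n / real s)\<^sup>2 \<le> c * (1 - 64 / n) * (1 - mass n (killed n s))\<^sup>2"
  proof (intro mult_left_mono power_mono)
    show "1 - 2 * real n / real s \<le> 1 - mass n (killed n s)" using mass_killed_le[of n s] n s by simp
    show "0 \<le> 1 - 2 * real n / real s" using s by simp
    show "0 \<le> c * (1 - 64 / n)" using c0 n by simp
  qed
  ultimately have "sep n T \<le> 1 - c * (1 - 64 / n) * (1 - 2 * real n / real s)\<^sup>2" by linarith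
  then show ?thesis by (simp only: c_def p_def)
qed

lemma sep_upper_limit:
  fixes \<epsilon> :: real
  assumes e: "0 < \<epsilon>" "\<epsilon> < 1"
  shows "(\<lambda>n. sep n (nat \<lceil>(1 + \<epsilon>) * (1 / 2) * real n * ln (real n)\<rceil>)) \<longlonglongrightarrow> 0"
proof -
  \<comment> \<open>In units of n ln n the surplus is \<epsilon> / 2; \<open>3 * s\<close> takes 3
    \<epsilon> / 16 of it and leaves 5 \<epsilon> / 16 to \<open>t\<close>. With this
    \<open>\<delta>\<close> the decay exponent (1 - \<epsilon> / 8) (1 + 5 \<epsilon> / 8) is at
    least 1 + \<epsilon> / 4, which beats the factor n in front. Still \<open>s\<close> is much
    larger than n, as the runs and the parity repair require.\<close>
  define \<delta> where "\<delta> = \<epsilon> / 8"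
  define s where "s = (\<lambda>n::nat. nat \<lfloor>\<epsilon> / 16 * real n * ln (real n)\<rfloor>)"
  define T where "T = (\<lambda>n::nat. nat \<lceil>(1 + \<epsilon>) * (1 / 2) * real n * ln (real n)\<rceil>)"
  define C where "C = 31 + 961 / \<delta>"
  define E where "E = (\<lambda>n::nat. 1 - C * real n powr (- (\<epsilon> / 4)))"
  \<comment> \<open>A lower bound for \<open>s\<close> without the floor function, so that the
    limits become purely analytic.\<close>
  define L where "L = (\<lambda>n::nat. \<epsilon> / 16 * real n * ln (real n) - 1)"
  have sL: "L n \<le> real (s n)" for n
  proof -
    have "\<epsilon> / 16 * real n * ln (real n) - 1 \<le> real_of_int \<lfloor>\<epsilon> / 16 * real n * ln (real n)\<rfloor>" by linarith
    also have "\<dots> \<le> real (s n)" unfolding s_def by simp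
    finally show ?thesis by (simp add: L_def)
  qed
  define b where "b = (\<lambda>n::nat. E n * (1 - exp (- 2 * L n / n)) * (n / (real n + 96)) * (1 - 64 / n) * (1 - 2 * real n / L n)\<^sup>2)"
  have b1: "b \<longlonglongrightarrow> 1"
  proof -
    have 1: "E \<longlonglongrightarrow> 1" unfolding E_def using e by real_asymp
    have 2: "(\<lambda>n. 1 - exp (- 2 * L n / n)) \<longlonglongrightarrow> 1" unfolding L_def using e by real_asymp
    have 3: "(\<lambda>n::nat. n / (real n + 96)) \<longlonglongrightarrow> 1" by real_asymp
    have 4: "(\<lambda>n::nat. 1 - 64 / real n) \<longlonglongrightarrow> 1" by real_asymp
    have 5: "(\<lambda>n. (1 - 2 * real n / L n)\<^sup>2) \<longlonglongrightarrow> 1" unfolding L_def using e by real_asymp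
    show ?thesis unfolding b_def using tendsto_mult[OF tendsto_mult[OF tendsto_mult[OF tendsto_mult[OF 1 2] 3] 4] 5] by simp
  qed
  have ev1: "\<forall>\<^sub>F n in sequentially. 2 * real n \<le> L n" unfolding L_def using e by real_asymp
  have ev2: "\<forall>\<^sub>F n in sequentially. 0 \<le> E n"
    using order_tendstoD(1)[of E 1 sequentially 0] unfolding E_def using e by real_asymp
  have ev3: "\<forall>\<^sub>F n in sequentially. max 2048 (64 / \<delta>) \<le> real n" by real_asymp
  have bound: "\<forall>\<^sub>F n in sequentially. sep n (T n) \<le> 1 - b n"
    using ev1 ev2 ev3
  proof eventually_elim
    case (elim n)
    have n: "2048 \<le> n" "64 / \<delta> \<le> n" using elim by auto
    have \<delta>: "0 < \<delta>" "\<delta> \<le> 1" using e by (auto simp: \<delta>_def)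
    have L0: "0 < L n" using elim n by linarith
    have ln0: "0 \<le> ln (real n)" using n by simp
    define y where "y = real n * ln (real n)"
    have y0: "0 \<le> y" using ln0 by (simp add: y_def)
    have sU: "real (s n) \<le> \<epsilon> / 16 * y"
      unfolding s_def y_def mult.assoc[symmetric] using e ln0 by (intro of_nat_floor) simp
    have TL: "(1 + \<epsilon>) * (1 / 2) * y \<le> real (T n)"
      unfolding T_def y_def mult.assoc[symmetric] by linarith
    define t where "t = T n - 3 * s n"
    have t: "t + 3 * s n \<le> T n" "(1 / 2 + 5 * \<epsilon> / 16) * y \<le> real t"
    proof -
      have "real (3 * s n) \<le> 3 * (\<epsilon> / 16 * y)" using sU by simp
      also have "\<dots> \<le> (1 + \<epsilon>) * (1 / 2) * y"
        unfolding mult.assoc[symmetric] using e y0 by (intro mult_right_mono) auto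
      finally have le: "3 * s n \<le> T n" using TL by linarith
      then show "t + 3 * s n \<le> T n" by (simp add: t_def)
      have "real t = real (T n) - 3 * real (s n)" using le by (simp add: t_def of_nat_diff)
      then show "(1 / 2 + 5 * \<epsilon> / 16) * y \<le> real t" using TL sU by (simp add: algebra_simps)
    qed
    have Eb: "E n \<le> 1 - n * (31 + 961 / \<delta>) * (1 - 2 * (1 - \<delta>) / n) ^ t"
    proof -
      have "(1 - 2 * (1 - \<delta>) / n) ^ t \<le> exp (- (2 * (1 - \<delta>) / n)) ^ t"
        using n \<delta> exp_ge_add_one_self[of "- (2 * (1 - \<delta>) / n)"] by (intro power_mono) (auto simp: field_simps)
      also have "\<dots> = exp (- (2 * (1 - \<delta>) / n * real t))" by (simp add: mult.commute flip: exp_of_nat_mult)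
      also have "\<dots> \<le> exp (- ((1 + \<epsilon> / 4) * ln n))"
      proof -
        have "(1 + \<epsilon> / 4) * ln n \<le> 2 * (1 - \<delta>) * (1 / 2 + 5 * \<epsilon> / 16) * ln n"
        proof (rule mult_right_mono[OF _ ln0])
          have "\<epsilon> * \<epsilon> \<le> \<epsilon> * 1" using e by (intro mult_left_mono) auto
          then show "1 + \<epsilon> / 4 \<le> 2 * (1 - \<delta>) * (1 / 2 + 5 * \<epsilon> / 16)"
            using e by (simp add: \<delta>_def algebra_simps)
        qed
        also have "\<dots> = 2 * (1 - \<delta>) / n * ((1 / 2 + 5 * \<epsilon> / 16) * y)" using n by (simp add: y_def)
        also have "\<dots> \<le> 2 * (1 - \<delta>) / n * real t" using t(2) \<delta> by (intro mult_left_mono) auto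
        finally show ?thesis by simp
      qed
      also have "\<dots> = real n powr (- (\<epsilon> / 4)) / n"
      proof -
        have "exp (- ((1 + \<epsilon> / 4) * ln n)) = real n powr (- (\<epsilon> / 4) + - 1)"
          using n by (simp add: powr_def algebra_simps)
        also have "\<dots> = real n powr (- (\<epsilon> / 4)) * real n powr - 1" by (rule powr_add)
        finally show ?thesis using n by (simp add: powr_minus_divide)
      qed
      finally have "n * C * (1 - 2 * (1 - \<delta>) / n) ^ t \<le> n * C * (real n powr (- (\<epsilon> / 4)) / n)"
        using \<delta> by (intro mult_left_mono) (auto simp: C_def)
      also have "\<dots> = C * real n powr (- (\<epsilon> / 4))" using n by simp
      finally show ?thesis by (simp add: E_def C_def)
    qed
    have s0: "0 < s n" "2 * real n \<le> real (s n)" using sL[of n] L0 elim by linarith+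
    have "sep n (T n) \<le> 1 - E n * (1 - exp (- 2 * real (s n) / n)) * (n / (real n + 96)) * (1 - 64 / n) * (1 - 2 * real n / real (s n))\<^sup>2"
      using n by (intro sep_upper_bound[where t=t and \<delta>=\<delta>] \<delta> s0 t(1) Eb elim) auto
    moreover have "b n \<le> E n * (1 - exp (- 2 * real (s n) / n)) * (n / (real n + 96)) * (1 - 64 / n) * (1 - 2 * real n / real (s n))\<^sup>2"
    proof -
      have 1: "1 - exp (- 2 * L n / n) \<le> 1 - exp (- 2 * real (s n) / n)"
        using sL[of n] n by (simp add: divide_right_mono)
      have 2: "1 - 2 * real n / L n \<le> 1 - 2 * real n / real (s n)"
        using sL[of n] L0 by (simp add: frac_le)
      have 3: "0 \<le> 1 - 2 * real n / L n" using elim L0 by simp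
      have 4: "0 \<le> 1 - exp (- 2 * L n / n)" using L0 by simp
      show ?thesis unfolding b_def using 1 2 3 4 elim(2) n
        by (intro mult_mono power_mono mult_nonneg_nonneg) auto
    qed
    ultimately show ?case by linarith
  qed
  have "(\<lambda>n. sep n (T n)) \<longlonglongrightarrow> 0"
  proof (rule tendsto_sandwich[OF _ bound])
    show "\<forall>\<^sub>F n in sequentially. 0 \<le> sep n (T n)" by (simp add: sep_nonneg)
    show "(\<lambda>n. 1 - b n) \<longlonglongrightarrow> 0" using tendsto_diff[OF tendsto_const[of 1] b1] by simp
  qed simp
  then show ?thesis by (simp add: T_def)
qed

lemma sep_lower_limit:
  fixes \<epsilon> :: real
  assumes e: "0 < \<epsilon>" "\<epsilon> < 1"
  shows "(\<lambda>n. sep n (nat \<lfloor>(1 - \<epsilon>) * (1 / 2) * real n * ln (real n)\<rfloor>)) \<longlonglongrightarrow> 1"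
proof -
  define T where "T = (\<lambda>n::nat. nat \<lfloor>(1 - \<epsilon>) * (1 / 2) * real n * ln (real n)\<rfloor>)"
  \<comment> \<open>This is n^\<epsilon> / e^2, a lower bound for the mean number of untouched
    cards. The constant 2 absorbs the quadratic error term of ln (1 - 1 / n), multiplied by (1 -
    \<epsilon>) n ln n.\<close>
  define \<nu> where "\<nu> = (\<lambda>n::nat. exp (\<epsilon> * ln (real n) - 2))"
  have lim: "filterlim \<nu> at_top sequentially" unfolding \<nu>_def using e by real_asymp
  then have ev: "\<forall>\<^sub>F n in sequentially. 2 \<le> \<nu> n" by (simp add: filterlim_at_top)
  have "\<forall>\<^sub>F n in sequentially. 1 - 8 / \<nu> n \<le> sep n (T n)"
    using ev eventually_ge_at_top[of 2]
  proof eventually_elim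
    case (elim n)
    define \<mu> where "\<mu> = real n * (((real n - 1) / real n)\<^sup>2) ^ T n"
    have TU: "2 * real (T n) \<le> (1 - \<epsilon>) * real n * ln (real n)"
    proof -
      have "0 \<le> (1 - \<epsilon>) * (1 / 2) * real n * ln (real n)" using e elim by simp
      then have "real (T n) \<le> (1 - \<epsilon>) * (1 / 2) * real n * ln (real n)" unfolding T_def by (rule of_nat_floor)
      then show ?thesis by simp
    qed
    have q: "0 < 1 - 1 / real n" "(real n - 1) / real n = 1 - 1 / real n" using elim by (auto simp: field_simps)
    have "(((real n - 1) / real n)\<^sup>2) ^ T n = exp (ln (1 - 1 / real n)) ^ (2 * T n)"
      unfolding power_mult[symmetric] using q by simp
    also have "\<dots> = exp (2 * real (T n) * ln (1 - 1 / real n))" by (simp flip: exp_of_nat_mult)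
    also have "\<dots> \<ge> exp ((1 - \<epsilon>) * real n * ln (real n) * ln (1 - 1 / real n))"
      using TU q elim by (simp only: exp_le_cancel_iff) (intro mult_right_mono_neg, auto simp: ln_le_zero_iff)
    finally have "real n * exp ((1 - \<epsilon>) * real n * ln (real n) * ln (1 - 1 / real n)) \<le> \<mu>"
      unfolding \<mu>_def by (intro mult_left_mono) auto
    moreover have "\<nu> n \<le> real n * exp ((1 - \<epsilon>) * real n * ln (real n) * ln (1 - 1 / real n))"
    proof -
      let ?l = "ln (real n)"
      have l: "0 \<le> ?l" "?l \<le> real n" using elim ln_le_minus_one[of "real n"] by auto
      have "- (1 / real n) - 2 * (1 / real n)\<^sup>2 \<le> ln (1 - 1 / real n)"
        using elim by (intro ln_one_minus_pos_lower_bound) (auto simp: field_simps)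
      then have "(1 - \<epsilon>) * real n * ?l * (- (1 / real n) - 2 * (1 / real n)\<^sup>2) \<le> (1 - \<epsilon>) * real n * ?l * ln (1 - 1 / real n)"
        using e l by (intro mult_left_mono) auto
      moreover have "(1 - \<epsilon>) * real n * ?l * (- (1 / real n) - 2 * (1 / real n)\<^sup>2) = - ((1 - \<epsilon>) * ?l) - 2 * ((1 - \<epsilon>) * (?l / real n))"
        using elim by (simp add: power2_eq_square field_simps)
      moreover have "(1 - \<epsilon>) * (?l / real n) \<le> 1 * 1"
        using e l elim by (intro mult_mono) auto
      moreover have "(1 - \<epsilon>) * ?l = ?l - \<epsilon> * ?l" by (simp add: left_diff_distrib)
      ultimately have "\<epsilon> * ?l - 2 \<le> ?l + (1 - \<epsilon>) * real n * ?l * ln (1 - 1 / real n)"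
        by linarith
      then have "\<nu> n \<le> exp (?l + (1 - \<epsilon>) * real n * ?l * ln (1 - 1 / real n))" unfolding \<nu>_def by simp
      also have "\<dots> = real n * exp ((1 - \<epsilon>) * real n * ?l * ln (1 - 1 / real n))"
        using elim by (simp add: exp_add)
      finally show ?thesis .
    qed
    ultimately have \<mu>: "\<nu> n \<le> \<mu>" by linarith
    then have \<mu>2: "2 \<le> \<mu>" using elim by simp
    have "1 - 2 * (\<mu> / (\<mu> - 1)\<^sup>2) \<le> sep n (T n)"
      unfolding \<mu>_def using \<mu>2 elim unfolding \<mu>_def by (intro sep_ge) auto
    moreover have "\<mu> / (\<mu> - 1)\<^sup>2 \<le> 4 / \<nu> n"
    proof -
      have "(\<mu> / 2)\<^sup>2 \<le> (\<mu> - 1)\<^sup>2" using \<mu>2 by (intro power_mono) auto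
      then have "\<mu> / (\<mu> - 1)\<^sup>2 \<le> \<mu> / (\<mu> / 2)\<^sup>2" using \<mu>2 by (intro divide_left_mono) auto
      also have "\<dots> = 4 / \<mu>" using \<mu>2 by (simp add: power2_eq_square)
      also have "\<dots> \<le> 4 / \<nu> n" using \<mu> elim by (intro divide_left_mono) auto
      finally show ?thesis .
    qed
    ultimately show ?case by simp
  qed
  moreover have "(\<lambda>n. 1 - 8 / \<nu> n) \<longlonglongrightarrow> 1"
  proof -
    have "(\<lambda>n. 8 / \<nu> n) \<longlonglongrightarrow> 0"
      using lim by (intro tendsto_divide_0[OF tendsto_const] filterlim_at_top_imp_at_infinity)
    then show ?thesis using tendsto_diff[OF tendsto_const[of 1]] by fastforce
  qed
  ultimately have "(\<lambda>n. sep n (T n)) \<longlonglongrightarrow> 1"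
    by (intro tendsto_sandwich[where g="\<lambda>n. sep n (T n)" and h="\<lambda>_. 1"]) (auto simp: sep_le_1)
  then show ?thesis by (simp add: T_def)
qed

theorem theorem1:
  fixes \<epsilon> :: real
  assumes "0 < \<epsilon>" and "\<epsilon> < 1"
  shows "(\<lambda>n. sep n (nat \<lfloor>(1 - \<epsilon>) * (1 / 2) * real n * ln (real n)\<rfloor>)) \<longlonglongrightarrow> 1
       \<and> (\<lambda>n. sep n (nat \<lceil>(1 + \<epsilon>) * (1 / 2) * real n * ln (real n)\<rceil>)) \<longlonglongrightarrow> 0"
using sep_lower_limit[OF assms] sep_upper_limit[OF assms] by blast

end
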